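(* Let $A$ and $A'$ be Lie algebroids over a smooth manifold $M$, let $B,C,B',C'$ be vector bundles over $M$, and let $D=A\oplus B\oplus C$ and $D'=A'\oplus B'\oplus C'$ be the trivial double vector bundles with cores $C$ and $C'$. Suppose $D$ and $D'$ carry $\mathcal{VB}$-algebroid structures $(D\to B;A\to M)$ and $(D'\to B';A'\to M)$ with base Lie algebroids $A$ and $A'$, and let $V=C_{[0]}\oplus B_{[1]}$ and $W=C'_{[0]}\oplus B'_{[1]}$ be the associated 2-term representations up to homotopy of $A$ and $A'$, respectively. Let $F:D\to D'$ be a double vector bundle morphism over $\mathrm{id}_M$, written $$F(a,b,c)=\big(F_{\rm ver}(a),\,F_{\rm hor}(b),\,F_c(c)+\Phi_a(b)\big),$$ with vector bundle morphisms $F_{\rm ver}:A\to A'$, $F_{\rm hor}:B\to B'$, $F_c:C\to C'$ and $\Phi\in\Omega^1(A;\mathrm{Hom}(B,C'))$. Then $F$ is a $\mathcal{VB}$-algebroid morphism if and only if $F_{\rm ver}:A\to A'$ is a Lie algebroid morphism and $(F_c,F_{\rm hor},\Phi)$ are the components of a morphism $(A,V)\Rightarrow(A',W)$ over $F_{\rm ver}$.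
   Context: **2-term representations up to homotopy.** For a Lie algebroid $(A,[\cdot,\cdot]_A,\rho_A)$ over $M$ and a graded vector bundle $V=V_0\oplus V_1$ (degrees 0 and 1), a representation up to homotopy of $A$ on $V$ is given by structure operators $(\partial,\nabla,K)$: a bundle map $\partial:V_0\to V_1$; $A$-connections $\nabla^0$ on $V_0$, $\nabla^1$ on $V_1$ with $\partial\circ\nabla^0_a=\nabla^1_a\circ\partial$; and $K\in\Omega^2(A;\mathrm{Hom}(V_1,V_0))$ with $d_{\nabla^{\rm End}}K=0$ (Koszul differential for the induced connection on $\mathrm{Hom}(V_1,V_0)$), $R_{\nabla^0}=-K\circ\partial$, $R_{\nabla^1}=-\partial\circ K$. The notation $E_{[0]}\oplus E'_{[1]}$ means $E$ in degree 0 and $E'$ in degree 1. A morphism $(A,V)\Rightarrow(A,W)$ between two such representations of $A$ is a triple $(\phi_0,\phi_1,\Phi)$ of bundle maps $\phi_i:V_i\to W_i$ and $\Phi\in\Omega^1(A;\mathrm{Hom}(V_1,W_0))$ with $\phi_1\circ\partial_V=\partial_W\circ\phi_0$; $\nabla^{\rm Hom}_a\phi_0=\Phi_a\circ\partial_V$ and $\nabla^{\rm Hom}_a\phi_1=\partial_W\circ\Phi_a$ for all $a\in\Gamma(A)$; $d_{\nabla^{\rm Hom}}\Phi=\phi_0\circ K_V-K_W\circ\phi_1$. Here $\nabla^{\rm Hom}_a\phi=\nabla^W_a\circ\phi-\phi\circ\nabla^V_a$. If $T:A\to A'$ is a Lie algebroid morphism over $\mathrm{id}_M$ and $W$ is a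 2-term representation up to homotopy of $A'$ with structure operators $(\partial,\nabla,K)$, its pullback $T^!W$ is the representation up to homotopy of $A$ on $W$ with structure operators $(\partial,\nabla^T,T^*K)$, $\nabla^T_aw=\nabla_{T(a)}w$, $T^*K(a_1,a_2)=K(T(a_1),T(a_2))$. A morphism $(A,V)\Rightarrow(A',W)$ over $T$ is a morphism $(A,V)\Rightarrow(A,T^!W)$. **Double vector bundles.** A double vector bundle $(D;A,B;M)$ is a commutative square of vector bundles $D\to B$, $D\to A$, $A\to M$, $B\to M$ such that $D\to B$ is a vector bundle morphism over $A\to M$ and the addition of $D\to B$ is a vector bundle morphism over the addition of $A\to M$. Its core $C$ is the intersection of the kernels of $D\to A$ and $D\to B$, a vector bundle over $M$. Double vector bundle morphisms are maps that are vector bundle morphisms for all the vector bundle structures. The trivial double vector bundle with core $C$ is $A\oplus B\oplus C$, with $D\to A$ the pullback of $B\oplus C$ to $A$ and $D\to B$ the pullback of $A\oplus C$ to $B$. For $c\in\Gamma(C)$ the core section $\widehat c\in\Gamma(B,D)$ is $b_m\mapsto(0,b_m,c(m))$. A section of $D\to B$ is linear if it is a vector bundle morphism from $B\to M$ to $D\to A$. For $a\in\Gamma(A)$ let $h(a)\in\Gamma(B,D)$ be the linear section $b_m\mapsto(a(m),b_m,0)$, and for $T\in\Gamma(B^*\otimes C)$ let $\widehat T$ be the linear section $b_m\mapsto(0,b_m,T(b_m))$. **$\mathcal{VB}$-algebroids.** $(D\to B;A\to M)$ is a $\mathcal{VB}$-algebroid if $D\to B$ is a Lie algebroid whose anchor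 $\rho_D:D\to TB$ is a bundle morphism over a map $\rho_A:A\to TM$, brackets of linear sections are linear, the bracket of a linear and a core section is a core section, and core sections have zero bracket. It induces a Lie algebroid structure on $A$ (the base Lie algebroid): anchor $\rho_A$, and if linear sections $\mathcal X,\mathcal Y$ cover $\mathcal X_0,\mathcal Y_0\in\Gamma(A)$ then $[\mathcal X,\mathcal Y]_D$ covers $[\mathcal X_0,\mathcal Y_0]_A$. A $\mathcal{VB}$-algebroid morphism is a double vector bundle morphism $F:D\to D'$ that is a Lie algebroid morphism from $D\to B$ to $D'\to B'$. **Associated representation.** $\mathcal{VB}$-algebroid structures on the trivial double vector bundle $A\oplus B\oplus C$ with base Lie algebroid $A$ correspond bijectively to representations up to homotopy $(\partial,\nabla,K)$ of $A$ on $C_{[0]}\oplus B_{[1]}$ via: $\rho_D(h(a))=X_{\nabla^1_a}$, the linear vector field on $B$ with $X(\ell_\psi)=\ell_{(\nabla^1_a)^*\psi}$ for $\psi\in\Gamma(B^* )$ ($\ell_\psi$ the fibrewise linear function of $\psi$, $(\nabla^1)^*$ the dual connection), covering $\rho_A(a)$; $\rho_D(\widehat c)=\partial(c)^\uparrow$ (vertical lift); $[\widehat c_1,\widehat c_2]_D=0$; $[h(a),\widehat c]_D=\widehat{\nabla^0_ac}$; $[h(a_1),h(a_2)]_D=h([a_1,a_2]_A)+\widehat{K(a_1,a_2)}$. *)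

theory Defs
  imports "HOL-Analysis.Analysis"
begin

section \<open>Smooth manifolds\<close>

text \<open>
  The class \<open>euclidean_space\<close> has no member of dimension 0. Charts and fibre coordinates therefore
  take values in a linear subspace of a Euclidean space, so that manifolds of dimension 0 and bundles
  of rank 0 are included. Accordingly smoothness is defined on arbitrary subsets, by local smooth
  extension; \<open>ck_on\<close> (k times continuously differentiable) is only meant for open sets.
\<close>

primrec ck_on :: "nat \<Rightarrow> 'e::real_normed_vector set \<Rightarrow> ('e \<Rightarrow> 'f::real_normed_vector) \<Rightarrow> bool" where
  "ck_on 0 S f \<longleftrightarrow> continuous_on S f"
| "ck_on (Suc k) S f \<longleftrightarrow>
     (\<forall>x\<in>S. f differentiable (at x)) \<and> (\<forall>v. ck_on k S (\<lambda>x. frechet_derivative f (at x) v))"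

definition smooth_on :: "'e::real_normed_vector set \<Rightarrow> ('e \<Rightarrow> 'f::real_normed_vector) \<Rightarrow> bool" where
  "smooth_on S f \<longleftrightarrow>
     (\<forall>x\<in>S. \<exists>U g. open U \<and> x \<in> U \<and> (\<forall>k. ck_on k U g) \<and> (\<forall>y\<in>S \<inter> U. f y = g y))"

record ('m, 'e) manifold =
  points :: "'m set"
  model :: "'e set"
  atlas :: "('m set \<times> ('m \<Rightarrow> 'e)) set"

definition smooth_atlas :: "('m, 'e::euclidean_space) manifold \<Rightarrow> bool" where
  "smooth_atlas M \<longleftrightarrow>
     subspace (model M) \<and>
     (\<Union>(U, \<phi>)\<in>atlas M. U) = points M \<and>
     (\<forall>(U, \<phi>)\<in>atlas M. inj_on \<phi> U \<and> openin (top_of_set (model M)) (\<phi> ` U)) \<and>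
     (\<forall>(U, \<phi>)\<in>atlas M. \<forall>(V, \<psi>)\<in>atlas M.
        openin (top_of_set (model M)) (\<phi> ` (U \<inter> V)) \<and>
        smooth_on (\<phi> ` (U \<inter> V)) (\<psi> \<circ> inv_into U \<phi>))"

text \<open>The topology of a manifold is the one determined by its atlas.\<close>

definition mfd_open :: "('m, 'e::euclidean_space) manifold \<Rightarrow> 'm set \<Rightarrow> bool" where
  "mfd_open M W \<longleftrightarrow>
     W \<subseteq> points M \<and> (\<forall>(U, \<phi>)\<in>atlas M. openin (top_of_set (model M)) (\<phi> ` (W \<inter> U)))"

definition mfd_topology :: "('m, 'e::euclidean_space) manifold \<Rightarrow> 'm topology" where
  "mfd_topology M = topology (mfd_open M)"

lemma openin_mfd_topology:
  assumes "smooth_atlas M"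
  shows "openin (mfd_topology M) W \<longleftrightarrow> mfd_open M W"
proof -
  have inj: "inj_on \<phi> U" if "(U, \<phi>) \<in> atlas M" for U \<phi>
    using assms that unfolding smooth_atlas_def by blast
  have "mfd_open M (S \<inter> T)" if S: "mfd_open M S" and T: "mfd_open M T" for S T
  proof -
    have "openin (top_of_set (model M)) (\<phi> ` (S \<inter> T \<inter> U))" if U: "(U, \<phi>) \<in> atlas M" for U \<phi>
    proof -
      have "\<phi> ` (S \<inter> T \<inter> U) = \<phi> ` (S \<inter> U) \<inter> \<phi> ` (T \<inter> U)"
        using inj[OF U] by (auto simp: inj_on_def)
      then show ?thesis
        using S T U unfolding mfd_open_def by auto
    qed
    then show ?thesis
      using S unfolding mfd_open_def by auto
  qed
  moreover have "mfd_open M (\<Union>\<K>)" if K: "\<forall>K\<in>\<K>. mfd_open M K" for \<K>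
  proof -
    have "openin (top_of_set (model M)) (\<phi> ` (\<Union>\<K> \<inter> U))" if U: "(U, \<phi>) \<in> atlas M" for U \<phi>
    proof -
      have "\<phi> ` (\<Union>\<K> \<inter> U) = (\<Union>K\<in>\<K>. \<phi> ` (K \<inter> U))"
        by auto
      moreover have "\<forall>K\<in>\<K>. openin (top_of_set (model M)) (\<phi> ` (K \<inter> U))"
        using K U unfolding mfd_open_def by blast
      ultimately show ?thesis
        by (metis (no_types, lifting) openin_Union image_iff)
    qed
    then show ?thesis
      using K unfolding mfd_open_def by auto
  qed
  ultimately have "istopology (mfd_open M)"
    unfolding istopology_def by blast
  then show ?thesis
    by (simp add: mfd_topology_def topology_inverse')
qed

definition smooth_manifold :: "('m, 'e::euclidean_space) manifold \<Rightarrow> bool" where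
  "smooth_manifold M \<longleftrightarrow>
     smooth_atlas M \<and> Hausdorff_space (mfd_topology M) \<and>
     second_countable (mfd_topology M)"

definition smooth_map ::
  "('m, 'e::euclidean_space) manifold \<Rightarrow> ('n, 'k::euclidean_space) manifold \<Rightarrow> ('m \<Rightarrow> 'n) \<Rightarrow> bool" where
  "smooth_map M N f \<longleftrightarrow>
     f ` points M \<subseteq> points N \<and>
     (\<forall>(U, \<phi>)\<in>atlas M. \<forall>(V, \<psi>)\<in>atlas N.
        openin (top_of_set (model M)) (\<phi> ` (U \<inter> f -` V)) \<and>
        smooth_on (\<phi> ` (U \<inter> f -` V)) (\<psi> \<circ> f \<circ> inv_into U \<phi>))"

text \<open>Smoothness of a vector-valued function on an open subset \<open>W\<close> of \<open>M\<close>.\<close>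

definition smooth_fun_on ::
  "('m, 'e::euclidean_space) manifold \<Rightarrow> 'm set \<Rightarrow> ('m \<Rightarrow> 'f::real_normed_vector) \<Rightarrow> bool" where
  "smooth_fun_on M W f \<longleftrightarrow> (\<forall>(U, \<phi>)\<in>atlas M. smooth_on (\<phi> ` (U \<inter> W)) (f \<circ> inv_into U \<phi>))"

text \<open>\<open>C\<^sup>\<infinity>(M)\<close>; the values of a member outside \<open>points M\<close> are irrelevant.\<close>

definition smooth_funs :: "('m, 'e::euclidean_space) manifold \<Rightarrow> ('m \<Rightarrow> real) set" where
  "smooth_funs M = {f. smooth_fun_on M (points M) f}"

text \<open>
  Tangent vectors are point derivations of \<open>C\<^sup>\<infinity>(M)\<close>. They are only compared on \<open>C\<^sup>\<infinity>(M)\<close>, by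
  \<open>tv_eq\<close>.
\<close>

definition tangent_vector ::
  "('m, 'e::euclidean_space) manifold \<Rightarrow> 'm \<Rightarrow> (('m \<Rightarrow> real) \<Rightarrow> real) \<Rightarrow> bool" where
  "tangent_vector M p v \<longleftrightarrow>
     p \<in> points M \<and>
     (\<forall>f\<in>smooth_funs M. \<forall>g\<in>smooth_funs M.
        v (\<lambda>x. f x + g x) = v f + v g \<and> v (\<lambda>x. f x * g x) = f p * v g + g p * v f) \<and>
     (\<forall>f\<in>smooth_funs M. \<forall>r. v (\<lambda>x. r * f x) = r * v f)"

definition tv_eq ::
  "('m, 'e::euclidean_space) manifold \<Rightarrow>
   (('m \<Rightarrow> real) \<Rightarrow> real) \<Rightarrow> (('m \<Rightarrow> real) \<Rightarrow> real) \<Rightarrow> bool" where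
  "tv_eq M v w \<longleftrightarrow> (\<forall>f\<in>smooth_funs M. v f = w f)"

text \<open>The tangent map \<open>Tf\<close>.\<close>

definition pushforward :: "('m \<Rightarrow> 'n) \<Rightarrow> (('m \<Rightarrow> real) \<Rightarrow> real) \<Rightarrow> (('n \<Rightarrow> real) \<Rightarrow> real)" where
  "pushforward f v = (\<lambda>g. v (g \<circ> f))"


section \<open>Vector bundles\<close>

text \<open>
  A vector bundle is a family of vector spaces \<open>fibre E m\<close> with an atlas of fibrewise linear
  trivializations and smooth transition functions. The fibres are subspaces of one real vector space
  type. This is no restriction: it can be the direct sum of all fibres. In particular the fibres over
  different points need not be related as subspaces.
\<close>

record ('m, 'e, 'v, 'f) vbundle =
  base :: "('m, 'e) manifold"
  fibre :: "'m \<Rightarrow> 'v set"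
  fmodel :: "'f set"
  trivs :: "('m set \<times> ('m \<Rightarrow> 'v \<Rightarrow> 'f)) set"

definition lin_on :: "'v::real_vector set \<Rightarrow> ('v \<Rightarrow> 'w::real_vector) \<Rightarrow> bool" where
  "lin_on S f \<longleftrightarrow>
     (\<forall>x\<in>S. \<forall>y\<in>S. f (x + y) = f x + f y) \<and> (\<forall>r. \<forall>x\<in>S. f (r *\<^sub>R x) = r *\<^sub>R f x)"

definition vector_bundle ::
  "('m, 'e::euclidean_space, 'v::real_vector, 'f::euclidean_space) vbundle \<Rightarrow> bool" where
  "vector_bundle E \<longleftrightarrow>
     smooth_manifold (base E) \<and>
     subspace (fmodel E) \<and>
     (\<forall>m\<in>points (base E). subspace (fibre E m)) \<and>
     (\<Union>(U, \<tau>)\<in>trivs E. U) = points (base E) \<and>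
     (\<forall>(U, \<tau>)\<in>trivs E. openin (mfd_topology (base E)) U \<and>
        (\<forall>m\<in>U. lin_on (fibre E m) (\<tau> m) \<and> bij_betw (\<tau> m) (fibre E m) (fmodel E))) \<and>
     (\<forall>(U, \<tau>)\<in>trivs E. \<forall>(V, \<sigma>)\<in>trivs E. \<forall>x\<in>fmodel E.
        smooth_fun_on (base E) (U \<inter> V) (\<lambda>m. \<sigma> m (inv_into (fibre E m) (\<tau> m) x)))"

definition total ::
  "('m, 'e, 'v, 'f) vbundle \<Rightarrow> ('m \<times> 'v, 'e::euclidean_space \<times> 'f::euclidean_space) manifold" where
  "total E =
     \<lparr>points = Sigma (points (base E)) (fibre E),
      model = model (base E) \<times> fmodel E,
      atlas = {(Sigma (U \<inter> V) (fibre E), \<lambda>(m, v). (\<phi> m, \<tau> m v)) | U \<phi> V \<tau>.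
                 (U, \<phi>) \<in> atlas (base E) \<and> (V, \<tau>) \<in> trivs E}\<rparr>"

text \<open>Sections are normalized to vanish outside the base, so that they are equal as functions.\<close>

definition sections ::
  "('m, 'e::euclidean_space, 'v::real_vector, 'f::euclidean_space) vbundle \<Rightarrow> ('m \<Rightarrow> 'v) set"
  ("\<Gamma>") where
  "\<Gamma> E = {s. (\<forall>m\<in>points (base E). s m \<in> fibre E m) \<and> (\<forall>m. m \<notin> points (base E) \<longrightarrow> s m = 0) \<and>
             smooth_map (base E) (total E) (\<lambda>m. (m, s m))}"

definition off_zero :: "('m, 'e) manifold \<Rightarrow> ('m \<Rightarrow> 'v::real_vector) \<Rightarrow> 'm \<Rightarrow> 'v" where
  "off_zero M s = (\<lambda>m. if m \<in> points M then s m else 0)"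

text \<open>\<open>G\<close> is a map of total spaces and \<open>f\<close> the map it covers.\<close>

definition vb_morphism ::
  "('m, 'e::euclidean_space, 'v::real_vector, 'f::euclidean_space) vbundle \<Rightarrow>
   ('n, 'k::euclidean_space, 'w::real_vector, 'g::euclidean_space) vbundle \<Rightarrow>
   ('m \<Rightarrow> 'n) \<Rightarrow> ('m \<times> 'v \<Rightarrow> 'n \<times> 'w) \<Rightarrow> bool" where
  "vb_morphism E E' f G \<longleftrightarrow>
     smooth_map (base E) (base E') f \<and> smooth_map (total E) (total E') G \<and>
     (\<forall>m\<in>points (base E).
        (\<forall>e\<in>fibre E m. fst (G (m, e)) = f m) \<and> lin_on (fibre E m) (\<lambda>e. snd (G (m, e))))"

text \<open>Bundle maps over the identity are given by their fibre maps \<open>\<phi> m : E\<^sub>m \<Rightarrow> E'\<^sub>m\<close>.\<close>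

definition total_map :: "('m \<Rightarrow> 'v \<Rightarrow> 'w) \<Rightarrow> 'm \<times> 'v \<Rightarrow> 'm \<times> 'w" where
  "total_map \<phi> = (\<lambda>(m, e). (m, \<phi> m e))"

definition bundle_map ::
  "('m, 'e::euclidean_space, 'v::real_vector, 'f::euclidean_space) vbundle \<Rightarrow>
   ('m, 'e, 'w::real_vector, 'g::euclidean_space) vbundle \<Rightarrow> ('m \<Rightarrow> 'v \<Rightarrow> 'w) \<Rightarrow> bool" where
  "bundle_map E E' \<phi> \<longleftrightarrow> base E = base E' \<and> vb_morphism E E' id (total_map \<phi>)"

definition apply_map ::
  "('m, 'e) manifold \<Rightarrow> ('m \<Rightarrow> 'v \<Rightarrow> 'w::real_vector) \<Rightarrow> ('m \<Rightarrow> 'v) \<Rightarrow> 'm \<Rightarrow> 'w" where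
  "apply_map M \<phi> s = off_zero M (\<lambda>m. \<phi> m (s m))"

definition dual_sections ::
  "('m, 'e::euclidean_space, 'v::real_vector, 'f::euclidean_space) vbundle \<Rightarrow>
   ('m \<Rightarrow> 'v \<Rightarrow> real) set" where
  "dual_sections E =
     {\<psi>. (\<forall>m\<in>points (base E). lin_on (fibre E m) (\<psi> m)) \<and>
          (\<forall>s\<in>\<Gamma> E. (\<lambda>m. \<psi> m (s m)) \<in> smooth_funs (base E))}"

definition lin_fun :: "('m \<Rightarrow> 'v \<Rightarrow> real) \<Rightarrow> 'm \<times> 'v \<Rightarrow> real" ("\<ell>") where
  "\<ell> \<psi> = (\<lambda>(m, e). \<psi> m e)"

definition pullback_bundle ::
  "('n, 'k) manifold \<Rightarrow> ('n \<Rightarrow> 'm) \<Rightarrow> ('m, 'e, 'v, 'f) vbundle \<Rightarrow> ('n, 'k, 'v, 'f) vbundle" where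
  "pullback_bundle N f E =
     \<lparr>base = N, fibre = (\<lambda>n. fibre E (f n)), fmodel = fmodel E,
      trivs = {(points N \<inter> f -` U, \<lambda>n. \<tau> (f n)) | U \<tau>. (U, \<tau>) \<in> trivs E}\<rparr>"

definition direct_sum ::
  "('m, 'e, 'v, 'f) vbundle \<Rightarrow> ('m, 'e, 'w, 'g) vbundle \<Rightarrow> ('m, 'e, 'v \<times> 'w, 'f \<times> 'g) vbundle"
  (infixr "\<oplus>\<^sub>b" 65) where
  "E \<oplus>\<^sub>b E' =
     \<lparr>base = base E, fibre = (\<lambda>m. fibre E m \<times> fibre E' m), fmodel = fmodel E \<times> fmodel E',
      trivs = {(U \<inter> V, \<lambda>m. \<lambda>(x, y). (\<tau> m x, \<sigma> m y)) | U \<tau> V \<sigma>.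
                 (U, \<tau>) \<in> trivs E \<and> (V, \<sigma>) \<in> trivs E'}\<rparr>"

text \<open>
  \<open>\<Omega>\<^sup>1(A; Hom(E, E'))\<close> and \<open>\<Omega>\<^sup>2(A; Hom(E, E'))\<close>. A fibrewise multilinear map is smooth if it maps
  smooth sections to smooth sections.
\<close>

definition hom_one_forms ::
  "('m, 'e::euclidean_space, 'a::real_vector, 'h::euclidean_space) vbundle \<Rightarrow>
   ('m, 'e, 'v::real_vector, 'f::euclidean_space) vbundle \<Rightarrow>
   ('m, 'e, 'w::real_vector, 'g::euclidean_space) vbundle \<Rightarrow> ('m \<Rightarrow> 'a \<Rightarrow> 'v \<Rightarrow> 'w) set" where
  "hom_one_forms A E E' =
     {\<Phi>. (\<forall>m\<in>points (base A).
            (\<forall>a\<in>fibre A m. lin_on (fibre E m) (\<Phi> m a) \<and> \<Phi> m a ` fibre E m \<subseteq> fibre E' m) \<and>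
            (\<forall>e\<in>fibre E m. lin_on (fibre A m) (\<lambda>a. \<Phi> m a e))) \<and>
          (\<forall>a\<in>\<Gamma> A. \<forall>s\<in>\<Gamma> E. off_zero (base A) (\<lambda>m. \<Phi> m (a m) (s m)) \<in> \<Gamma> E')}"

definition hom_two_forms ::
  "('m, 'e::euclidean_space, 'a::real_vector, 'h::euclidean_space) vbundle \<Rightarrow>
   ('m, 'e, 'v::real_vector, 'f::euclidean_space) vbundle \<Rightarrow>
   ('m, 'e, 'w::real_vector, 'g::euclidean_space) vbundle \<Rightarrow>
   ('m \<Rightarrow> 'a \<Rightarrow> 'a \<Rightarrow> 'v \<Rightarrow> 'w) set" where
  "hom_two_forms A E E' =
     {K. (\<forall>m\<in>points (base A). \<forall>a\<in>fibre A m.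
            (\<forall>b\<in>fibre A m. lin_on (fibre E m) (K m a b) \<and> K m a b ` fibre E m \<subseteq> fibre E' m) \<and>
            (\<forall>e\<in>fibre E m. lin_on (fibre A m) (\<lambda>b. K m a b e)) \<and>
            (\<forall>b\<in>fibre A m. \<forall>e\<in>fibre E m. K m a b e = - K m b a e)) \<and>
          (\<forall>a\<in>\<Gamma> A. \<forall>b\<in>\<Gamma> A. \<forall>s\<in>\<Gamma> E. off_zero (base A) (\<lambda>m. K m (a m) (b m) (s m)) \<in> \<Gamma> E')}"


section \<open>Lie algebroids\<close>

text \<open>The anchor sends \<open>a \<in> A\<^sub>m\<close> to a derivation \<open>anchor A m a\<close> at \<open>m\<close>.\<close>

record ('m, 'e, 'v, 'f) lie_algd =
  vbun :: "('m, 'e, 'v, 'f) vbundle"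
  anchor :: "'m \<Rightarrow> 'v \<Rightarrow> ('m \<Rightarrow> real) \<Rightarrow> real"
  bracket :: "('m \<Rightarrow> 'v) \<Rightarrow> ('m \<Rightarrow> 'v) \<Rightarrow> 'm \<Rightarrow> 'v"

text \<open>
  Smooth bundle maps \<open>E \<Rightarrow> TM\<close>; smoothness says that a section \<open>s\<close> is mapped to a smooth vector field,
  i.e. to a derivation of \<open>C\<^sup>\<infinity>(M)\<close>.
\<close>

definition bundle_map_to_tangent ::
  "('m, 'e::euclidean_space, 'v::real_vector, 'f::euclidean_space) vbundle \<Rightarrow>
   ('m \<Rightarrow> 'v \<Rightarrow> ('m \<Rightarrow> real) \<Rightarrow> real) \<Rightarrow> bool" where
  "bundle_map_to_tangent E \<rho> \<longleftrightarrow>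
     (\<forall>m\<in>points (base E).
        (\<forall>e\<in>fibre E m. tangent_vector (base E) m (\<rho> m e)) \<and>
        (\<forall>f\<in>smooth_funs (base E). lin_on (fibre E m) (\<lambda>e. \<rho> m e f))) \<and>
     (\<forall>s\<in>\<Gamma> E. \<forall>f\<in>smooth_funs (base E). (\<lambda>m. \<rho> m (s m) f) \<in> smooth_funs (base E))"

definition lie_algebroid ::
  "('m, 'e::euclidean_space, 'v::real_vector, 'f::euclidean_space) lie_algd \<Rightarrow> bool" where
  "lie_algebroid A \<longleftrightarrow>
     (let E = vbun A; br = bracket A in
      vector_bundle E \<and>
      bundle_map_to_tangent E (anchor A) \<and>
      (\<forall>X\<in>\<Gamma> E. \<forall>Y\<in>\<Gamma> E. br X Y \<in> \<Gamma> E \<and> br X Y = (\<lambda>m. - br Y X m)) \<and>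
      (\<forall>X\<in>\<Gamma> E. \<forall>Y\<in>\<Gamma> E. \<forall>Z\<in>\<Gamma> E. br X (\<lambda>m. Y m + Z m) = (\<lambda>m. br X Y m + br X Z m)) \<and>
      (\<forall>X\<in>\<Gamma> E. \<forall>Y\<in>\<Gamma> E. \<forall>r. br X (\<lambda>m. r *\<^sub>R Y m) = (\<lambda>m. r *\<^sub>R br X Y m)) \<and>
      (\<forall>X\<in>\<Gamma> E. \<forall>Y\<in>\<Gamma> E. \<forall>Z\<in>\<Gamma> E.
         (\<lambda>m. br X (br Y Z) m + br Y (br Z X) m + br Z (br X Y) m) = (\<lambda>m. 0)) \<and>
      (\<forall>X\<in>\<Gamma> E. \<forall>Y\<in>\<Gamma> E. \<forall>f\<in>smooth_funs (base E).
         br X (\<lambda>m. f m *\<^sub>R Y m) = (\<lambda>m. f m *\<^sub>R br X Y m + anchor A m (X m) f *\<^sub>R Y m)))"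

text \<open>
  Lie algebroid morphisms over an arbitrary base map \<open>f\<close>, following Higgins and Mackenzie. A list
  \<open>ds\<close> of pairs \<open>(u\<^sub>i, X\<^sub>i)\<close> encodes the section \<open>\<Sum> u\<^sub>i (X\<^sub>i \<circ> f)\<close> of \<open>f\<^sup>!E'\<close>; \<open>G \<circ> X\<close> always has such a
  decomposition, and the bracket condition is imposed for all of them.
\<close>

definition decomposes ::
  "('m, 'e::euclidean_space, 'v::real_vector, 'f::euclidean_space) vbundle \<Rightarrow>
   ('n, 'k::euclidean_space, 'w::real_vector, 'g::euclidean_space) vbundle \<Rightarrow>
   ('m \<Rightarrow> 'n) \<Rightarrow> ('m \<times> 'v \<Rightarrow> 'n \<times> 'w) \<Rightarrow> ('m \<Rightarrow> 'v) \<Rightarrow> (('m \<Rightarrow> real) \<times> ('n \<Rightarrow> 'w)) list \<Rightarrow> bool" where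
  "decomposes E E' f G X ds \<longleftrightarrow>
     set ds \<subseteq> smooth_funs (base E) \<times> \<Gamma> E' \<and>
     (\<forall>m\<in>points (base E). snd (G (m, X m)) = (\<Sum>(u, X')\<leftarrow>ds. u m *\<^sub>R X' (f m)))"

definition la_morphism ::
  "('m, 'e::euclidean_space, 'v::real_vector, 'f::euclidean_space) lie_algd \<Rightarrow>
   ('n, 'k::euclidean_space, 'w::real_vector, 'g::euclidean_space) lie_algd \<Rightarrow>
   ('m \<Rightarrow> 'n) \<Rightarrow> ('m \<times> 'v \<Rightarrow> 'n \<times> 'w) \<Rightarrow> bool" where
  "la_morphism A A' f G \<longleftrightarrow>
     (let E = vbun A; E' = vbun A'; M = base E in
      vb_morphism E E' f G \<and>
      (\<forall>m\<in>points M. \<forall>e\<in>fibre E m.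
         tv_eq (base E') (anchor A' (f m) (snd (G (m, e)))) (pushforward f (anchor A m e))) \<and>
      (\<forall>X\<in>\<Gamma> E. \<forall>Y\<in>\<Gamma> E. \<forall>ds es.
         decomposes E E' f G X ds \<and> decomposes E E' f G Y es \<longrightarrow>
         (\<forall>m\<in>points M.
            snd (G (m, bracket A X Y m)) =
              (\<Sum>(u, X')\<leftarrow>ds. \<Sum>(v, Y')\<leftarrow>es. (u m * v m) *\<^sub>R bracket A' X' Y' (f m))
            + (\<Sum>(v, Y')\<leftarrow>es. anchor A m (X m) v *\<^sub>R Y' (f m))
            - (\<Sum>(u, X')\<leftarrow>ds. anchor A m (Y m) u *\<^sub>R X' (f m)))))"

definition connection ::
  "('m, 'e::euclidean_space, 'a::real_vector, 'h::euclidean_space) lie_algd \<Rightarrow>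
   ('m, 'e, 'v::real_vector, 'f::euclidean_space) vbundle \<Rightarrow>
   (('m \<Rightarrow> 'a) \<Rightarrow> ('m \<Rightarrow> 'v) \<Rightarrow> 'm \<Rightarrow> 'v) \<Rightarrow> bool" where
  "connection A E nab \<longleftrightarrow>
     (\<forall>a\<in>\<Gamma> (vbun A). \<forall>s\<in>\<Gamma> E. nab a s \<in> \<Gamma> E) \<and>
     (\<forall>a\<in>\<Gamma> (vbun A). \<forall>s\<in>\<Gamma> E. \<forall>t\<in>\<Gamma> E. nab a (\<lambda>m. s m + t m) = (\<lambda>m. nab a s m + nab a t m)) \<and>
     (\<forall>a\<in>\<Gamma> (vbun A). \<forall>b\<in>\<Gamma> (vbun A). \<forall>s\<in>\<Gamma> E.
        nab (\<lambda>m. a m + b m) s = (\<lambda>m. nab a s m + nab b s m)) \<and>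
     (\<forall>a\<in>\<Gamma> (vbun A). \<forall>s\<in>\<Gamma> E. \<forall>f\<in>smooth_funs (base E).
        nab (\<lambda>m. f m *\<^sub>R a m) s = (\<lambda>m. f m *\<^sub>R nab a s m) \<and>
        nab a (\<lambda>m. f m *\<^sub>R s m) = (\<lambda>m. f m *\<^sub>R nab a s m + anchor A m (a m) f *\<^sub>R s m))"

text \<open>\<open>\<nabla>\<^sup>H\<^sup>o\<^sup>m\<^sub>a \<phi> = \<nabla>'\<^sub>a \<circ> \<phi> - \<phi> \<circ> \<nabla>\<^sub>a\<close>, applied to a section \<open>s\<close>.\<close>

definition hom_conn ::
  "('m, 'e) manifold \<Rightarrow>
   (('m \<Rightarrow> 'a) \<Rightarrow> ('m \<Rightarrow> 'v) \<Rightarrow> 'm \<Rightarrow> 'v) \<Rightarrow> (('m \<Rightarrow> 'a) \<Rightarrow> ('m \<Rightarrow> 'w) \<Rightarrow> 'm \<Rightarrow> 'w::real_vector) \<Rightarrow>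
   ('m \<Rightarrow> 'a) \<Rightarrow> ('m \<Rightarrow> 'v \<Rightarrow> 'w) \<Rightarrow> ('m \<Rightarrow> 'v) \<Rightarrow> 'm \<Rightarrow> 'w" where
  "hom_conn M nab nab' a \<phi> s = (\<lambda>m. nab' a (apply_map M \<phi> s) m - \<phi> m (nab a s m))"

text \<open>
  The Koszul differentials of \<open>\<Phi> \<in> \<Omega>\<^sup>1(A; Hom(E, E'))\<close> and \<open>K \<in> \<Omega>\<^sup>2(A; Hom(E, E'))\<close> for \<open>\<nabla>\<^sup>H\<^sup>o\<^sup>m\<close>, evaluated on
  sections of \<open>A\<close> and applied to a section \<open>s\<close> of \<open>E\<close>.
\<close>

definition koszul_d1 ::
  "('m, 'e, 'a, 'h) lie_algd \<Rightarrow>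
   (('m \<Rightarrow> 'a) \<Rightarrow> ('m \<Rightarrow> 'v) \<Rightarrow> 'm \<Rightarrow> 'v) \<Rightarrow> (('m \<Rightarrow> 'a) \<Rightarrow> ('m \<Rightarrow> 'w) \<Rightarrow> 'm \<Rightarrow> 'w::real_vector) \<Rightarrow>
   ('m \<Rightarrow> 'a \<Rightarrow> 'v \<Rightarrow> 'w) \<Rightarrow> ('m \<Rightarrow> 'a) \<Rightarrow> ('m \<Rightarrow> 'a) \<Rightarrow> ('m \<Rightarrow> 'v) \<Rightarrow> 'm \<Rightarrow> 'w" where
  "koszul_d1 A nab nab' \<Phi> a b s =
     (let D = hom_conn (base (vbun A)) nab nab' in
      (\<lambda>m. D a (\<lambda>x. \<Phi> x (b x)) s m - D b (\<lambda>x. \<Phi> x (a x)) s m - \<Phi> m (bracket A a b m) (s m)))"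

definition koszul_d2 ::
  "('m, 'e, 'a, 'h) lie_algd \<Rightarrow>
   (('m \<Rightarrow> 'a) \<Rightarrow> ('m \<Rightarrow> 'v) \<Rightarrow> 'm \<Rightarrow> 'v) \<Rightarrow> (('m \<Rightarrow> 'a) \<Rightarrow> ('m \<Rightarrow> 'w) \<Rightarrow> 'm \<Rightarrow> 'w::real_vector) \<Rightarrow>
   ('m \<Rightarrow> 'a \<Rightarrow> 'a \<Rightarrow> 'v \<Rightarrow> 'w) \<Rightarrow>
   ('m \<Rightarrow> 'a) \<Rightarrow> ('m \<Rightarrow> 'a) \<Rightarrow> ('m \<Rightarrow> 'a) \<Rightarrow> ('m \<Rightarrow> 'v) \<Rightarrow> 'm \<Rightarrow> 'w" where
  "koszul_d2 A nab nab' K a b c s =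
     (let D = hom_conn (base (vbun A)) nab nab'; br = bracket A in
      (\<lambda>m. D a (\<lambda>x. K x (b x) (c x)) s m - D b (\<lambda>x. K x (a x) (c x)) s m
         + D c (\<lambda>x. K x (a x) (b x)) s m
         - K m (br a b m) (c m) (s m) + K m (br a c m) (b m) (s m) - K m (br b c m) (a m) (s m)))"


section \<open>Two-term representations up to homotopy\<close>

record ('m, 'e, 'a, 'v, 'f, 'w, 'g) ruth =
  deg0 :: "('m, 'e, 'v, 'f) vbundle"
  deg1 :: "('m, 'e, 'w, 'g) vbundle"
  bdry :: "'m \<Rightarrow> 'v \<Rightarrow> 'w"
  conn0 :: "('m \<Rightarrow> 'a) \<Rightarrow> ('m \<Rightarrow> 'v) \<Rightarrow> 'm \<Rightarrow> 'v"
  conn1 :: "('m \<Rightarrow> 'a) \<Rightarrow> ('m \<Rightarrow> 'w) \<Rightarrow> 'm \<Rightarrow> 'w"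
  curv :: "'m \<Rightarrow> 'a \<Rightarrow> 'a \<Rightarrow> 'w \<Rightarrow> 'v"

definition is_ruth ::
  "('m, 'e::euclidean_space, 'a::real_vector, 'h::euclidean_space) lie_algd \<Rightarrow>
   ('m, 'e, 'a, 'v::real_vector, 'f::euclidean_space, 'w::real_vector, 'g::euclidean_space) ruth \<Rightarrow>
   bool" where
  "is_ruth A V \<longleftrightarrow>
     (let M = base (vbun A); E0 = deg0 V; E1 = deg1 V; bd = bdry V; nab0 = conn0 V; nab1 = conn1 V;
          K = curv V; br = bracket A in
      lie_algebroid A \<and>
      vector_bundle E0 \<and> base E0 = M \<and> vector_bundle E1 \<and> base E1 = M \<and>
      bundle_map E0 E1 bd \<and> connection A E0 nab0 \<and> connection A E1 nab1 \<and>
      K \<in> hom_two_forms (vbun A) E1 E0 \<and>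
      (\<forall>a\<in>\<Gamma> (vbun A). \<forall>s\<in>\<Gamma> E0. apply_map M bd (nab0 a s) = nab1 a (apply_map M bd s)) \<and>
      (\<forall>a\<in>\<Gamma> (vbun A). \<forall>b\<in>\<Gamma> (vbun A). \<forall>c\<in>\<Gamma> (vbun A). \<forall>s\<in>\<Gamma> E1. \<forall>m\<in>points M.
         koszul_d2 A nab1 nab0 K a b c s m = 0) \<and>
      (\<forall>a\<in>\<Gamma> (vbun A). \<forall>b\<in>\<Gamma> (vbun A). \<forall>s\<in>\<Gamma> E0. \<forall>m\<in>points M.
         nab0 a (nab0 b s) m - nab0 b (nab0 a s) m - nab0 (br a b) s m = - K m (a m) (b m) (bd m (s m))) \<and>
      (\<forall>a\<in>\<Gamma> (vbun A). \<forall>b\<in>\<Gamma> (vbun A). \<forall>s\<in>\<Gamma> E1. \<forall>m\<in>points M.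
         nab1 a (nab1 b s) m - nab1 b (nab1 a s) m - nab1 (br a b) s m = - bd m (K m (a m) (b m) (s m))))"

definition ruth_morphism ::
  "('m, 'e::euclidean_space, 'a::real_vector, 'h::euclidean_space) lie_algd \<Rightarrow>
   ('m, 'e, 'a, 'v::real_vector, 'f::euclidean_space, 'w::real_vector, 'g::euclidean_space) ruth \<Rightarrow>
   ('m, 'e, 'a, 'x::real_vector, 'i::euclidean_space, 'y::real_vector, 'j::euclidean_space) ruth \<Rightarrow>
   ('m \<Rightarrow> 'v \<Rightarrow> 'x) \<Rightarrow> ('m \<Rightarrow> 'w \<Rightarrow> 'y) \<Rightarrow> ('m \<Rightarrow> 'a \<Rightarrow> 'w \<Rightarrow> 'x) \<Rightarrow> bool" where
  "ruth_morphism A V W \<phi>0 \<phi>1 \<Phi> \<longleftrightarrow>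
     (let M = base (vbun A); S = \<Gamma> (vbun A) in
      bundle_map (deg0 V) (deg0 W) \<phi>0 \<and> bundle_map (deg1 V) (deg1 W) \<phi>1 \<and>
      \<Phi> \<in> hom_one_forms (vbun A) (deg1 V) (deg0 W) \<and>
      (\<forall>m\<in>points M. \<forall>e\<in>fibre (deg0 V) m. \<phi>1 m (bdry V m e) = bdry W m (\<phi>0 m e)) \<and>
      (\<forall>a\<in>S. \<forall>s\<in>\<Gamma> (deg0 V). \<forall>m\<in>points M.
         hom_conn M (conn0 V) (conn0 W) a \<phi>0 s m = \<Phi> m (a m) (bdry V m (s m))) \<and>
      (\<forall>a\<in>S. \<forall>s\<in>\<Gamma> (deg1 V). \<forall>m\<in>points M.
         hom_conn M (conn1 V) (conn1 W) a \<phi>1 s m = bdry W m (\<Phi> m (a m) (s m))) \<and>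
      (\<forall>a\<in>S. \<forall>b\<in>S. \<forall>s\<in>\<Gamma> (deg1 V). \<forall>m\<in>points M.
         koszul_d1 A (conn1 V) (conn0 W) \<Phi> a b s m =
           \<phi>0 m (curv V m (a m) (b m) (s m)) - curv W m (a m) (b m) (\<phi>1 m (s m))))"

text \<open>\<open>T\<^sup>!W\<close> for \<open>T : A \<Rightarrow> A'\<close> over the identity of \<open>M\<close>.\<close>

definition pullback_ruth ::
  "('m, 'e) manifold \<Rightarrow> ('m \<Rightarrow> 'a \<Rightarrow> 'b::real_vector) \<Rightarrow> ('m, 'e, 'b, 'v, 'f, 'w, 'g) ruth \<Rightarrow>
   ('m, 'e, 'a, 'v, 'f, 'w, 'g) ruth" where
  "pullback_ruth M T W =
     \<lparr>deg0 = deg0 W, deg1 = deg1 W, bdry = bdry W,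
      conn0 = (\<lambda>a. conn0 W (apply_map M T a)), conn1 = (\<lambda>a. conn1 W (apply_map M T a)),
      curv = (\<lambda>m a b. curv W m (T m a) (T m b))\<rparr>"

definition ruth_morphism_over ::
  "('m, 'e::euclidean_space, 'a::real_vector, 'h::euclidean_space) lie_algd \<Rightarrow>
   ('m, 'e, 'a, 'v::real_vector, 'f::euclidean_space, 'w::real_vector, 'g::euclidean_space) ruth \<Rightarrow>
   ('m, 'e, 'b::real_vector, 'x::real_vector, 'i::euclidean_space, 'y::real_vector, 'j::euclidean_space)
     ruth \<Rightarrow>
   ('m \<Rightarrow> 'a \<Rightarrow> 'b) \<Rightarrow>
   ('m \<Rightarrow> 'v \<Rightarrow> 'x) \<Rightarrow> ('m \<Rightarrow> 'w \<Rightarrow> 'y) \<Rightarrow> ('m \<Rightarrow> 'a \<Rightarrow> 'w \<Rightarrow> 'x) \<Rightarrow> bool" where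
  "ruth_morphism_over A V W T \<phi>0 \<phi>1 \<Phi> \<longleftrightarrow>
     ruth_morphism A V (pullback_ruth (base (vbun A)) T W) \<phi>0 \<phi>1 \<Phi>"


section \<open>Trivial double vector bundles\<close>

text \<open>
  The points of \<open>D = A \<oplus> B \<oplus> C\<close> are the quadruples \<open>(m, a, b, c)\<close> with \<open>a \<in> A\<^sub>m\<close>, \<open>b \<in> B\<^sub>m\<close>, \<open>c \<in> C\<^sub>m\<close>.
  In the total spaces of \<open>D \<Rightarrow> B\<close> and \<open>D \<Rightarrow> A\<close> such a point appears as \<open>((m, b), (a, c))\<close> and
  \<open>((m, a), (b, c))\<close>.
\<close>

definition dvb_over_B ::
  "('m, 'e, 'a, 'fa) vbundle \<Rightarrow> ('m, 'e, 'b, 'fb) vbundle \<Rightarrow> ('m, 'e, 'c, 'fc) vbundle \<Rightarrow>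
   ('m \<times> 'b, 'e::euclidean_space \<times> 'fb::euclidean_space, 'a \<times> 'c, 'fa \<times> 'fc) vbundle" where
  "dvb_over_B A B C = pullback_bundle (total B) fst (A \<oplus>\<^sub>b C)"

definition dvb_over_A ::
  "('m, 'e, 'a, 'fa) vbundle \<Rightarrow> ('m, 'e, 'b, 'fb) vbundle \<Rightarrow> ('m, 'e, 'c, 'fc) vbundle \<Rightarrow>
   ('m \<times> 'a, 'e::euclidean_space \<times> 'fa::euclidean_space, 'b \<times> 'c, 'fb \<times> 'fc) vbundle" where
  "dvb_over_A A B C = pullback_bundle (total A) fst (B \<oplus>\<^sub>b C)"

definition view_B ::
  "('m \<times> 'a \<times> 'b \<times> 'c \<Rightarrow> 'n \<times> 'p \<times> 'q \<times> 'r) \<Rightarrow> ('m \<times> 'b) \<times> ('a \<times> 'c) \<Rightarrow> ('n \<times> 'q) \<times> ('p \<times> 'r)" where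
  "view_B F = (\<lambda>((m, b), (a, c)). case F (m, a, b, c) of (n, p, q, r) \<Rightarrow> ((n, q), (p, r)))"

definition view_A ::
  "('m \<times> 'a \<times> 'b \<times> 'c \<Rightarrow> 'n \<times> 'p \<times> 'q \<times> 'r) \<Rightarrow> ('m \<times> 'a) \<times> ('b \<times> 'c) \<Rightarrow> ('n \<times> 'p) \<times> ('q \<times> 'r)" where
  "view_A F = (\<lambda>((m, a), (b, c)). case F (m, a, b, c) of (n, p, q, r) \<Rightarrow> ((n, p), (q, r)))"

text \<open>\<open>f\<close>, \<open>g\<close> and \<open>h\<close> are the maps induced on \<open>M\<close>, \<open>A\<close> and \<open>B\<close>.\<close>

definition dvb_morphism ::
  "('m, 'e::euclidean_space, 'a::real_vector, 'fa::euclidean_space) vbundle \<Rightarrow>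
   ('m, 'e, 'b::real_vector, 'fb::euclidean_space) vbundle \<Rightarrow>
   ('m, 'e, 'c::real_vector, 'fc::euclidean_space) vbundle \<Rightarrow>
   ('n, 'k::euclidean_space, 'p::real_vector, 'fp::euclidean_space) vbundle \<Rightarrow>
   ('n, 'k, 'q::real_vector, 'fq::euclidean_space) vbundle \<Rightarrow>
   ('n, 'k, 'r::real_vector, 'fr::euclidean_space) vbundle \<Rightarrow>
   ('m \<Rightarrow> 'n) \<Rightarrow> ('m \<times> 'a \<times> 'b \<times> 'c \<Rightarrow> 'n \<times> 'p \<times> 'q \<times> 'r) \<Rightarrow> bool" where
  "dvb_morphism A B C A' B' C' f F \<longleftrightarrow>
     (\<exists>g h.
        vb_morphism A A' f g \<and> vb_morphism B B' f h \<and>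
        vb_morphism (dvb_over_A A B C) (dvb_over_A A' B' C') g (view_A F) \<and>
        vb_morphism (dvb_over_B A B C) (dvb_over_B A' B' C') h (view_B F))"

text \<open>Core and linear sections of \<open>D \<Rightarrow> B\<close>.\<close>

definition core_section ::
  "('m, 'e::euclidean_space, 'b, 'fb::euclidean_space) vbundle \<Rightarrow> ('m \<Rightarrow> 'c::real_vector) \<Rightarrow>
   'm \<times> 'b \<Rightarrow> 'a::real_vector \<times> 'c" where
  "core_section B c = off_zero (total B) (\<lambda>(m, b). (0, c m))"

definition horizontal_lift ::
  "('m, 'e::euclidean_space, 'b, 'fb::euclidean_space) vbundle \<Rightarrow> ('m \<Rightarrow> 'a::real_vector) \<Rightarrow>
   'm \<times> 'b \<Rightarrow> 'a \<times> 'c::real_vector" where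
  "horizontal_lift B a = off_zero (total B) (\<lambda>(m, b). (a m, 0))"

definition hat_section ::
  "('m, 'e::euclidean_space, 'b, 'fb::euclidean_space) vbundle \<Rightarrow> ('m \<Rightarrow> 'b \<Rightarrow> 'c::real_vector) \<Rightarrow>
   'm \<times> 'b \<Rightarrow> 'a::real_vector \<times> 'c" where
  "hat_section B T = off_zero (total B) (\<lambda>(m, b). (0, T m b))"

text \<open>\<open>X\<close> is a vector bundle morphism from \<open>B \<Rightarrow> M\<close> to \<open>D \<Rightarrow> A\<close> over the section \<open>X\<^sub>0\<close> of \<open>A\<close>.\<close>

definition linear_section_over ::
  "('m, 'e::euclidean_space, 'a::real_vector, 'fa::euclidean_space) vbundle \<Rightarrow>
   ('m, 'e, 'b::real_vector, 'fb::euclidean_space) vbundle \<Rightarrow>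
   ('m, 'e, 'c::real_vector, 'fc::euclidean_space) vbundle \<Rightarrow>
   ('m \<Rightarrow> 'a) \<Rightarrow> ('m \<times> 'b \<Rightarrow> 'a \<times> 'c) \<Rightarrow> bool" where
  "linear_section_over A B C X\<^sub>0 X \<longleftrightarrow>
     X\<^sub>0 \<in> \<Gamma> A \<and> X \<in> \<Gamma> (dvb_over_B A B C) \<and>
     vb_morphism B (dvb_over_A A B C) (\<lambda>m. (m, X\<^sub>0 m))
       (\<lambda>(m, b). case X (m, b) of (a, c) \<Rightarrow> ((m, a), (b, c)))"


section \<open>VB-algebroids\<close>

text \<open>
  \<open>\<rho>\<close> is a morphism from \<open>D \<Rightarrow> A\<close> to \<open>TB \<Rightarrow> TM\<close> over \<open>\<rho>\<^sub>A\<close>. The projection \<open>TB \<Rightarrow> TM\<close> and the linear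
  structure of \<open>TB \<Rightarrow> TM\<close> are the tangent maps of the projection, the addition
  \<open>B \<times>\<^sub>M B \<Rightarrow> B\<close> and the scalar multiplications of \<open>B\<close>. In the additivity clause \<open>w\<close> is the tangent
  vector of \<open>B \<times>\<^sub>M B = B \<oplus> B\<close> with components \<open>\<rho>(a, b\<^sub>1, c\<^sub>1)\<close> and \<open>\<rho>(a, b\<^sub>2, c\<^sub>2)\<close>.
\<close>

definition linear_anchor ::
  "('m, 'e::euclidean_space, 'a::real_vector, 'fa::euclidean_space) lie_algd \<Rightarrow>
   ('m, 'e, 'b::real_vector, 'fb::euclidean_space) vbundle \<Rightarrow>
   ('m, 'e, 'c::real_vector, 'fc::euclidean_space) vbundle \<Rightarrow>
   ('m \<times> 'b \<Rightarrow> 'a \<times> 'c \<Rightarrow> ('m \<times> 'b \<Rightarrow> real) \<Rightarrow> real) \<Rightarrow> bool" where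
  "linear_anchor A B C \<rho> \<longleftrightarrow>
     (\<forall>m\<in>points (base B). \<forall>a\<in>fibre (vbun A) m.
        (\<forall>b\<in>fibre B m. \<forall>c\<in>fibre C m.
           tv_eq (base B) (pushforward fst (\<rho> (m, b) (a, c))) (anchor A m a)) \<and>
        (\<forall>b\<^sub>1\<in>fibre B m. \<forall>b\<^sub>2\<in>fibre B m. \<forall>c\<^sub>1\<in>fibre C m. \<forall>c\<^sub>2\<in>fibre C m.
           \<exists>w. tangent_vector (total (B \<oplus>\<^sub>b B)) (m, (b\<^sub>1, b\<^sub>2)) w \<and>
               tv_eq (total B) (pushforward (\<lambda>(m, (x, y)). (m, x)) w) (\<rho> (m, b\<^sub>1) (a, c\<^sub>1)) \<and>
               tv_eq (total B) (pushforward (\<lambda>(m, (x, y)). (m, y)) w) (\<rho> (m, b\<^sub>2) (a, c\<^sub>2)) \<and>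
               tv_eq (total B) (pushforward (\<lambda>(m, (x, y)). (m, x + y)) w)
                 (\<rho> (m, b\<^sub>1 + b\<^sub>2) (a, c\<^sub>1 + c\<^sub>2))) \<and>
        (\<forall>b\<in>fibre B m. \<forall>c\<in>fibre C m. \<forall>r.
           tv_eq (total B) (pushforward (\<lambda>(m, x). (m, r *\<^sub>R x)) (\<rho> (m, b) (a, c)))
             (\<rho> (m, r *\<^sub>R b) (a, r *\<^sub>R c))))"

text \<open>
  \<open>D\<close> is a VB-algebroid structure on \<open>A \<oplus> B \<oplus> C\<close> with base Lie algebroid \<open>A\<close>. For a trivial double vector
  bundle the core sections of \<open>D \<Rightarrow> B\<close> are the \<open>core_section B c\<close> with \<open>c \<in> \<Gamma>(C)\<close>.
\<close>

definition vb_algebroid ::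
  "('m, 'e::euclidean_space, 'a::real_vector, 'fa::euclidean_space) lie_algd \<Rightarrow>
   ('m, 'e, 'b::real_vector, 'fb::euclidean_space) vbundle \<Rightarrow>
   ('m, 'e, 'c::real_vector, 'fc::euclidean_space) vbundle \<Rightarrow>
   ('m \<times> 'b, 'e \<times> 'fb, 'a \<times> 'c, 'fa \<times> 'fc) lie_algd \<Rightarrow> bool" where
  "vb_algebroid A B C D \<longleftrightarrow>
     lie_algebroid A \<and> vector_bundle B \<and> vector_bundle C \<and>
     base B = base (vbun A) \<and> base C = base (vbun A) \<and>
     lie_algebroid D \<and> vbun D = dvb_over_B (vbun A) B C \<and>
     linear_anchor A B C (anchor D) \<and>
     (\<forall>X\<^sub>0 X Y\<^sub>0 Y. linear_section_over (vbun A) B C X\<^sub>0 X \<and> linear_section_over (vbun A) B C Y\<^sub>0 Y \<longrightarrow>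
        linear_section_over (vbun A) B C (bracket A X\<^sub>0 Y\<^sub>0) (bracket D X Y)) \<and>
     (\<forall>X\<^sub>0 X. \<forall>c\<in>\<Gamma> C. linear_section_over (vbun A) B C X\<^sub>0 X \<longrightarrow>
        (\<exists>c'\<in>\<Gamma> C. bracket D X (core_section B c) = core_section B c')) \<and>
     (\<forall>c\<in>\<Gamma> C. \<forall>c'\<in>\<Gamma> C. bracket D (core_section B c) (core_section B c') = (\<lambda>_. 0))"

definition vb_algebroid_morphism ::
  "('m, 'e::euclidean_space, 'a::real_vector, 'fa::euclidean_space) lie_algd \<Rightarrow>
   ('m, 'e, 'b::real_vector, 'fb::euclidean_space) vbundle \<Rightarrow>
   ('m, 'e, 'c::real_vector, 'fc::euclidean_space) vbundle \<Rightarrow>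
   ('m \<times> 'b, 'e \<times> 'fb, 'a \<times> 'c, 'fa \<times> 'fc) lie_algd \<Rightarrow>
   ('n, 'k::euclidean_space, 'p::real_vector, 'fp::euclidean_space) lie_algd \<Rightarrow>
   ('n, 'k, 'q::real_vector, 'fq::euclidean_space) vbundle \<Rightarrow>
   ('n, 'k, 'r::real_vector, 'fr::euclidean_space) vbundle \<Rightarrow>
   ('n \<times> 'q, 'k \<times> 'fq, 'p \<times> 'r, 'fp \<times> 'fr) lie_algd \<Rightarrow>
   ('m \<times> 'a \<times> 'b \<times> 'c \<Rightarrow> 'n \<times> 'p \<times> 'q \<times> 'r) \<Rightarrow> bool" where
  "vb_algebroid_morphism A B C D A' B' C' D' F \<longleftrightarrow>
     (\<exists>f. dvb_morphism (vbun A) B C (vbun A') B' C' f F) \<and> (\<exists>h. la_morphism D D' h (view_B F))"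


section \<open>The associated representation up to homotopy\<close>

text \<open>\<open>\<psi>' = (\<nabla>\<^sub>a)\<^sup>*\<psi>\<close> for the connection dual to \<open>\<nabla>\<close>.\<close>

definition dual_conn_rel ::
  "('m, 'e::euclidean_space, 'a::real_vector, 'h::euclidean_space) lie_algd \<Rightarrow>
   ('m, 'e, 'v::real_vector, 'f::euclidean_space) vbundle \<Rightarrow>
   (('m \<Rightarrow> 'a) \<Rightarrow> ('m \<Rightarrow> 'v) \<Rightarrow> 'm \<Rightarrow> 'v) \<Rightarrow> ('m \<Rightarrow> 'a) \<Rightarrow> ('m \<Rightarrow> 'v \<Rightarrow> real) \<Rightarrow> ('m \<Rightarrow> 'v \<Rightarrow> real) \<Rightarrow> bool"
  where
  "dual_conn_rel A E nab a \<psi> \<psi>' \<longleftrightarrow>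
     \<psi>' \<in> dual_sections E \<and>
     (\<forall>s\<in>\<Gamma> E. \<forall>m\<in>points (base E).
        \<psi>' m (s m) = anchor A m (a m) (\<lambda>x. \<psi> x (s x)) - \<psi> m (nab a s m))"

text \<open>\<open>X\<close>, a family of tangent vectors of (the total space of) \<open>E\<close>, is the linear vector field \<open>X\<^bsub>\<nabla>\<^sub>a\<^esub>\<close>.\<close>

definition linear_vector_field_of ::
  "('m, 'e::euclidean_space, 'a::real_vector, 'h::euclidean_space) lie_algd \<Rightarrow>
   ('m, 'e, 'v::real_vector, 'f::euclidean_space) vbundle \<Rightarrow>
   (('m \<Rightarrow> 'a) \<Rightarrow> ('m \<Rightarrow> 'v) \<Rightarrow> 'm \<Rightarrow> 'v) \<Rightarrow> ('m \<Rightarrow> 'a) \<Rightarrow> ('m \<times> 'v \<Rightarrow> ('m \<times> 'v \<Rightarrow> real) \<Rightarrow> real) \<Rightarrow> bool"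
  where
  "linear_vector_field_of A E nab a X \<longleftrightarrow>
     (\<forall>(m, e)\<in>points (total E). tv_eq (base E) (pushforward fst (X (m, e))) (anchor A m (a m))) \<and>
     (\<forall>\<psi>\<in>dual_sections E. \<exists>\<psi>'. dual_conn_rel A E nab a \<psi> \<psi>' \<and>
        (\<forall>p\<in>points (total E). X p (\<ell> \<psi>) = \<ell> \<psi>' p))"

definition vertical_lift :: "('m \<Rightarrow> 'v::real_vector) \<Rightarrow> 'm \<times> 'v \<Rightarrow> ('m \<times> 'v \<Rightarrow> real) \<Rightarrow> real" where
  "vertical_lift s = (\<lambda>(m, e) f. deriv (\<lambda>t::real. f (m, e + t *\<^sub>R s m)) 0)"

definition associated_ruth ::
  "('m, 'e::euclidean_space, 'a::real_vector, 'fa::euclidean_space) lie_algd \<Rightarrow>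
   ('m, 'e, 'b::real_vector, 'fb::euclidean_space) vbundle \<Rightarrow>
   ('m, 'e, 'c::real_vector, 'fc::euclidean_space) vbundle \<Rightarrow>
   ('m \<times> 'b, 'e \<times> 'fb, 'a \<times> 'c, 'fa \<times> 'fc) lie_algd \<Rightarrow>
   ('m, 'e, 'a, 'c, 'fc, 'b, 'fb) ruth \<Rightarrow> bool" where
  "associated_ruth A B C D V \<longleftrightarrow>
     (let M = base (vbun A); S = \<Gamma> (vbun A); h = horizontal_lift B in
      is_ruth A V \<and> deg0 V = C \<and> deg1 V = B \<and>
      (\<forall>a\<in>S. linear_vector_field_of A B (conn1 V) a (\<lambda>p. anchor D p (h a p))) \<and>
      (\<forall>c\<in>\<Gamma> C. \<forall>p\<in>points (total B).
         tv_eq (total B) (anchor D p (core_section B c p)) (vertical_lift (apply_map M (bdry V) c) p)) \<and>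
      (\<forall>c\<^sub>1\<in>\<Gamma> C. \<forall>c\<^sub>2\<in>\<Gamma> C. bracket D (core_section B c\<^sub>1) (core_section B c\<^sub>2) = (\<lambda>_. 0)) \<and>
      (\<forall>a\<in>S. \<forall>c\<in>\<Gamma> C. bracket D (h a) (core_section B c) = core_section B (conn0 V a c)) \<and>
      (\<forall>a\<^sub>1\<in>S. \<forall>a\<^sub>2\<in>S.
         bracket D (h a\<^sub>1) (h a\<^sub>2) =
           (\<lambda>p. h (bracket A a\<^sub>1 a\<^sub>2) p + hat_section B (\<lambda>m. curv V m (a\<^sub>1 m) (a\<^sub>2 m)) p)))"

end

(*
  Pairing the bracket condition of a Lie algebroid morphism G : A => A' over f with a section xi of the
  dual of A' turns it into d(G* xi) = G*(d xi) for the Chevalley-Eilenberg differentials. Both sides are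
  tensorial, so it suffices to test a family of forms that separates points, on sections with prescribed
  values at the point. For D = A + B + C one takes the sections h(a) + c^ and the forms alpha + gamma with
  alpha on A' and gamma on C'. The part alpha gives the bracket condition for F_ver; the part gamma, with
  c = 0 and a = 0 in turn, gives the equation for d Phi and the one for the degree 0 connections.

  The anchor condition is an identity between tangent vectors of the total space of B'. By Hadamard's
  lemma it only has to be checked on functions pulled back from M and on fibrewise linear functions. The
  former give the anchor condition for F_ver; the latter give the compatibility of F_c and F_hor with
  the boundary maps and the equation for the degree 1 connections.
*)

theory Submission
  imports Defs
begin

section \<open>Smooth functions on Euclidean space\<close>

text \<open>Tensoriality also settles two further points. A decomposition of
  \<open>G \<circ> X\<close> is constructed only after X is multiplied by a function that is 1 at
  the point in question. And F maps a lift h(a) + c^ to no lift in general, because the C'-component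
  \<open>F_c c + \<Phi> a b\<close> varies with b; along a section s of B, however, the image has
  the values of the lift with C'-component \<open>F_c c + \<Phi> a s\<close>, and every point of B
  lies on such an s. The same s allows connections, which act on sections, to be evaluated at points
  of B.

  The dual form of the bracket condition presupposes the anchor condition, so the anchors are
  compared first. What F fails to satisfy is recorded in defects, vectors on which a form takes the
  difference of the two sides of a dual equation; they vanish as soon as all forms kill them. Some
  defects combine two of the wanted equations, which are separated by inserting zero sections.

  The Hadamard argument needs cut-off functions on the total space of B', hence a Hausdorff space.
  This is available because that total space is the base of the vector bundle D' -> B'.\<close>

lemma ck_on_subset: "ck_on k S f \<Longrightarrow> T \<subseteq> S \<Longrightarrow> ck_on k T f"
proof (induction k arbitrary: f)
  case 0
  then show ?case by (auto intro: continuous_on_subset)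
next
  case (Suc k)
  then show ?case by auto
qed

lemma frechet_derivative_cong_open:
  assumes "open S" "x \<in> S" "\<And>y. y \<in> S \<Longrightarrow> f y = g y"
  shows "f differentiable (at x) \<longleftrightarrow> g differentiable (at x)"
    and "frechet_derivative f (at x) = frechet_derivative g (at x)"
proof -
  have "(f has_derivative D) (at x) \<longleftrightarrow> (g has_derivative D) (at x)" for D
    using has_derivative_transform_within_open[OF _ assms(1,2), of f D UNIV g]
      has_derivative_transform_within_open[OF _ assms(1,2), of g D UNIV f] assms(3) by fastforce
  then show "f differentiable (at x) \<longleftrightarrow> g differentiable (at x)"
    "frechet_derivative f (at x) = frechet_derivative g (at x)"
    by (auto simp: differentiable_def frechet_derivative_def)
qed

lemma ck_on_cong:
  assumes "open S" "\<And>y. y \<in> S \<Longrightarrow> f y = g y" "ck_on k S f"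
  shows "ck_on k S g"
  using assms(2,3)
proof (induction k arbitrary: f g)
  case 0
  then show ?case using continuous_on_cong[of S S f g] by simp
next
  case (Suc k)
  have eq: "frechet_derivative f (at x) v = frechet_derivative g (at x) v"
    and dif: "f differentiable (at x) \<longleftrightarrow> g differentiable (at x)" if "x \<in> S" for x v
    using frechet_derivative_cong_open[OF assms(1) that, of f g] Suc.prems(1) by simp_all
  have "ck_on k S (\<lambda>x. frechet_derivative f (at x) v)" for v
    using Suc.prems(2) by simp
  from Suc.IH[OF eq this] have "ck_on k S (\<lambda>x. frechet_derivative g (at x) v)" for v
    by blast
  moreover have "\<forall>x\<in>S. g differentiable (at x)"
    using Suc.prems(2) dif by simp
  ultimately show ?case by simp
qed

text \<open>\<open>frechet_derivative\<close> is a choice term. Uniqueness of derivatives identifies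
  it with an exhibited \<open>f'\<close>, and agreement on the open set is enough for the inductive
  premise.\<close>

lemma ck_on_SucI:
  assumes "open S" "\<And>x. x \<in> S \<Longrightarrow> (f has_derivative f' x) (at x)" "\<And>v. ck_on k S (\<lambda>x. f' x v)"
  shows "ck_on (Suc k) S f"
proof -
  have "frechet_derivative f (at x) = f' x" if "x \<in> S" for x
    using frechet_derivative_at[OF assms(2)[OF that]] by simp
  then have "ck_on k S (\<lambda>x. frechet_derivative f (at x) v)" for v
    by (intro ck_on_cong[OF assms(1) _ assms(3)[of v]]) auto
  then show ?thesis
    using assms(2) by (auto simp: differentiable_def)
qed

lemma ck_on_has_derivative:
  assumes "ck_on (Suc k) S f" "x \<in> S"
  shows "(f has_derivative frechet_derivative f (at x)) (at x)"
  using assms frechet_derivative_works by auto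

lemma ck_on_Suc_imp: "ck_on (Suc k) S f \<Longrightarrow> ck_on k S f"
proof (induction k arbitrary: f)
  case 0
  then show ?case
    by (auto intro!: continuous_at_imp_continuous_on differentiable_imp_continuous_within)
next
  case (Suc k)
  then have "ck_on k S (\<lambda>x. frechet_derivative f (at x) v)" for v by auto
  then show ?case using Suc.prems by auto
qed

lemma ck_on_const: "open S \<Longrightarrow> ck_on k S (\<lambda>x. c)"
proof (induction k arbitrary: c)
  case (Suc k)
  show ?case
    by (rule ck_on_SucI[OF Suc.prems, where f' = "\<lambda>x v. 0"]) (use Suc in auto)
qed auto

lemma ck_on_linear: "open S \<Longrightarrow> bounded_linear f \<Longrightarrow> ck_on k S f"
proof (cases k)
  case (Suc n)
  assume *: "open S" "bounded_linear f"
  show ?thesis unfolding Suc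
    by (rule ck_on_SucI[OF *(1), where f' = "\<lambda>x. f"])
      (use * in \<open>auto intro: ck_on_const bounded_linear_imp_has_derivative\<close>)
qed (auto intro: linear_continuous_on)

lemma ck_on_add:
  assumes "open S" "ck_on k S f" "ck_on k S g"
  shows "ck_on k S (\<lambda>x. f x + g x)"
  using assms(2,3)
proof (induction k arbitrary: f g)
  case (Suc k)
  show ?case
    by (rule ck_on_SucI[OF assms(1) has_derivative_add]) 
      (use Suc in \<open>auto intro: ck_on_has_derivative\<close>)
qed (auto intro: continuous_intros)

lemma ck_on_sum:
  assumes "open S" "\<And>i. i \<in> I \<Longrightarrow> ck_on k S (f i)"
  shows "ck_on k S (\<lambda>x. \<Sum>i\<in>I. f i x)"
  using assms(2)
  by (induction I rule: infinite_finite_induct) (auto intro!: ck_on_add ck_on_const assms(1))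

lemma ck_on_scaleR:
  assumes "open S" "ck_on k S u" "ck_on k S f"
  shows "ck_on k S (\<lambda>x. u x *\<^sub>R f x)"
  using assms(2,3)
proof (induction k arbitrary: u f)
  case (Suc k)
  show ?case
  proof (rule ck_on_SucI[OF assms(1) has_derivative_scaleR])
    fix v
    show "ck_on k S (\<lambda>x. u x *\<^sub>R frechet_derivative f (at x) v + frechet_derivative u (at x) v *\<^sub>R f x)"
      by (intro ck_on_add assms Suc.IH ck_on_Suc_imp[OF Suc.prems(1)] ck_on_Suc_imp[OF Suc.prems(2)])
        (use Suc.prems in auto)
  qed (use Suc in \<open>auto intro: ck_on_has_derivative\<close>)
qed (auto intro: continuous_intros)

lemma ck_on_linear_compose:
  assumes "open S" "ck_on k S f" "bounded_linear L"
  shows "ck_on k S (\<lambda>x. L (f x))"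
  using assms(2)
proof (induction k arbitrary: f)
  case 0
  then show ?case
    using assms(3) by (auto intro: bounded_linear.continuous_on)
next
  case (Suc k)
  show ?case
    by (rule ck_on_SucI[OF assms(1) bounded_linear.has_derivative[OF assms(3)]])
      (use Suc in \<open>auto intro: ck_on_has_derivative\<close>)
qed

lemma linear_eq_componentwise:
  assumes "linear L"
  shows "L v = (\<Sum>i\<in>Basis. (v \<bullet> i) *\<^sub>R L i)"
  by (subst euclidean_representation[of v, symmetric])
    (simp only: linear_sum[OF assms] linear_scale[OF assms])

lemma ck_on_compose:
  fixes f :: "'d::real_normed_vector \<Rightarrow> 'e::euclidean_space" and g :: "'e \<Rightarrow> 'f::real_normed_vector"
  assumes "open S" "open T" "f ` S \<subseteq> T" "ck_on k S f" "ck_on k T g"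
  shows "ck_on k S (\<lambda>x. g (f x))"
  using assms(4,5)
proof (induction k arbitrary: g)
  case 0
  then show ?case using assms(3) continuous_on_compose2[of T g S f] by auto
next
  case (Suc k)
  have f: "(f has_derivative frechet_derivative f (at x)) (at x)" if "x \<in> S" for x
    using ck_on_has_derivative[OF Suc.prems(1)] that by auto
  have g: "(g has_derivative frechet_derivative g (at y)) (at y)" if "y \<in> T" for y
    using ck_on_has_derivative[OF Suc.prems(2)] that by auto
  have lin: "linear (frechet_derivative g (at y))" if "y \<in> T" for y
    using g[OF that] has_derivative_linear by blast
  \<comment> \<open>The direction in which g is differentiated varies with x, whereas
    \<open>ck_on\<close> keeps directions fixed. Expanding it in \<open>Basis\<close> leaves
    products of scalar functions with partial derivatives of g, and the induction hypothesis applies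
    to the latter.\<close>
  let ?D = "\<lambda>x v. \<Sum>i\<in>Basis. (frechet_derivative f (at x) v \<bullet> i) *\<^sub>R frechet_derivative g (at (f x)) i"
  show ?case
  proof (rule ck_on_SucI[OF assms(1), where f' = ?D])
    fix x assume x: "x \<in> S"
    then have "f x \<in> T" using assms(3) by auto
    then have "(\<lambda>v. frechet_derivative g (at (f x)) (frechet_derivative f (at x) v)) = ?D x"
      by (intro ext linear_eq_componentwise lin)
    then show "((\<lambda>x. g (f x)) has_derivative ?D x) (at x)"
      using has_derivative_compose[OF f[OF x] g[OF \<open>f x \<in> T\<close>]] by simp
  next
    fix v
    have "ck_on k S (\<lambda>x. frechet_derivative g (at (f x)) i)" for i
      using Suc.IH[OF ck_on_Suc_imp[OF Suc.prems(1)], of "\<lambda>y. frechet_derivative g (at y) i"] Suc.prems(2)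
      by simp
    moreover have "ck_on k S (\<lambda>x. frechet_derivative f (at x) v \<bullet> i)" for i
      by (rule ck_on_linear_compose[OF assms(1) _ bounded_linear_inner_left]) (use Suc.prems(1) in simp)
    ultimately show "ck_on k S (\<lambda>x. ?D x v)"
      by (intro ck_on_sum ck_on_scaleR assms) auto
  qed
qed

lemma ck_on_imp_continuous_on: "ck_on k S f \<Longrightarrow> continuous_on S f"
  by (induction k) (simp, blast dest: ck_on_Suc_imp)

section \<open>Smooth maps on arbitrary subsets\<close>

lemma smooth_onI:
  assumes "\<And>x. x \<in> S \<Longrightarrow> \<exists>U g. open U \<and> x \<in> U \<and> (\<forall>k. ck_on k U g) \<and> (\<forall>y\<in>S \<inter> U. f y = g y)"
  shows "smooth_on S f"
  using assms unfolding smooth_on_def by blast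

lemma smooth_onE:
  assumes "smooth_on S f" "x \<in> S"
  obtains U g where "open U" "x \<in> U" "\<And>k. ck_on k U g" "\<And>y. y \<in> S \<Longrightarrow> y \<in> U \<Longrightarrow> f y = g y"
proof -
  obtain U g where "open U \<and> x \<in> U \<and> (\<forall>k. ck_on k U g) \<and> (\<forall>y\<in>S \<inter> U. f y = g y)"
    using assms unfolding smooth_on_def by blast
  then show ?thesis by (intro that[of U g]) blast+
qed

lemma smooth_on_subset:
  assumes "smooth_on S f" "T \<subseteq> S"
  shows "smooth_on T f"
proof (rule smooth_onI)
  fix x assume "x \<in> T"
  then obtain U g where "open U" "x \<in> U" "\<And>k. ck_on k U g" "\<And>y. y \<in> S \<Longrightarrow> y \<in> U \<Longrightarrow> f y = g y"
    using smooth_onE[OF assms(1)] assms(2) by blast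
  then show "\<exists>U g. open U \<and> x \<in> U \<and> (\<forall>k. ck_on k U g) \<and> (\<forall>y\<in>T \<inter> U. f y = g y)"
    using assms(2) by blast
qed

lemma smooth_on_cong:
  assumes "\<And>x. x \<in> S \<Longrightarrow> f x = g x" "smooth_on S f"
  shows "smooth_on S g"
proof (rule smooth_onI)
  fix x assume "x \<in> S"
  then obtain U h where U: "open U" "x \<in> U" "\<And>k. ck_on k U h" "\<And>y. y \<in> S \<Longrightarrow> y \<in> U \<Longrightarrow> f y = h y"
    using smooth_onE[OF assms(2)] by blast
  have "\<forall>y\<in>S \<inter> U. g y = h y"
    using assms(1) U(4) by fastforce
  then show "\<exists>U h. open U \<and> x \<in> U \<and> (\<forall>k. ck_on k U h) \<and> (\<forall>y\<in>S \<inter> U. g y = h y)"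
    using U(1-3) by blast
qed

lemma smooth_on_local:
  assumes "\<And>x. x \<in> S \<Longrightarrow> \<exists>T. open T \<and> x \<in> T \<and> smooth_on (S \<inter> T) f"
  shows "smooth_on S f"
proof (rule smooth_onI)
  fix x assume "x \<in> S"
  then obtain T where T: "open T" "x \<in> T" "smooth_on (S \<inter> T) f" using assms by blast
  then obtain U g where "open U" "x \<in> U" "\<And>k. ck_on k U g" "\<And>y. y \<in> S \<inter> T \<Longrightarrow> y \<in> U \<Longrightarrow> f y = g y"
    using smooth_onE[of "S \<inter> T" f x] \<open>x \<in> S\<close> by blast
  then show "\<exists>U g. open U \<and> x \<in> U \<and> (\<forall>k. ck_on k U g) \<and> (\<forall>y\<in>S \<inter> U. f y = g y)"
    using T by (intro exI[of _ "U \<inter> T"] exI[of _ g]) (auto intro: ck_on_subset)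
qed

lemma smooth_on_open: "open S \<Longrightarrow> (\<And>k. ck_on k S f) \<Longrightarrow> smooth_on S f"
  by (rule smooth_onI) (auto intro!: exI[of _ S])

lemma smooth_on_const: "smooth_on S (\<lambda>x. c)"
  by (rule smooth_on_subset[OF smooth_on_open[of UNIV]]) (auto intro: ck_on_const)

lemma smooth_on_linear: "bounded_linear f \<Longrightarrow> smooth_on S f"
  by (rule smooth_on_subset[OF smooth_on_open[of UNIV]]) (auto intro: ck_on_linear)

lemma smooth_on_imp_continuous_on:
  assumes "smooth_on S f"
  shows "continuous_on S f"
proof (subst continuous_on_eq_continuous_within, rule ballI)
  fix x assume x: "x \<in> S"
  then obtain U g where U: "open U" "x \<in> U" "\<And>k. ck_on k U g" "\<And>y. y \<in> S \<Longrightarrow> y \<in> U \<Longrightarrow> f y = g y"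
    using smooth_onE[OF assms] by blast
  have "continuous_on (S \<inter> U) f"
    using continuous_on_subset[OF ck_on_imp_continuous_on[OF U(3)], of "S \<inter> U"] U(4)
      continuous_on_cong[of "S \<inter> U" "S \<inter> U" f g] by auto
  then have "(f \<longlongrightarrow> f x) (at x within S \<inter> U)"
    using x U by (auto simp: continuous_on_def)
  then show "continuous (at x within S) f"
    using at_within_nhd[of x U "S \<inter> U" S] U(1,2) by (auto simp: continuous_within)
qed

lemma smooth_on_add:
  assumes "smooth_on S f" "smooth_on S g"
  shows "smooth_on S (\<lambda>x. f x + g x)"
proof (rule smooth_onI)
  fix x assume x: "x \<in> S"
  obtain U f' where U: "open U" "x \<in> U" "\<And>k. ck_on k U f'" "\<And>y. y \<in> S \<Longrightarrow> y \<in> U \<Longrightarrow> f y = f' y"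
    using smooth_onE[OF assms(1) x] by blast
  obtain V g' where V: "open V" "x \<in> V" "\<And>k. ck_on k V g'" "\<And>y. y \<in> S \<Longrightarrow> y \<in> V \<Longrightarrow> g y = g' y"
    using smooth_onE[OF assms(2) x] by blast
  show "\<exists>U h. open U \<and> x \<in> U \<and> (\<forall>k. ck_on k U h) \<and> (\<forall>y\<in>S \<inter> U. f y + g y = h y)"
    using U V
    by (intro exI[of _ "U \<inter> V"] exI[of _ "\<lambda>x. f' x + g' x"])
      (auto intro!: ck_on_add intro: ck_on_subset)
qed

lemma smooth_on_scaleR:
  assumes "smooth_on S f" "smooth_on S g"
  shows "smooth_on S (\<lambda>x. f x *\<^sub>R g x)"
proof (rule smooth_onI)
  fix x assume x: "x \<in> S"
  obtain U f' where U: "open U" "x \<in> U" "\<And>k. ck_on k U f'" "\<And>y. y \<in> S \<Longrightarrow> y \<in> U \<Longrightarrow> f y = f' y"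
    using smooth_onE[OF assms(1) x] by blast
  obtain V g' where V: "open V" "x \<in> V" "\<And>k. ck_on k V g'" "\<And>y. y \<in> S \<Longrightarrow> y \<in> V \<Longrightarrow> g y = g' y"
    using smooth_onE[OF assms(2) x] by blast
  show "\<exists>U h. open U \<and> x \<in> U \<and> (\<forall>k. ck_on k U h) \<and> (\<forall>y\<in>S \<inter> U. f y *\<^sub>R g y = h y)"
    using U V
    by (intro exI[of _ "U \<inter> V"] exI[of _ "\<lambda>x. f' x *\<^sub>R g' x"])
      (auto intro!: ck_on_scaleR intro: ck_on_subset)
qed

lemma smooth_on_sum:
  "(\<And>i. i \<in> I \<Longrightarrow> smooth_on S (f i)) \<Longrightarrow> smooth_on S (\<lambda>x. \<Sum>i\<in>I. f i x)"
  by (induction I rule: infinite_finite_induct) (auto intro!: smooth_on_add smooth_on_const)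

lemma smooth_on_compose:
  fixes f :: "'d::real_normed_vector \<Rightarrow> 'e::euclidean_space" and g :: "'e \<Rightarrow> 'f::real_normed_vector"
  assumes "smooth_on S f" "smooth_on T g" "f ` S \<subseteq> T"
  shows "smooth_on S (\<lambda>x. g (f x))"
proof (rule smooth_onI)
  fix x assume x: "x \<in> S"
  obtain U f' where U: "open U" "x \<in> U" "\<And>k. ck_on k U f'" "\<And>y. y \<in> S \<Longrightarrow> y \<in> U \<Longrightarrow> f y = f' y"
    using smooth_onE[OF assms(1) x] by blast
  have "f x \<in> T" using x assms(3) by auto
  then obtain V g' where V: "open V" "f x \<in> V" "\<And>k. ck_on k V g'" "\<And>y. y \<in> T \<Longrightarrow> y \<in> V \<Longrightarrow> g y = g' y"
    using smooth_onE[OF assms(2)] by blast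
  define O' where "O' = U \<inter> f' -` V"
  have O': "open O'" "x \<in> O'" "O' \<subseteq> U"
    using continuous_open_preimage[OF ck_on_imp_continuous_on[OF U(3)] U(1) V(1)] U V x
    by (auto simp: O'_def)
  have "ck_on k O' (\<lambda>x. g' (f' x))" for k
    by (rule ck_on_compose[OF O'(1) V(1) _ ck_on_subset[OF U(3) O'(3)] V(3)]) (auto simp: O'_def)
  then show "\<exists>U h. open U \<and> x \<in> U \<and> (\<forall>k. ck_on k U h) \<and> (\<forall>y\<in>S \<inter> U. g (f y) = h y)"
    using O' U V assms(3) by (intro exI[of _ O'] exI[of _ "\<lambda>x. g' (f' x)"]) (force simp: O'_def)
qed

lemma smooth_on_linear_compose:
  fixes f :: "'d::real_normed_vector \<Rightarrow> 'e::real_normed_vector"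
  assumes "smooth_on S f" "bounded_linear L"
  shows "smooth_on S (\<lambda>x. L (f x))"
proof (rule smooth_onI)
  fix x assume x: "x \<in> S"
  obtain U f' where U: "open U" "x \<in> U" "\<And>k. ck_on k U f'" "\<And>y. y \<in> S \<Longrightarrow> y \<in> U \<Longrightarrow> f y = f' y"
    using smooth_onE[OF assms(1) x] by blast
  then show "\<exists>U h. open U \<and> x \<in> U \<and> (\<forall>k. ck_on k U h) \<and> (\<forall>y\<in>S \<inter> U. L (f y) = h y)"
    by (intro exI[of _ U] exI[of _ "\<lambda>x. L (f' x)"]) (auto intro: ck_on_linear_compose assms)
qed

lemma smooth_on_Pair:
  fixes f :: "'d::real_normed_vector \<Rightarrow> 'e::real_normed_vector" and g :: "'d \<Rightarrow> 'f::real_normed_vector"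
  assumes "smooth_on S f" "smooth_on S g"
  shows "smooth_on S (\<lambda>x. (f x, g x))"
proof -
  have "bounded_linear (\<lambda>x::'e. (x, 0::'f))" "bounded_linear (\<lambda>x::'f. (0::'e, x))"
    by (auto intro: bounded_linear_Pair bounded_linear_ident bounded_linear_zero)
  note smooth_on_linear_compose[OF assms(1) this(1)] smooth_on_linear_compose[OF assms(2) this(2)]
  from smooth_on_add[OF this] show ?thesis by simp
qed

lemma smooth_on_inner_left: "smooth_on S f \<Longrightarrow> smooth_on S (\<lambda>x. f x \<bullet> i)"
  by (rule smooth_on_linear_compose[OF _ bounded_linear_inner_left])

lemma smooth_on_fst: "smooth_on S fst" and smooth_on_snd: "smooth_on S snd"
  by (rule smooth_on_linear[OF bounded_linear_fst] smooth_on_linear[OF bounded_linear_snd])+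

text \<open>The family \<open>exp (-1/x) / x^n\<close> is closed under differentiation up to linear combinations.\<close>

definition flat :: "nat \<Rightarrow> real \<Rightarrow> real" where
  "flat n x = (if x > 0 then exp (- (1 / x)) / x ^ n else 0)"

text \<open>Only the right limit has content: with y = 1/x it is the decay of
  \<open>y ^ n / exp y\<close> at infinity.\<close>

lemma flat_tendsto_0: "(flat n \<longlongrightarrow> 0) (at 0)"
  unfolding filterlim_split_at_real[of "flat n"] 
proof (rule filterlim_split_at)
  show "(flat n \<longlongrightarrow> 0) (at_left 0)"
    by (rule tendsto_eventually) (auto simp: flat_def eventually_at_left_field intro!: exI[of _ "-1"])
  have "((\<lambda>x. inverse x ^ n / exp (inverse x)) \<longlongrightarrow> 0) (at_right (0::real))"
    using filterlim_compose[OF tendsto_power_div_exp_0 filterlim_inverse_at_top_right] .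
  moreover have "eventually (\<lambda>x. inverse x ^ n / exp (inverse x) = flat n x) (at_right 0)"
    by (auto simp: flat_def eventually_at_right_field field_simps exp_minus intro!: exI[of _ 1])
  ultimately show "(flat n \<longlongrightarrow> 0) (at_right 0)"
    by (rule Lim_transform_eventually)
qed

lemma flat_has_derivative:
  "(flat n has_real_derivative flat (n + 2) x - n * flat (n + 1) x) (at x)"
proof -
  consider "x < 0" | "x = 0" | "x > 0" by linarith
  then show ?thesis
  proof cases
    case 1
    have "((\<lambda>_. 0) has_real_derivative 0) (at x)" by simp
    then have "(flat n has_real_derivative 0) (at x)"
      by (rule DERIV_cong_ev[THEN iffD1, rotated -1])
        (use 1 in \<open>auto simp: flat_def eventually_nhds intro!: exI[of _ "{..<0}"]\<close>)
    then show ?thesis using 1 by (simp add: flat_def)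
  next
    case 2
    \<comment> \<open>The difference quotient at 0 is again a member of the family, so the
      derivative there is the limit computed before.\<close>
    have "(\<lambda>h. (flat n (0 + h) - flat n 0) / h) = flat (n + 1)"
      by (auto simp: flat_def fun_eq_iff)
    then have "(flat n has_real_derivative 0) (at 0)"
      using flat_tendsto_0[of "n + 1"] by (simp add: DERIV_def)
    then show ?thesis using 2 by (simp add: flat_def)
  next
    case 3
    have "((\<lambda>x. exp (- (1 / x)) / x ^ n) has_real_derivative
        (exp (- (1/x)) * (1 / x\<^sup>2) * x ^ n - exp (- (1/x)) * (n * x ^ (n - 1))) / (x ^ n * x ^ n)) (at x)"
      using 3 by (auto intro!: derivative_eq_intros simp: power2_eq_square)
    moreover have "(exp (- (1/x)) * (1 / x\<^sup>2) * x ^ n - exp (- (1/x)) * (n * x ^ (n - 1))) / (x ^ n * x ^ n)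
        = flat (n + 2) x - n * flat (n + 1) x"
      using 3 by (cases n) (auto simp: flat_def field_simps power2_eq_square)
    ultimately have "((\<lambda>x. exp (- (1 / x)) / x ^ n) has_real_derivative flat (n + 2) x - n * flat (n + 1) x) (at x)"
      by simp
    then show ?thesis
      by (rule DERIV_cong_ev[THEN iffD1, rotated -1])
        (use 3 in \<open>auto simp: flat_def eventually_nhds intro!: exI[of _ "{0<..}"]\<close>)
  qed
qed

lemma ck_on_flat: "ck_on k UNIV (flat n)"
proof (induction k arbitrary: n)
  case 0
  show ?case
    by (auto intro!: continuous_at_imp_continuous_on DERIV_isCont[OF flat_has_derivative])
next
  case (Suc k)
  show ?case
  proof (rule ck_on_SucI)
    fix x
    show "(flat n has_derivative (\<lambda>v. (flat (n + 2) x + (- real n) *\<^sub>R flat (n + 1) x) *\<^sub>R v)) (at x)"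
      using flat_has_derivative[of n x] by (simp add: has_field_derivative_def)
  next
    fix v :: real
    show "ck_on k UNIV (\<lambda>x. (flat (n + 2) x + (- real n) *\<^sub>R flat (n + 1) x) *\<^sub>R v)"
      by (intro ck_on_scaleR ck_on_add ck_on_const Suc.IH open_UNIV)
  qed simp
qed

lemma smooth_on_inverse: "smooth_on {x::real. x \<noteq> 0} inverse"
proof -
  have op: "open {x::real. x \<noteq> 0}" by (simp add: open_Collect_neq)
  have "ck_on k {x::real. x \<noteq> 0} inverse" for k
  proof (induction k)
    case 0
    show ?case by (auto intro: continuous_intros)
  next
    case (Suc k)
    show ?case
    proof (rule ck_on_SucI[OF op])
      fix x :: real assume "x \<in> {x. x \<noteq> 0}"
      then show "(inverse has_derivative (\<lambda>v. (- 1) *\<^sub>R inverse x *\<^sub>R inverse x *\<^sub>R v)) (at x)"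
        by (auto intro!: derivative_eq_intros)
    next
      fix v :: real
      show "ck_on k {x. x \<noteq> 0} (\<lambda>x. (- 1) *\<^sub>R inverse x *\<^sub>R inverse x *\<^sub>R v)"
        by (intro ck_on_scaleR ck_on_const Suc.IH op)
    qed
  qed
  then show ?thesis by (intro smooth_on_open op)
qed

text \<open>\<open>flat 0\<close> is positive exactly on the positive reals, so composing it with
  r^2 - |x - x0|^2 confines the support to the ball. The distance enters squared because its square
  is a polynomial, while the norm is not smooth at x0.\<close>

lemma smooth_bump:
  fixes x0 :: "'e::euclidean_space"
  assumes "r > 0"
  obtains \<beta> :: "'e \<Rightarrow> real" where
    "smooth_on UNIV \<beta>" "\<beta> x0 = 1" "\<And>x. x \<notin> cball x0 r \<Longrightarrow> \<beta> x = 0"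
proof
  let ?q = "\<lambda>x. r\<^sup>2 - (x - x0) \<bullet> (x - x0)"
  let ?\<beta> = "\<lambda>x. (1 / flat 0 (r\<^sup>2)) *\<^sub>R flat 0 (?q x)"
  have "smooth_on UNIV (\<lambda>x. x - x0)"
    using smooth_on_add[OF smooth_on_linear[OF bounded_linear_ident] smooth_on_const[of _ "- x0"]] by simp
  then have "smooth_on UNIV (\<lambda>x. \<Sum>i\<in>Basis. ((x - x0) \<bullet> i) *\<^sub>R ((x - x0) \<bullet> i))"
    by (intro smooth_on_sum smooth_on_scaleR smooth_on_inner_left)
  then have "smooth_on UNIV (\<lambda>x. (x - x0) \<bullet> (x - x0))"
    by (subst euclidean_inner) simp
  from smooth_on_add[OF smooth_on_const[of _ "r\<^sup>2"] smooth_on_scaleR[OF smooth_on_const[of _ "-1"] this]]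
  have "smooth_on UNIV ?q" by simp
  moreover have "smooth_on UNIV (flat 0)"
    by (intro smooth_on_open ck_on_flat) simp
  ultimately have "smooth_on UNIV (\<lambda>x. flat 0 (?q x))"
    by (rule smooth_on_compose) simp
  then show "smooth_on UNIV ?\<beta>"
    by (intro smooth_on_scaleR smooth_on_const)
  show "?\<beta> x0 = 1"
    using assms by (simp add: flat_def)
  show "?\<beta> x = 0" if "x \<notin> cball x0 r" for x
  proof -
    have "r < norm (x - x0)"
      using that by (simp add: dist_norm norm_minus_commute)
    then have "r\<^sup>2 < (norm (x - x0))\<^sup>2"
      using assms by (intro power_strict_mono) auto
    then show ?thesis by (simp add: flat_def dot_square_norm)
  qed
qed

section \<open>Hadamard's lemma\<close>

text \<open>Differentiation under the integral sign. Each derivative in x brings out one factor t by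
  the chain rule; carrying the weight \<open>t ^ j\<close> keeps the family closed under
  differentiation, which the induction in the next lemma requires.\<close>

lemma has_derivative_integral_segment:
  fixes H :: "'e::euclidean_space \<Rightarrow> real"
  assumes "ck_on (Suc 0) (ball x0 r) H" "x \<in> ball x0 r"
  shows "((\<lambda>x. integral {0..1} (\<lambda>t. t ^ j * H (x0 + t *\<^sub>R (x - x0)))) has_derivative
          (\<lambda>v. integral {0..1} (\<lambda>t. t ^ Suc j * frechet_derivative H (at (x0 + t *\<^sub>R (x - x0))) v))) (at x)"
proof -
  define B where "B = ball x0 r"
  \<comment> \<open>\<open>leibniz_rule\<close> asks for a continuous family of bounded linear maps.
    Continuity in each fixed direction yields it because the domain has finite dimension.\<close>
  define H' where "H' y = Blinfun (frechet_derivative H (at y))" for y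
  have H: "(H has_derivative frechet_derivative H (at y)) (at y)" if "y \<in> B" for y
    using ck_on_has_derivative[OF assms(1)] that by (simp add: B_def)
  have H': "blinfun_apply (H' y) = frechet_derivative H (at y)" if "y \<in> B" for y
    unfolding H'_def using has_derivative_bounded_linear[OF H[OF that]] by (rule bounded_linear_Blinfun_apply)
  have "continuous_on B (\<lambda>y. frechet_derivative H (at y) i)" for i
    using assms(1) by (simp add: B_def)
  then have contH': "continuous_on B H'"
    by (intro continuous_on_blinfun_componentwise) (simp cong: continuous_on_cong add: H')
  have seg: "x0 + t *\<^sub>R (y - x0) \<in> B" if "y \<in> B" "t \<in> {0..1}" for y t
  proof -
    have "norm (t *\<^sub>R (y - x0)) \<le> norm (y - x0)"
      using that(2) by (simp add: mult_left_le_one_le)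
    then show ?thesis using that(1) by (simp add: B_def dist_norm norm_minus_commute)
  qed
  have contH: "continuous_on B H"
    using H has_derivative_continuous by (blast intro: continuous_at_imp_continuous_on)
  have contfx: "continuous_on (B \<times> cbox 0 1) (\<lambda>(y, t). t ^ Suc j *\<^sub>R H' (x0 + t *\<^sub>R (y - x0)))"
    unfolding split_beta
    by (intro continuous_intros continuous_on_compose2[OF contH']) (auto intro: seg)
  have "((\<lambda>x. integral (cbox 0 1) (\<lambda>t. t ^ j * H (x0 + t *\<^sub>R (x - x0)))) has_derivative
     integral (cbox 0 1) (\<lambda>t. t ^ Suc j *\<^sub>R H' (x0 + t *\<^sub>R (x - x0)))) (at x within B)"
  proof (rule leibniz_rule[OF _ _ contfx])
    fix y t assume yt: "y \<in> B" "t \<in> cbox (0::real) 1"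
    have "((\<lambda>y. H (x0 + t *\<^sub>R (y - x0))) has_derivative
        (\<lambda>v. frechet_derivative H (at (x0 + t *\<^sub>R (y - x0))) (t *\<^sub>R v))) (at y within B)"
      by (rule has_derivative_compose[OF _ H]) (use yt in \<open>auto intro!: derivative_eq_intros seg\<close>)
    moreover have "frechet_derivative H (at (x0 + t *\<^sub>R (y - x0))) (t *\<^sub>R v)
        = t *\<^sub>R blinfun_apply (H' (x0 + t *\<^sub>R (y - x0))) v" for v
      using yt by (simp add: H'[symmetric] seg blinfun.scaleR_right)
    ultimately have "((\<lambda>y. H (x0 + t *\<^sub>R (y - x0))) has_derivative
        (\<lambda>v. t *\<^sub>R blinfun_apply (H' (x0 + t *\<^sub>R (y - x0))) v)) (at y within B)"
      by simp
    from has_derivative_mult_right[OF this, of "t ^ j"]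
    show "((\<lambda>y. t ^ j * H (x0 + t *\<^sub>R (y - x0))) has_derivative
        blinfun_apply (t ^ Suc j *\<^sub>R H' (x0 + t *\<^sub>R (y - x0)))) (at y within B)"
      by (rule has_derivative_eq_rhs) (auto simp: blinfun.scaleR_left)
  next
    fix y assume y: "y \<in> B"
    show "(\<lambda>t. t ^ j * H (x0 + t *\<^sub>R (y - x0))) integrable_on cbox 0 1"
      by (intro integrable_continuous continuous_intros continuous_on_compose2[OF contH])
        (use y in \<open>auto intro: seg\<close>)
  qed (use assms(2) in \<open>auto simp: B_def\<close>)
  moreover have "(\<lambda>t. t ^ Suc j *\<^sub>R H' (x0 + t *\<^sub>R (x - x0))) integrable_on cbox 0 1"
    by (intro integrable_continuous continuous_intros continuous_on_compose2[OF contH'])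
      (use assms(2) in \<open>auto intro: seg simp: B_def[symmetric]\<close>)
  then have "blinfun_apply (integral (cbox 0 1) (\<lambda>t. t ^ Suc j *\<^sub>R H' (x0 + t *\<^sub>R (x - x0)))) v
      = integral (cbox 0 1) (\<lambda>t. blinfun_apply (t ^ Suc j *\<^sub>R H' (x0 + t *\<^sub>R (x - x0))) v)" for v
    using integral_linear[OF _ blinfun.bounded_linear_left[of v], symmetric] by (simp add: o_def)
  moreover have "integral (cbox 0 1) (\<lambda>t. blinfun_apply (t ^ Suc j *\<^sub>R H' (x0 + t *\<^sub>R (x - x0))) v)
      = integral (cbox 0 1) (\<lambda>t. t ^ Suc j * frechet_derivative H (at (x0 + t *\<^sub>R (x - x0))) v)" for v
    by (rule integral_cong) (use assms(2) in \<open>simp add: blinfun.scaleR_left H' seg B_def[symmetric]\<close>)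
  ultimately have "((\<lambda>x. integral (cbox 0 1) (\<lambda>t. t ^ j * H (x0 + t *\<^sub>R (x - x0)))) has_derivative
      (\<lambda>v. integral (cbox 0 1) (\<lambda>t. t ^ Suc j * frechet_derivative H (at (x0 + t *\<^sub>R (x - x0))) v)))
      (at x within B)"
    by (elim has_derivative_eq_rhs) (simp only: fun_eq_iff simp_thms)
  then show ?thesis
    using assms(2) at_within_open[of x B] by (simp add: B_def)
qed

lemma ck_on_integral_segment:
  fixes H :: "'e::euclidean_space \<Rightarrow> real"
  assumes "\<And>k. ck_on k (ball x0 r) H"
  shows "ck_on k (ball x0 r) (\<lambda>x. integral {0..1} (\<lambda>t. t ^ j * H (x0 + t *\<^sub>R (x - x0))))"
  using assms
proof (induction k arbitrary: H j)
  case 0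
  show ?case
    using has_derivative_continuous[OF has_derivative_integral_segment[OF 0]]
    by (simp add: continuous_at_imp_continuous_on del: ck_on.simps(2))
next
  case (Suc k)
  show ?case
  proof (rule ck_on_SucI[OF open_ball has_derivative_integral_segment[OF Suc.prems]])
    fix v
    show "ck_on k (ball x0 r) (\<lambda>x. integral {0..1} (\<lambda>t. t ^ Suc j * frechet_derivative H (at (x0 + t *\<^sub>R (x - x0))) v))"
      using Suc.prems[of "Suc _"] by (intro Suc.IH) simp
  qed
qed

text \<open>The fundamental theorem of calculus along the segment from x0 to x, which stays in the
  ball. The factors \<open>g i\<close> are the averages of the partial derivatives over this
  segment, smooth by the previous lemma with \<open>j = 0\<close>.\<close>

lemma hadamard:
  fixes G :: "'e::euclidean_space \<Rightarrow> real"
  assumes "\<And>k. ck_on k (ball x0 r) G"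
  obtains g where "\<And>i k. ck_on k (ball x0 r) (g i)"
    "\<And>x. x \<in> ball x0 r \<Longrightarrow> G x = G x0 + (\<Sum>i\<in>Basis. ((x - x0) \<bullet> i) * g i x)"
proof
  let ?g = "\<lambda>i x. integral {0..1} (\<lambda>t. t ^ 0 * frechet_derivative G (at (x0 + t *\<^sub>R (x - x0))) i)"
  have ck: "ck_on k (ball x0 r) (\<lambda>x. frechet_derivative G (at x) i)" for k i
    using assms[of "Suc k"] by simp
  then show "ck_on k (ball x0 r) (?g i)" for i k
    by (rule ck_on_integral_segment)
  fix x assume x: "x \<in> ball x0 r"
  have seg: "x0 + t *\<^sub>R (x - x0) \<in> ball x0 r" if "t \<in> {0..1}" for t
  proof -
    have "norm (t *\<^sub>R (x - x0)) \<le> norm (x - x0)"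
      using that by (simp add: mult_left_le_one_le)
    then show ?thesis using x by (simp add: dist_norm norm_minus_commute)
  qed
  have G: "(G has_derivative frechet_derivative G (at y)) (at y)" if "y \<in> ball x0 r" for y
    using ck_on_has_derivative[OF assms that] .
  let ?d = "\<lambda>t. frechet_derivative G (at (x0 + t *\<^sub>R (x - x0)))"
  have "((\<lambda>t. ?d t (x - x0)) has_integral G (x0 + 1 *\<^sub>R (x - x0)) - G (x0 + 0 *\<^sub>R (x - x0))) {0..1}"
  proof (rule fundamental_theorem_of_calculus)
    fix t :: real assume t: "t \<in> {0..1}"
    have "((\<lambda>t. G (x0 + t *\<^sub>R (x - x0))) has_derivative (\<lambda>s. ?d t (s *\<^sub>R (x - x0)))) (at t within {0..1})"
      by (rule has_derivative_compose[where f = "\<lambda>t. x0 + t *\<^sub>R (x - x0)", OF _ G[OF seg[OF t]]])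
        (auto intro!: derivative_eq_intros)
    then show "((\<lambda>t. G (x0 + t *\<^sub>R (x - x0))) has_vector_derivative ?d t (x - x0)) (at t within {0..1})"
      using linear_scale[OF has_derivative_linear[OF G[OF seg[OF t]]]]
      by (simp add: has_vector_derivative_def)
  qed simp
  then have "G x - G x0 = integral {0..1} (\<lambda>t. ?d t (x - x0))"
    by (simp add: integral_unique)
  also have "\<dots> = integral {0..1} (\<lambda>t. \<Sum>i\<in>Basis. ((x - x0) \<bullet> i) *\<^sub>R ?d t i)"
    using linear_eq_componentwise[OF has_derivative_linear[OF G[OF seg]], of _ "x - x0"]
    by (auto intro!: integral_cong)
  also have "\<dots> = (\<Sum>i\<in>Basis. integral {0..1} (\<lambda>t. ((x - x0) \<bullet> i) *\<^sub>R ?d t i))"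
  proof (rule integral_sum)
    fix i :: 'e
    have "continuous_on {0..1} (\<lambda>t. ?d t i)"
      by (rule continuous_on_compose2[OF ck_on_imp_continuous_on[OF ck[of 0]]])
        (use seg in \<open>auto intro!: continuous_intros\<close>)
    then show "(\<lambda>t. ((x - x0) \<bullet> i) *\<^sub>R ?d t i) integrable_on {0..1}"
      by (intro integrable_continuous_real continuous_intros)
  qed simp
  finally show "G x = G x0 + (\<Sum>i\<in>Basis. ((x - x0) \<bullet> i) * ?g i x)"
    by simp
qed

section \<open>Smooth functions on manifolds\<close>

text \<open>
  Weaker than \<open>smooth_atlas\<close>: on total spaces of vector bundles the smoothness of the transition maps is
  never needed.
\<close>

definition charted :: "('m, 'e::euclidean_space) manifold \<Rightarrow> bool" where
  "charted M \<longleftrightarrow> (\<Union>(U, \<phi>)\<in>atlas M. U) = points M \<and>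
     (\<forall>(U, \<phi>)\<in>atlas M. inj_on \<phi> U \<and> openin (top_of_set (model M)) (\<phi> ` U))"

lemma chartedD:
  assumes "charted M" "(U, \<phi>) \<in> atlas M"
  shows "inj_on \<phi> U" "\<phi> ` U \<subseteq> model M" "U \<subseteq> points M" "openin (top_of_set (model M)) (\<phi> ` U)"
proof -
  have "\<forall>x\<in>atlas M. case x of (U, \<phi>) \<Rightarrow> inj_on \<phi> U \<and> openin (top_of_set (model M)) (\<phi> ` U)"
    using assms(1) by (simp add: charted_def)
  from bspec[OF this assms(2)] show "inj_on \<phi> U" "openin (top_of_set (model M)) (\<phi> ` U)" by simp_all
  then show "\<phi> ` U \<subseteq> model M" using openin_imp_subset by blast
  show "U \<subseteq> points M" using assms by (auto simp: charted_def)
qed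

lemma charted_cover:
  assumes "charted M" "p \<in> points M"
  obtains U \<phi> where "(U, \<phi>) \<in> atlas M" "p \<in> U"
proof -
  have "p \<in> (\<Union>(U, \<phi>)\<in>atlas M. U)" using assms by (simp add: charted_def)
  then show ?thesis using that by auto
qed

lemma smooth_atlas_charted: "smooth_atlas M \<Longrightarrow> charted M"
  unfolding smooth_atlas_def charted_def by (fastforce dest: openin_imp_subset)

lemma smooth_manifold_atlas: "smooth_manifold M \<Longrightarrow> smooth_atlas M"
  by (simp add: smooth_manifold_def)

lemma smooth_manifold_charted: "smooth_manifold M \<Longrightarrow> charted M"
  by (simp add: smooth_manifold_atlas smooth_atlas_charted)

section \<open>Algebra and locality of smooth functions\<close>

lemma smooth_fun_onI:
  "(\<And>U \<phi>. (U, \<phi>) \<in> atlas M \<Longrightarrow> smooth_on (\<phi> ` (U \<inter> W)) (f \<circ> inv_into U \<phi>)) \<Longrightarrow> smooth_fun_on M W f"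
  by (auto simp: smooth_fun_on_def)

lemma smooth_fun_onD:
  "smooth_fun_on M W f \<Longrightarrow> (U, \<phi>) \<in> atlas M \<Longrightarrow> smooth_on (\<phi> ` (U \<inter> W)) (f \<circ> inv_into U \<phi>)"
  by (auto simp: smooth_fun_on_def)

lemma smooth_fun_on_cong:
  assumes "charted M" "smooth_fun_on M W f" "\<And>p. p \<in> points M \<Longrightarrow> p \<in> W \<Longrightarrow> f p = g p"
  shows "smooth_fun_on M W g"
proof (rule smooth_fun_onI)
  fix U \<phi> assume U: "(U, \<phi>) \<in> atlas M"
  show "smooth_on (\<phi> ` (U \<inter> W)) (g \<circ> inv_into U \<phi>)"
    by (rule smooth_on_cong[OF _ smooth_fun_onD[OF assms(2) U]])
      (use chartedD[OF assms(1) U] assms(3) in auto)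
qed

lemma smooth_fun_on_subset: "smooth_fun_on M W f \<Longrightarrow> W' \<subseteq> W \<Longrightarrow> smooth_fun_on M W' f"
  by (auto simp: smooth_fun_on_def intro: smooth_on_subset)

lemma smooth_fun_on_Int_points:
  assumes "charted M" "smooth_fun_on M (points M \<inter> W) f"
  shows "smooth_fun_on M W f"
proof (rule smooth_fun_onI)
  fix U \<phi> assume U: "(U, \<phi>) \<in> atlas M"
  then have "U \<inter> (points M \<inter> W) = U \<inter> W" using chartedD[OF assms(1)] by blast
  then show "smooth_on (\<phi> ` (U \<inter> W)) (f \<circ> inv_into U \<phi>)"
    using smooth_fun_onD[OF assms(2) U] by simp
qed

lemma smooth_fun_on_const: "smooth_fun_on M W (\<lambda>p. c)"
  by (simp add: smooth_fun_on_def o_def smooth_on_const)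

lemma smooth_fun_on_add:
  "smooth_fun_on M W f \<Longrightarrow> smooth_fun_on M W g \<Longrightarrow> smooth_fun_on M W (\<lambda>p. f p + g p)"
  by (auto simp: smooth_fun_on_def o_def intro: smooth_on_add)

lemma smooth_fun_on_scaleR:
  "smooth_fun_on M W f \<Longrightarrow> smooth_fun_on M W g \<Longrightarrow> smooth_fun_on M W (\<lambda>p. f p *\<^sub>R g p)"
  by (auto simp: smooth_fun_on_def o_def intro: smooth_on_scaleR)

lemma smooth_fun_on_mult:
  fixes f g :: "'m \<Rightarrow> real"
  shows "smooth_fun_on M W f \<Longrightarrow> smooth_fun_on M W g \<Longrightarrow> smooth_fun_on M W (\<lambda>p. f p * g p)"
  using smooth_fun_on_scaleR[of M W f g] by simp

lemma smooth_fun_on_sum: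
  "(\<And>i. i \<in> I \<Longrightarrow> smooth_fun_on M W (f i)) \<Longrightarrow> smooth_fun_on M W (\<lambda>p. \<Sum>i\<in>I. f i p)"
  by (induction I rule: infinite_finite_induct) (auto intro!: smooth_fun_on_add smooth_fun_on_const)

lemma smooth_fun_on_linear:
  "smooth_fun_on M W f \<Longrightarrow> bounded_linear L \<Longrightarrow> smooth_fun_on M W (\<lambda>p. L (f p))"
  by (auto simp: smooth_fun_on_def o_def intro: smooth_on_linear_compose)

text \<open>\<open>smooth_on\<close> is local in the model space, \<open>mfd_open\<close> in the
  manifold. Injectivity of the chart turns an open neighbourhood of p into an open set T of the
  ambient space of the model.\<close>

lemma smooth_fun_on_local:
  assumes M: "charted M"
    and loc: "\<And>p. p \<in> points M \<Longrightarrow> p \<in> W \<Longrightarrow> \<exists>W'. mfd_open M W' \<and> p \<in> W' \<and> smooth_fun_on M (W \<inter> W') f"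
  shows "smooth_fun_on M W f"
proof (rule smooth_fun_onI, rule smooth_on_local)
  fix U \<phi> x assume U: "(U, \<phi>) \<in> atlas M" and "x \<in> \<phi> ` (U \<inter> W)"
  then obtain p where p: "p \<in> U" "p \<in> W" "x = \<phi> p" by blast
  note inj = chartedD[OF M U]
  obtain W' where W': "mfd_open M W'" "p \<in> W'" "smooth_fun_on M (W \<inter> W') f"
    using loc[of p] p inj by blast
  then obtain T where T: "open T" "\<phi> ` (W' \<inter> U) = model M \<inter> T"
    using U by (auto simp: mfd_open_def openin_open)
  have "\<phi> ` (U \<inter> W) \<inter> T \<subseteq> \<phi> ` (U \<inter> (W \<inter> W'))"
  proof
    fix y assume y: "y \<in> \<phi> ` (U \<inter> W) \<inter> T"
    then obtain q where q: "q \<in> U" "q \<in> W" "y = \<phi> q" by blast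
    then have "\<phi> q \<in> \<phi> ` (W' \<inter> U)" using y T(2) inj by blast
    then have "q \<in> W'" using inj(1) q(1) by (auto simp: inj_on_def)
    then show "y \<in> \<phi> ` (U \<inter> (W \<inter> W'))" using q by blast
  qed
  then have "smooth_on (\<phi> ` (U \<inter> W) \<inter> T) (f \<circ> inv_into U \<phi>)"
    using smooth_fun_onD[OF W'(3) U] smooth_on_subset by blast
  moreover have "x \<in> T" using T(2) p W' by blast
  ultimately show "\<exists>T. open T \<and> x \<in> T \<and> smooth_on (\<phi> ` (U \<inter> W) \<inter> T) (f \<circ> inv_into U \<phi>)"
    using T(1) by blast
qed

section \<open>Pullback of functions and continuity of smooth maps\<close>

lemma smooth_mapD:
  assumes "smooth_map N M f"
  shows "p \<in> points N \<Longrightarrow> f p \<in> points M"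
    and "(U, \<phi>) \<in> atlas N \<Longrightarrow> (V, \<psi>) \<in> atlas M \<Longrightarrow> openin (top_of_set (model N)) (\<phi> ` (U \<inter> f -` V))"
    and "(U, \<phi>) \<in> atlas N \<Longrightarrow> (V, \<psi>) \<in> atlas M \<Longrightarrow>
      smooth_on (\<phi> ` (U \<inter> f -` V)) (\<psi> \<circ> f \<circ> inv_into U \<phi>)"
  using assms unfolding smooth_map_def by (blast, fast, fast)

lemma smooth_fun_on_pullback:
  fixes N :: "('n, 'k::euclidean_space) manifold" and M :: "('m, 'e::euclidean_space) manifold"
  assumes N: "charted N" and M: "charted M" and f: "smooth_map N M f" and g: "smooth_fun_on M W g"
  shows "smooth_fun_on N (f -` W) (\<lambda>p. g (f p))"
proof (rule smooth_fun_onI, rule smooth_on_local)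
  fix U \<phi> x assume U: "(U, \<phi>) \<in> atlas N" and "x \<in> \<phi> ` (U \<inter> f -` W)"
  then obtain p where p: "p \<in> U" "f p \<in> W" "x = \<phi> p" by blast
  note inj = chartedD[OF N U]
  have "f p \<in> points M" using smooth_mapD(1)[OF f] p inj by blast
  then obtain V \<psi> where V: "(V, \<psi>) \<in> atlas M" "f p \<in> V"
    using charted_cover[OF M] by blast
  note inj' = chartedD[OF M V(1)]
  obtain T where T: "open T" "\<phi> ` (U \<inter> f -` V) = model N \<inter> T"
    using smooth_mapD(2)[OF f U V(1)] by (auto simp: openin_open)
  \<comment> \<open>Over T the map f stays within the single chart V, so g after f is the coordinate
    form of g composed with that of f.\<close>
  let ?S = "\<phi> ` (U \<inter> f -` W) \<inter> T"
  have S: "\<exists>q. q \<in> U \<and> f q \<in> V \<and> f q \<in> W \<and> y = \<phi> q" if y: "y \<in> ?S" for y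
  proof -
    obtain q where q: "q \<in> U" "f q \<in> W" "y = \<phi> q" using y by blast
    then have "\<phi> q \<in> \<phi> ` (U \<inter> f -` V)" using y T(2) inj by blast
    then have "f q \<in> V" using inj(1) q(1) by (auto simp: inj_on_def)
    then show ?thesis using q by blast
  qed
  have "smooth_on ?S (\<psi> \<circ> f \<circ> inv_into U \<phi>)"
    by (rule smooth_on_subset[OF smooth_mapD(3)[OF f U V(1)]]) (use S in blast)
  moreover have "(\<psi> \<circ> f \<circ> inv_into U \<phi>) ` ?S \<subseteq> \<psi> ` (V \<inter> W)"
    using S inj(1) by fastforce
  ultimately have "smooth_on ?S (\<lambda>y. (g \<circ> inv_into V \<psi>) ((\<psi> \<circ> f \<circ> inv_into U \<phi>) y))"
    by (intro smooth_on_compose[OF _ smooth_fun_onD[OF g V(1)]])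
  moreover have "(g \<circ> inv_into V \<psi>) ((\<psi> \<circ> f \<circ> inv_into U \<phi>) y) = ((\<lambda>p. g (f p)) \<circ> inv_into U \<phi>) y" if "y \<in> ?S" for y
    using S[OF that] inj(1) inj'(1) by auto
  ultimately have "smooth_on ?S ((\<lambda>p. g (f p)) \<circ> inv_into U \<phi>)"
    by (rule smooth_on_cong[rotated])
  moreover have "x \<in> T" using T(2) p V by blast
  ultimately show "\<exists>T. open T \<and> x \<in> T \<and> smooth_on (\<phi> ` (U \<inter> f -` W) \<inter> T) ((\<lambda>p. g (f p)) \<circ> inv_into U \<phi>)"
    using T(1) by blast
qed

text \<open>\<open>smooth_map\<close> supplies openness for preimages of chart domains. Inside one
  of them continuity of the coordinate expression cuts out W, and the union over the charts of M
  gives the whole preimage.\<close>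

lemma smooth_map_preimage_open:
  fixes N :: "('n, 'k::euclidean_space) manifold" and M :: "('m, 'e::euclidean_space) manifold"
  assumes N: "charted N" and M: "charted M" and f: "smooth_map N M f" and W: "mfd_open M W"
  shows "mfd_open N (points N \<inter> f -` W)"
  unfolding mfd_open_def
proof (intro conjI ballI, simp, safe)
  fix U \<phi> assume U: "(U, \<phi>) \<in> atlas N"
  note inj = chartedD[OF N U]
  have "openin (top_of_set (model N)) (\<phi> ` (U \<inter> f -` (V \<inter> W)))" if V: "(V, \<psi>) \<in> atlas M" for V \<psi>
  proof -
    note inj' = chartedD[OF M V]
    let ?g = "\<psi> \<circ> f \<circ> inv_into U \<phi>" and ?S = "\<phi> ` (U \<inter> f -` V)"
    obtain T where T: "open T" "\<psi> ` (W \<inter> V) = model M \<inter> T"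
      using W V by (auto simp: mfd_open_def openin_open)
    have "f p \<in> W \<longleftrightarrow> ?g (\<phi> p) \<in> T" if p: "p \<in> U" "f p \<in> V" for p
    proof -
      have "\<psi> (f p) \<in> model M" using p inj'(2) by blast
      then have "?g (\<phi> p) \<in> T \<longleftrightarrow> \<psi> (f p) \<in> \<psi> ` (W \<inter> V)"
        using T(2) p inj(1) by simp
      then show ?thesis using inj'(1) p by (auto simp: inj_on_def)
    qed
    then have "\<phi> ` (U \<inter> f -` (V \<inter> W)) = ?S \<inter> ?g -` T"
      by blast
    moreover have "openin (top_of_set ?S) (?S \<inter> ?g -` T)"
      using smooth_on_imp_continuous_on[OF smooth_mapD(3)[OF f U V]] T(1)
      by (rule continuous_openin_preimage_gen)
    ultimately show ?thesis
      using smooth_mapD(2)[OF f U V] openin_trans by metis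
  qed
  then have "openin (top_of_set (model N)) (\<Union>(V, \<psi>)\<in>atlas M. \<phi> ` (U \<inter> f -` (V \<inter> W)))"
    by (intro openin_Union) auto
  also have "(\<Union>(V, \<psi>)\<in>atlas M. \<phi> ` (U \<inter> f -` (V \<inter> W))) = \<phi> ` (points N \<inter> f -` W \<inter> U)"
  proof
    show "(\<Union>(V, \<psi>)\<in>atlas M. \<phi> ` (U \<inter> f -` (V \<inter> W))) \<subseteq> \<phi> ` (points N \<inter> f -` W \<inter> U)"
      using inj(3) by blast
    show "\<phi> ` (points N \<inter> f -` W \<inter> U) \<subseteq> (\<Union>(V, \<psi>)\<in>atlas M. \<phi> ` (U \<inter> f -` (V \<inter> W)))"
    proof
      fix x assume "x \<in> \<phi> ` (points N \<inter> f -` W \<inter> U)"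
      then obtain p where p: "p \<in> points N" "f p \<in> W" "p \<in> U" "x = \<phi> p" by blast
      then obtain V \<psi> where "(V, \<psi>) \<in> atlas M" "f p \<in> V"
        using charted_cover[OF M smooth_mapD(1)[OF f]] by blast
      then show "x \<in> (\<Union>(V, \<psi>)\<in>atlas M. \<phi> ` (U \<inter> f -` (V \<inter> W)))" using p by blast
    qed
  qed
  finally show "openin (top_of_set (model N)) (\<phi> ` (points N \<inter> f -` W \<inter> U))" .
qed

section \<open>Cut-off functions on a manifold\<close>

lemma mfd_open_points: "smooth_atlas M \<Longrightarrow> mfd_open M (points M)"
proof -
  assume M: "smooth_atlas M"
  have "points M \<inter> U = U" if "(U, \<phi>) \<in> atlas M" for U \<phi>
    using chartedD[OF smooth_atlas_charted[OF M] that] by blast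
  then show ?thesis using M by (auto simp: mfd_open_def smooth_atlas_def)
qed

lemma mfd_open_Int: "smooth_atlas M \<Longrightarrow> mfd_open M W \<Longrightarrow> mfd_open M W' \<Longrightarrow> mfd_open M (W \<inter> W')"
  using openin_Int[of "mfd_topology M" W W'] by (simp add: openin_mfd_topology)

lemma mfd_open_chart:
  assumes M: "smooth_atlas M" and U: "(U, \<phi>) \<in> atlas M" and T: "open T"
  shows "mfd_open M {p \<in> U. \<phi> p \<in> T}"
  unfolding mfd_open_def
proof (intro conjI ballI, use chartedD[OF smooth_atlas_charted[OF M] U] in blast, safe)
  fix V \<psi> assume V: "(V, \<psi>) \<in> atlas M"
  note inj = chartedD[OF smooth_atlas_charted[OF M] V]
  let ?S = "\<psi> ` (V \<inter> U)"
  have *: "openin (top_of_set (model M)) ?S" "smooth_on ?S (\<phi> \<circ> inv_into V \<psi>)"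
    using M U V unfolding smooth_atlas_def by blast+
  have "\<psi> ` ({p \<in> U. \<phi> p \<in> T} \<inter> V) = ?S \<inter> (\<phi> \<circ> inv_into V \<psi>) -` T"
    using inj(1) by auto
  moreover have "openin (top_of_set ?S) (?S \<inter> (\<phi> \<circ> inv_into V \<psi>) -` T)"
    by (rule continuous_openin_preimage_gen[OF smooth_on_imp_continuous_on[OF *(2)] T])
  ultimately show "openin (top_of_set (model M)) (\<psi> ` ({p \<in> U. \<phi> p \<in> T} \<inter> V))"
    using *(1) openin_trans by metis
qed

lemma smooth_fun_on_chart:
  assumes M: "smooth_atlas M" and U: "(U, \<phi>) \<in> atlas M" and g: "smooth_on T g"
  shows "smooth_fun_on M {p \<in> U. \<phi> p \<in> T} (\<lambda>p. g (\<phi> p))"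
proof (rule smooth_fun_onI)
  fix V \<psi> assume V: "(V, \<psi>) \<in> atlas M"
  note inj = chartedD[OF smooth_atlas_charted[OF M] V]
  have "smooth_on (\<psi> ` (V \<inter> U)) (\<phi> \<circ> inv_into V \<psi>)"
    using M U V unfolding smooth_atlas_def by blast
  then have "smooth_on (\<psi> ` (V \<inter> {p \<in> U. \<phi> p \<in> T})) (\<phi> \<circ> inv_into V \<psi>)"
    by (rule smooth_on_subset) blast
  moreover have "(\<phi> \<circ> inv_into V \<psi>) ` \<psi> ` (V \<inter> {p \<in> U. \<phi> p \<in> T}) \<subseteq> T"
    using inj(1) by auto
  ultimately have "smooth_on (\<psi> ` (V \<inter> {p \<in> U. \<phi> p \<in> T})) (\<lambda>x. g ((\<phi> \<circ> inv_into V \<psi>) x))"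
    by (rule smooth_on_compose[OF _ g])
  then show "smooth_on (\<psi> ` (V \<inter> {p \<in> U. \<phi> p \<in> T})) ((\<lambda>p. g (\<phi> p)) \<circ> inv_into V \<psi>)"
    by (simp add: o_def)
qed

text \<open>K is a closed set off which h vanishes. The open sets \<open>O'\<close> and the
  complement of K cover M; h is smooth on the first and zero on the second.\<close>

lemma smooth_fun_on_extend_zero:
  assumes M: "charted M" and O: "mfd_open M O'" and K: "mfd_open M (points M - K)" "K \<subseteq> O'"
    and h: "smooth_fun_on M (W \<inter> O') h" "\<And>p. p \<in> points M \<Longrightarrow> p \<in> W \<Longrightarrow> p \<notin> K \<Longrightarrow> h p = 0"
  shows "smooth_fun_on M W h"
proof (rule smooth_fun_on_local[OF M])
  fix p assume p: "p \<in> points M" "p \<in> W"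
  show "\<exists>W'. mfd_open M W' \<and> p \<in> W' \<and> smooth_fun_on M (W \<inter> W') h"
  proof (cases "p \<in> O'")
    case True
    then show ?thesis using O h(1) by blast
  next
    case False
    have "smooth_fun_on M (W \<inter> (points M - K)) h"
      by (rule smooth_fun_on_cong[OF M smooth_fun_on_const[of _ _ 0]])
        (use h(2) in auto)
    then show ?thesis using K p False by blast
  qed
qed

text \<open>The Hausdorff property enters here. A closed ball in a chart is compact, and so is its
  preimage K in M; in a Hausdorff space K is therefore closed, which makes the extension by zero
  beyond the chart smooth.\<close>

lemma manifold_bump:
  fixes M :: "('m, 'e::euclidean_space) manifold"
  assumes M: "smooth_manifold M" and O: "mfd_open M O'" "p \<in> O'"
  obtains \<eta> K where "\<eta> \<in> smooth_funs M" "\<eta> p = 1" "K \<subseteq> O'" "mfd_open M (points M - K)"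
    "\<And>q. q \<notin> K \<Longrightarrow> \<eta> q = 0"
proof -
  note at = smooth_manifold_atlas[OF M] and ch = smooth_manifold_charted[OF M]
  have "p \<in> points M" using O by (auto simp: mfd_open_def)
  then obtain U \<phi> where U: "(U, \<phi>) \<in> atlas M" "p \<in> U"
    using charted_cover[OF ch] by blast
  note inj = chartedD[OF ch U(1)]
  obtain T where T: "open T" "\<phi> ` (O' \<inter> U) = model M \<inter> T"
    using O U by (auto simp: mfd_open_def openin_open)
  then have "\<phi> p \<in> T" using O U by blast
  then obtain r where r: "r > 0" "cball (\<phi> p) r \<subseteq> T"
    using T(1) open_contains_cball by blast
  obtain \<beta> :: "'e \<Rightarrow> real" where \<beta>: "smooth_on UNIV \<beta>" "\<beta> (\<phi> p) = 1" "\<And>x. x \<notin> cball (\<phi> p) r \<Longrightarrow> \<beta> x = 0"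
    using smooth_bump[OF r(1)] by metis
  define K where "K = {q \<in> U. \<phi> q \<in> cball (\<phi> p) r}"
  define \<eta> where "\<eta> q = (if q \<in> U then \<beta> (\<phi> q) else 0)" for q
  have K: "K \<subseteq> O'"
  proof
    fix q assume q: "q \<in> K"
    then have "\<phi> q \<in> \<phi> ` (O' \<inter> U)" using T(2) r inj by (auto simp: K_def)
    then show "q \<in> O'" using inj(1) q by (auto simp: K_def inj_on_def)
  qed
  \<comment> \<open>The model may be a proper subspace, so the ball is cut down to it. Subspaces of
    a Euclidean space are closed, which keeps the intersection compact.\<close>
  let ?C = "cball (\<phi> p) r \<inter> model M"
  have C: "?C \<subseteq> \<phi> ` U" using T(2) r(2) by blast
  have "\<phi> ` K = ?C"
  proof
    show "\<phi> ` K \<subseteq> ?C" using inj(2) by (auto simp: K_def)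
    show "?C \<subseteq> \<phi> ` K" using C by (auto simp: K_def)
  qed
  then have K_eq: "K = inv_into U \<phi> ` ?C"
    using inv_into_image_cancel[OF inj(1), of K] by (auto simp: K_def)
  have inv: "inv_into U \<phi> x \<in> U" "\<phi> (inv_into U \<phi> x) = x" if "x \<in> ?C" for x
    using inv_into_into[OF subsetD[OF C that]] f_inv_into_f[OF subsetD[OF C that]] .
  have topsp: "topspace (mfd_topology M) = points M"
    using mfd_open_points[OF at] unfolding topspace_def openin_mfd_topology[OF at]
    by (auto simp: mfd_open_def)
  have "continuous_map (top_of_set ?C) (mfd_topology M) (inv_into U \<phi>)"
    unfolding continuous_map_def
  proof (intro conjI allI impI funcsetI)
    fix x assume "x \<in> topspace (top_of_set ?C)"
    then show "inv_into U \<phi> x \<in> topspace (mfd_topology M)"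
      using inv(1)[of x] inj(3) topsp by auto
  next
    fix W assume "openin (mfd_topology M) W"
    then have W: "openin (top_of_set (model M)) (\<phi> ` (W \<inter> U))"
      using U by (auto simp: openin_mfd_topology[OF at] mfd_open_def)
    have "inv_into U \<phi> x \<in> W \<longleftrightarrow> x \<in> \<phi> ` (W \<inter> U)" if "x \<in> ?C" for x
      using inv[OF that] inj(1) by (metis (no_types) Int_iff image_iff inv_into_f_f)
    then have "{x \<in> topspace (top_of_set ?C). inv_into U \<phi> x \<in> W} = ?C \<inter> \<phi> ` (W \<inter> U)"
      by auto
    moreover have "openin (top_of_set ?C) (?C \<inter> \<phi> ` (W \<inter> U))"
      using W by (auto simp: openin_open)
    ultimately show "openin (top_of_set ?C) {x \<in> topspace (top_of_set ?C). inv_into U \<phi> x \<in> W}"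
      by simp
  qed
  moreover have "subspace (model M)" using at by (simp add: smooth_atlas_def)
  then have "compact ?C" by (intro compact_Int_closed closed_subspace) auto
  then have "compactin (top_of_set ?C) ?C" by (simp add: compactin_subtopology)
  ultimately have "compactin (mfd_topology M) K"
    unfolding K_eq by (rule image_compactin[rotated])
  then have "closedin (mfd_topology M) K"
    using M by (intro compactin_imp_closedin) (simp_all add: smooth_manifold_def)
  then have "openin (mfd_topology M) (topspace (mfd_topology M) - K)" by blast
  then have Kc: "mfd_open M (points M - K)"
    by (simp add: openin_mfd_topology[OF at] topsp)
  have \<eta>0: "\<eta> q = 0" if "q \<notin> K" for q using that \<beta>(3) by (auto simp: \<eta>_def K_def)
  have "smooth_fun_on M U \<eta>"
    using smooth_fun_on_cong[OF ch, of U "\<lambda>q. \<beta> (\<phi> q)" \<eta>] smooth_fun_on_chart[OF at U(1) \<beta>(1)]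
    by (simp add: \<eta>_def)
  then have "smooth_fun_on M (points M \<inter> U) \<eta>" by (rule smooth_fun_on_subset) blast
  moreover have "mfd_open M U" using mfd_open_chart[OF at U(1), of UNIV] by simp
  moreover have "K \<subseteq> U" by (auto simp: K_def)
  ultimately have "smooth_fun_on M (points M) \<eta>"
    using smooth_fun_on_extend_zero[OF ch _ Kc, of U "points M" \<eta>] \<eta>0 by blast
  then have "\<eta> \<in> smooth_funs M" by (simp add: smooth_funs_def)
  moreover have "\<eta> p = 1" using U \<beta>(2) by (simp add: \<eta>_def)
  ultimately show thesis using that K Kc \<eta>0 by blast
qed

lemma smooth_fun_on_compose:
  fixes f :: "'m \<Rightarrow> 'f::euclidean_space" and g :: "'f \<Rightarrow> 'g::real_normed_vector"
  assumes M: "charted M" and f: "smooth_fun_on M W f" and g: "smooth_on T g"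
    and T: "\<And>p. p \<in> points M \<Longrightarrow> p \<in> W \<Longrightarrow> f p \<in> T"
  shows "smooth_fun_on M W (\<lambda>p. g (f p))"
proof (rule smooth_fun_onI)
  fix U \<phi> assume U: "(U, \<phi>) \<in> atlas M"
  have "(f \<circ> inv_into U \<phi>) ` \<phi> ` (U \<inter> W) \<subseteq> T"
    using chartedD[OF M U] T by auto
  from smooth_on_compose[OF smooth_fun_onD[OF f U] g this]
  show "smooth_on (\<phi> ` (U \<inter> W)) ((\<lambda>p. g (f p)) \<circ> inv_into U \<phi>)" by (simp add: o_def)
qed

lemma mfd_open_nonzero:
  assumes M: "charted M" and f: "f \<in> smooth_funs M"
  shows "mfd_open M {p \<in> points M. f p \<noteq> 0}"
  unfolding mfd_open_def
proof (intro conjI ballI, blast, safe)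
  fix U \<phi> assume U: "(U, \<phi>) \<in> atlas M"
  note inj = chartedD[OF M U]
  have "smooth_on (\<phi> ` U) (f \<circ> inv_into U \<phi>)"
    using f U inj smooth_fun_onD[of M "points M" f U \<phi>] by (simp add: smooth_funs_def Int_absorb2)
  then have "openin (top_of_set (\<phi> ` U)) (\<phi> ` U \<inter> (f \<circ> inv_into U \<phi>) -` (- {0}))"
    by (intro continuous_openin_preimage_gen smooth_on_imp_continuous_on) auto
  moreover have "\<phi> ` U \<inter> (f \<circ> inv_into U \<phi>) -` (- {0}) = \<phi> ` ({p \<in> points M. f p \<noteq> 0} \<inter> U)"
    using inj by auto
  ultimately show "openin (top_of_set (model M)) (\<phi> ` ({p \<in> points M. f p \<noteq> 0} \<inter> U))"
    using inj(4) openin_trans by metis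
qed

text \<open>Near p the function \<kappa> is invertible, so f is recovered by division. Expansions in
  a cut-off frame determine only such a multiple of the object of interest.\<close>

lemma smooth_fun_on_cutoff:
  assumes M: "charted M"
    and \<kappa>: "\<And>p. p \<in> points M \<Longrightarrow> p \<in> W \<Longrightarrow>
      \<exists>\<kappa>\<in>smooth_funs M. \<kappa> p \<noteq> 0 \<and> smooth_fun_on M W (\<lambda>q. \<kappa> q *\<^sub>R f q)"
  shows "smooth_fun_on M W f"
proof (rule smooth_fun_on_local[OF M])
  fix p assume p: "p \<in> points M" "p \<in> W"
  then obtain \<kappa> where \<kappa>: "\<kappa> \<in> smooth_funs M" "\<kappa> p \<noteq> 0" "smooth_fun_on M W (\<lambda>q. \<kappa> q *\<^sub>R f q)"
    using \<kappa> by blast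
  let ?O = "{p \<in> points M. \<kappa> p \<noteq> 0}"
  have "smooth_fun_on M (W \<inter> ?O) \<kappa>"
    using \<kappa>(1) by (auto simp: smooth_funs_def intro: smooth_fun_on_subset)
  then have "smooth_fun_on M (W \<inter> ?O) (\<lambda>q. inverse (\<kappa> q))"
    by (rule smooth_fun_on_compose[OF M _ smooth_on_inverse]) auto
  moreover have "smooth_fun_on M (W \<inter> ?O) (\<lambda>q. \<kappa> q *\<^sub>R f q)"
    using \<kappa>(3) by (rule smooth_fun_on_subset) blast
  ultimately have "smooth_fun_on M (W \<inter> ?O) (\<lambda>q. inverse (\<kappa> q) *\<^sub>R (\<kappa> q *\<^sub>R f q))"
    by (rule smooth_fun_on_scaleR)
  then have "smooth_fun_on M (W \<inter> ?O) f"
    by (rule smooth_fun_on_cong[OF M]) auto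
  then show "\<exists>W'. mfd_open M W' \<and> p \<in> W' \<and> smooth_fun_on M (W \<inter> W') f"
    using mfd_open_nonzero[OF M \<kappa>(1)] p \<kappa>(2) by blast
qed

section \<open>The ring of smooth functions\<close>

lemma smooth_funs_const: "(\<lambda>p. c) \<in> smooth_funs M"
  and smooth_funs_add: "f \<in> smooth_funs M \<Longrightarrow> g \<in> smooth_funs M \<Longrightarrow> (\<lambda>p. f p + g p) \<in> smooth_funs M"
  and smooth_funs_mult: "f \<in> smooth_funs M \<Longrightarrow> g \<in> smooth_funs M \<Longrightarrow> (\<lambda>p. f p * g p) \<in> smooth_funs M"
  by (auto simp: smooth_funs_def intro: smooth_fun_on_const smooth_fun_on_add smooth_fun_on_mult)

lemma smooth_funs_sum:
  "(\<And>i. i \<in> I \<Longrightarrow> f i \<in> smooth_funs M) \<Longrightarrow> (\<lambda>p. \<Sum>i\<in>I. f i p) \<in> smooth_funs M"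
  by (auto simp: smooth_funs_def intro: smooth_fun_on_sum)

lemma smooth_funs_sum_list:
  "(\<And>x. x \<in> set xs \<Longrightarrow> f x \<in> smooth_funs M) \<Longrightarrow> (\<lambda>p. \<Sum>x\<leftarrow>xs. f x p) \<in> smooth_funs M"
  by (induction xs) (auto intro: smooth_funs_add smooth_funs_const)

lemma smooth_funs_cong:
  "charted M \<Longrightarrow> f \<in> smooth_funs M \<Longrightarrow> (\<And>p. p \<in> points M \<Longrightarrow> f p = g p) \<Longrightarrow> g \<in> smooth_funs M"
  by (auto simp: smooth_funs_def intro: smooth_fun_on_cong)

lemma smooth_funs_pullback:
  assumes "charted N" "charted M" "smooth_map N M f" "g \<in> smooth_funs M"
  shows "(\<lambda>p. g (f p)) \<in> smooth_funs N"
proof -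
  have "smooth_fun_on N (f -` points M) (\<lambda>p. g (f p))"
    using smooth_fun_on_pullback[OF assms(1-3)] assms(4) by (simp add: smooth_funs_def)
  then show ?thesis
    using smooth_mapD(1)[OF assms(3)] by (auto simp: smooth_funs_def intro: smooth_fun_on_subset)
qed


section \<open>Tangent vectors\<close>

lemma tangent_vectorD:
  assumes "tangent_vector M p v"
  shows "p \<in> points M"
    and "f \<in> smooth_funs M \<Longrightarrow> g \<in> smooth_funs M \<Longrightarrow> v (\<lambda>x. f x + g x) = v f + v g"
    and "f \<in> smooth_funs M \<Longrightarrow> g \<in> smooth_funs M \<Longrightarrow> v (\<lambda>x. f x * g x) = f p * v g + g p * v f"
    and "f \<in> smooth_funs M \<Longrightarrow> v (\<lambda>x. r * f x) = r * v f"
  using assms unfolding tangent_vector_def by blast+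

lemma tangent_vector_const:
  assumes "tangent_vector M p v"
  shows "v (\<lambda>x. c) = 0"
proof -
  have "v (\<lambda>x. 1 * 1) = 1 * v (\<lambda>x. 1) + 1 * v (\<lambda>x. 1)"
    by (rule tangent_vectorD(3)[OF assms smooth_funs_const smooth_funs_const])
  then have "v (\<lambda>x. 1) = 0" by simp
  then show ?thesis
    using tangent_vectorD(4)[OF assms smooth_funs_const[of 1], of c] by simp
qed

lemma tangent_vector_sum_list:
  assumes "tangent_vector M p v" "\<And>x. x \<in> set xs \<Longrightarrow> f x \<in> smooth_funs M"
  shows "v (\<lambda>q. \<Sum>x\<leftarrow>xs. f x q) = (\<Sum>x\<leftarrow>xs. v (f x))"
  using assms(2)
proof (induction xs)
  case Nil
  then show ?case by (simp add: tangent_vector_const[OF assms(1)])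
next
  case (Cons x xs)
  then show ?case
    by (simp add: tangent_vectorD(2)[OF assms(1)] smooth_funs_sum_list)
qed

text \<open>A derivation acts on functions of the whole type, so values off \<open>points M\<close>
  might matter. The function u, 0 on M and 1 elsewhere, is smooth, and multiplication by it fixes
  the difference \<open>?z\<close>. As u and \<open>?z\<close> both vanish at p, the Leibniz rule
  for \<open>u * ?z = ?z\<close> shows that v kills \<open>?z\<close>.\<close>

lemma tangent_vector_cong:
  assumes M: "charted M" and v: "tangent_vector M p v" and f: "f \<in> smooth_funs M"
    and eq: "\<And>q. q \<in> points M \<Longrightarrow> f q = g q"
  shows "v f = v g"
proof -
  define u where "u q = (if q \<in> points M then 0 else 1 :: real)" for q
  have u: "u \<in> smooth_funs M"
    by (rule smooth_funs_cong[OF M smooth_funs_const[of 0]]) (simp add: u_def)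
  have g: "g \<in> smooth_funs M" by (rule smooth_funs_cong[OF M f eq])
  let ?z = "\<lambda>q. g q + (-1) * f q"
  have z: "?z \<in> smooth_funs M" by (intro smooth_funs_add smooth_funs_mult smooth_funs_const f g)
  have p: "p \<in> points M" using tangent_vectorD(1)[OF v] .
  have "v (\<lambda>q. u q * ?z q) = u p * v ?z + ?z p * v u"
    by (rule tangent_vectorD(3)[OF v u z])
  moreover have "(\<lambda>q. u q * ?z q) = ?z" using eq by (auto simp: u_def fun_eq_iff)
  ultimately have "v ?z = 0" using p eq by (simp add: u_def)
  moreover have "v ?z = v g + (-1) * v f"
    by (simp only: tangent_vectorD(2)[OF v g smooth_funs_mult[OF smooth_funs_const f]]
        tangent_vectorD(4)[OF v f])
  ultimately show ?thesis by simp
qed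

lemma tangent_vector_diff:
  assumes "tangent_vector M p v" "tangent_vector M p w"
  shows "tangent_vector M p (\<lambda>f. v f - w f)"
  using assms unfolding tangent_vector_def by (simp add: algebra_simps)

text \<open>
  The coordinates only enter after multiplication by a cut-off function \<open>\<eta>\<close>, because tangent vectors
  act on globally defined functions.
\<close>

lemma tangent_vector_eq_0I:
  fixes N :: "('n, 'e::euclidean_space) manifold"
  assumes N: "smooth_manifold N" and u: "tangent_vector N p u"
    and U: "(U, \<phi>) \<in> atlas N" "p \<in> U"
    and \<eta>: "\<eta> \<in> smooth_funs N" "\<eta> p = 1" "u \<eta> = 0"
    and y: "\<And>i. i \<in> Basis \<Longrightarrow> y i \<in> smooth_funs N" "\<And>i. i \<in> Basis \<Longrightarrow> u (y i) = 0"
      "\<And>i q. i \<in> Basis \<Longrightarrow> q \<in> U \<Longrightarrow> y i q = \<eta> q * (\<phi> q \<bullet> i)"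
    and g: "g \<in> smooth_funs N"
  shows "u g = 0"
proof -
  note at = smooth_manifold_atlas[OF N] and ch = smooth_manifold_charted[OF N]
  note inj = chartedD[OF ch U(1)]
  have "smooth_on (\<phi> ` (U \<inter> points N)) (g \<circ> inv_into U \<phi>)"
    using g U smooth_fun_onD by (simp add: smooth_funs_def)
  then obtain T G where T: "open T" "\<phi> p \<in> T" "\<And>k. ck_on k T G"
    "\<And>x. x \<in> \<phi> ` (U \<inter> points N) \<Longrightarrow> x \<in> T \<Longrightarrow> (g \<circ> inv_into U \<phi>) x = G x"
    by (rule smooth_onE) (use U inj in blast, blast)
  have gG: "g q = G (\<phi> q)" if "q \<in> U" "\<phi> q \<in> T" for q
    using T(4)[of "\<phi> q"] that inj by auto
  obtain r where r: "r > 0" "ball (\<phi> p) r \<subseteq> T" using T open_contains_ball by blast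
  let ?B = "ball (\<phi> p) r"
  obtain h where h: "\<And>i k. ck_on k ?B (h i)"
    "\<And>x. x \<in> ?B \<Longrightarrow> G x = G (\<phi> p) + (\<Sum>i\<in>Basis. ((x - \<phi> p) \<bullet> i) * h i x)"
    using hadamard[OF ck_on_subset[OF T(3) r(2)]] by metis
  let ?O = "{q \<in> U. \<phi> q \<in> ?B}"
  have O: "mfd_open N ?O" by (rule mfd_open_chart[OF at U(1) open_ball])
  obtain \<kappa> K where \<kappa>: "\<kappa> \<in> smooth_funs N" "\<kappa> p = 1" "K \<subseteq> ?O" "mfd_open N (points N - K)"
    "\<And>q. q \<notin> K \<Longrightarrow> \<kappa> q = 0"
    by (rule manifold_bump[OF N O, of p]) (use U r in auto)
  have cut: "(\<lambda>q. \<kappa> q * f (\<phi> q)) \<in> smooth_funs N" if "smooth_on ?B f" for f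
  proof -
    have "smooth_fun_on N (points N \<inter> ?O) (\<lambda>q. \<kappa> q * f (\<phi> q))"
    proof (rule smooth_fun_on_mult)
      show "smooth_fun_on N (points N \<inter> ?O) \<kappa>"
        using \<kappa>(1) by (auto simp: smooth_funs_def intro: smooth_fun_on_subset)
      show "smooth_fun_on N (points N \<inter> ?O) (\<lambda>q. f (\<phi> q))"
        by (rule smooth_fun_on_subset[OF smooth_fun_on_chart[OF at U(1) that]]) blast
    qed
    then show ?thesis
      unfolding smooth_funs_def mem_Collect_eq
      by (rule smooth_fun_on_extend_zero[OF ch O \<kappa>(4,3)]) (simp add: \<kappa>(5))
  qed
  define E where "E i q = \<kappa> q * ((\<phi> q - \<phi> p) \<bullet> i)" for i q
  define H where "H i q = \<kappa> q * h i (\<phi> q)" for i q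
  have "smooth_on ?B (\<lambda>x. (x - \<phi> p) \<bullet> i)" for i
    using smooth_on_inner_left[OF smooth_on_add[OF smooth_on_linear[OF bounded_linear_ident] smooth_on_const[of _ "- \<phi> p"]]]
    by simp
  from cut[OF this] have E: "E i \<in> smooth_funs N" for i unfolding E_def .
  have H: "H i \<in> smooth_funs N" for i
    unfolding H_def by (rule cut[OF smooth_on_open[OF open_ball h(1)]])
  have E0: "E i p = 0" for i by (simp add: E_def)
  have uE: "u (E i) = 0" if i: "i \<in> Basis" for i
  proof -
    let ?w = "\<lambda>q. y i q + (- (\<phi> p \<bullet> i)) * \<eta> q"
    have w: "?w \<in> smooth_funs N" by (intro smooth_funs_add smooth_funs_mult smooth_funs_const y(1)[OF i] \<eta>)
    have "u ?w = u (y i) + (- (\<phi> p \<bullet> i)) * u \<eta>"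
      by (simp only: tangent_vectorD(2)[OF u y(1)[OF i] smooth_funs_mult[OF smooth_funs_const \<eta>(1)]]
          tangent_vectorD(4)[OF u \<eta>(1)])
    then have uw: "u ?w = 0" using y(2)[OF i] \<eta>(3) by simp
    \<comment> \<open>Both sides are \<eta> times \<kappa> times the centred coordinate. The
      cut-offs are 1 at p, where \<open>E i\<close> and \<open>?w\<close> vanish, so the Leibniz
      rule transfers \<open>u ?w = 0\<close> to \<open>E i\<close>.\<close>
    have "\<eta> q * E i q = \<kappa> q * ?w q" for q
    proof (cases "q \<in> U")
      case True
      then show ?thesis by (simp add: E_def y(3)[OF i] algebra_simps)
    next
      case False
      then have "\<kappa> q = 0" using \<kappa>(3,5) by blast
      then show ?thesis by (simp add: E_def)
    qed
    then have "u (\<lambda>q. \<eta> q * E i q) = u (\<lambda>q. \<kappa> q * ?w q)" by simp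
    then have "u (E i) = u ?w + ?w p * u \<kappa>"
      using tangent_vectorD(3)[OF u \<eta>(1) E] tangent_vectorD(3)[OF u \<kappa>(1) w] \<eta>(2) \<kappa>(2) E0 by simp
    then show ?thesis using uw y(3)[OF i U(2)] \<eta>(2) by simp
  qed
  have \<kappa>\<kappa>: "(\<lambda>q. \<kappa> q * \<kappa> q) \<in> smooth_funs N" by (intro smooth_funs_mult \<kappa>)
  have EH: "(\<lambda>q. E i q * H i q) \<in> smooth_funs N" for i by (intro smooth_funs_mult E H)
  have "u (\<lambda>q. E i q * H i q) = 0" if "i \<in> Basis" for i
    using tangent_vectorD(3)[OF u E H] E0 uE[OF that] by simp
  moreover have "u (\<lambda>q. \<Sum>i\<in>I. E i q * H i q) = (\<Sum>i\<in>I. u (\<lambda>q. E i q * H i q))" if "finite I" for I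
    using that
    by (induction I) (simp_all add: tangent_vector_const[OF u] tangent_vectorD(2)[OF u] EH smooth_funs_sum)
  ultimately have uS: "u (\<lambda>q. \<Sum>i\<in>Basis. E i q * H i q) = 0" by simp
  \<comment> \<open>Hadamard's formula times the square of \<kappa>: one factor makes the coordinate
    global, the other its coefficient. The Leibniz rule on the left yields u g and a term that
    cancels the contribution of the constant g p on the right.\<close>
  have "(\<kappa> q * \<kappa> q) * g q = g p * (\<kappa> q * \<kappa> q) + (\<Sum>i\<in>Basis. E i q * H i q)" for q
  proof (cases "q \<in> ?O")
    case True
    then have "g q = g p + (\<Sum>i\<in>Basis. ((\<phi> q - \<phi> p) \<bullet> i) * h i (\<phi> q))"
      using gG[of q] gG[of p] h(2)[of "\<phi> q"] r U T by auto
    then show ?thesis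
      by (simp add: E_def H_def algebra_simps sum_distrib_left)
  next
    case False
    then have "\<kappa> q = 0" using \<kappa>(3,5) by blast
    then show ?thesis by (simp add: E_def H_def)
  qed
  then have "u (\<lambda>q. (\<kappa> q * \<kappa> q) * g q) = u (\<lambda>q. g p * (\<kappa> q * \<kappa> q) + (\<Sum>i\<in>Basis. E i q * H i q))"
    by simp
  also have "\<dots> = g p * u (\<lambda>q. \<kappa> q * \<kappa> q) + 0"
    by (simp only: tangent_vectorD(2)[OF u smooth_funs_mult[OF smooth_funs_const \<kappa>\<kappa>] smooth_funs_sum[OF EH]]
        tangent_vectorD(4)[OF u \<kappa>\<kappa>] uS)
  finally show "u g = 0"
    using tangent_vectorD(3)[OF u \<kappa>\<kappa> g] \<kappa>(2) by simp
qed

section \<open>Vector bundles\<close>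

lemma lin_onD:
  assumes "lin_on S f"
  shows "x \<in> S \<Longrightarrow> y \<in> S \<Longrightarrow> f (x + y) = f x + f y" "x \<in> S \<Longrightarrow> f (r *\<^sub>R x) = r *\<^sub>R f x"
  using assms by (auto simp: lin_on_def)

lemma lin_on_0: "lin_on S f \<Longrightarrow> subspace S \<Longrightarrow> f 0 = 0"
  using lin_onD(2)[of S f 0 0] subspace_0 by auto

lemma lin_on_minus: "lin_on S f \<Longrightarrow> x \<in> S \<Longrightarrow> f (- x) = - f x"
  using lin_onD(2)[of S f x "-1"] by simp

lemma lin_on_diff: "lin_on S f \<Longrightarrow> subspace S \<Longrightarrow> x \<in> S \<Longrightarrow> y \<in> S \<Longrightarrow> f (x - y) = f x - f y"
  using lin_onD(1)[of S f x "- y"] lin_on_minus[of S f y] subspace_neg[of S y] by auto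

lemma lin_on_sum:
  "lin_on S f \<Longrightarrow> subspace S \<Longrightarrow> (\<And>i. i \<in> I \<Longrightarrow> x i \<in> S) \<Longrightarrow> f (\<Sum>i\<in>I. x i) = (\<Sum>i\<in>I. f (x i))"
  by (induction I rule: infinite_finite_induct) (auto simp: lin_on_0 lin_onD subspace_sum)

lemma lin_on_sum_list:
  "lin_on S f \<Longrightarrow> subspace S \<Longrightarrow> (\<And>i. i \<in> set xs \<Longrightarrow> x i \<in> S) \<Longrightarrow> f (\<Sum>i\<leftarrow>xs. x i) = (\<Sum>i\<leftarrow>xs. f (x i))"
  "subspace S \<Longrightarrow> (\<And>i. i \<in> set xs \<Longrightarrow> x i \<in> S) \<Longrightarrow> (\<Sum>i\<leftarrow>xs. x i) \<in> S"
proof -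
  show *: "subspace S \<Longrightarrow> (\<And>i. i \<in> set xs \<Longrightarrow> x i \<in> S) \<Longrightarrow> (\<Sum>i\<leftarrow>xs. x i) \<in> S" for xs
    by (induction xs) (auto simp: subspace_0 subspace_add)
  show "lin_on S f \<Longrightarrow> subspace S \<Longrightarrow> (\<And>i. i \<in> set xs \<Longrightarrow> x i \<in> S) \<Longrightarrow> f (\<Sum>i\<leftarrow>xs. x i) = (\<Sum>i\<leftarrow>xs. f (x i))"
    using * by (induction xs) (auto simp: lin_on_0 lin_onD)
qed

lemma lin_on_inv_into:
  assumes "lin_on S f" "bij_betw f S F" "subspace S"
  shows "lin_on F (inv_into S f)"
  unfolding lin_on_def
proof safe
  have *: "inv_into S f x \<in> S" "f (inv_into S f x) = x" if "x \<in> F" for x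
    using that assms(2) by (auto simp: bij_betw_def inv_into_into f_inv_into_f)
  have inj: "inj_on f S" using assms(2) by (simp add: bij_betw_def)
  fix x y r assume x: "x \<in> F"
  note *(1)[OF x, simp] *(2)[OF x, simp]
  have "inv_into S f (f (r *\<^sub>R inv_into S f x)) = r *\<^sub>R inv_into S f x"
    by (rule inv_into_f_f[OF inj subspace_scale[OF assms(3)]]) simp
  then show "inv_into S f (r *\<^sub>R x) = r *\<^sub>R inv_into S f x"
    by (simp add: lin_onD[OF assms(1)])
  assume y: "y \<in> F"
  note *(1)[OF y, simp] *(2)[OF y, simp]
  have "inv_into S f (f (inv_into S f x + inv_into S f y)) = inv_into S f x + inv_into S f y"
    by (rule inv_into_f_f[OF inj subspace_add[OF assms(3)]]) simp_all
  then show "inv_into S f (x + y) = inv_into S f x + inv_into S f y"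
    by (simp add: lin_onD[OF assms(1)])
qed

section \<open>Trivializations and fibre coordinates\<close>

lemma vector_bundleD:
  assumes "vector_bundle E"
  shows "smooth_manifold (base E)" "subspace (fmodel E)"
    "m \<in> points (base E) \<Longrightarrow> subspace (fibre E m)"
    "(V, \<tau>) \<in> trivs E \<Longrightarrow> mfd_open (base E) V"
    "(V, \<tau>) \<in> trivs E \<Longrightarrow> V \<subseteq> points (base E)"
    "(V, \<tau>) \<in> trivs E \<Longrightarrow> m \<in> V \<Longrightarrow> lin_on (fibre E m) (\<tau> m)"
    "(V, \<tau>) \<in> trivs E \<Longrightarrow> m \<in> V \<Longrightarrow> bij_betw (\<tau> m) (fibre E m) (fmodel E)"
    "(V, \<tau>) \<in> trivs E \<Longrightarrow> (V', \<sigma>) \<in> trivs E \<Longrightarrow> x \<in> fmodel E \<Longrightarrow>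
        smooth_fun_on (base E) (V \<inter> V') (\<lambda>m. \<sigma> m (inv_into (fibre E m) (\<tau> m) x))"
proof -
  note * = assms[unfolded vector_bundle_def]
  show M: "smooth_manifold (base E)" and "subspace (fmodel E)"
    "m \<in> points (base E) \<Longrightarrow> subspace (fibre E m)"
    using * by blast+
  show V: "mfd_open (base E) V" if "(V, \<tau>) \<in> trivs E" for V \<tau>
    using * that openin_mfd_topology[OF smooth_manifold_atlas[OF M]] by fast
  then show "(V, \<tau>) \<in> trivs E \<Longrightarrow> V \<subseteq> points (base E)" by (simp add: mfd_open_def)
  show "(V, \<tau>) \<in> trivs E \<Longrightarrow> m \<in> V \<Longrightarrow> lin_on (fibre E m) (\<tau> m)"
    "(V, \<tau>) \<in> trivs E \<Longrightarrow> m \<in> V \<Longrightarrow> bij_betw (\<tau> m) (fibre E m) (fmodel E)"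
    using * by fast+
  show "(V, \<tau>) \<in> trivs E \<Longrightarrow> (V', \<sigma>) \<in> trivs E \<Longrightarrow> x \<in> fmodel E \<Longrightarrow>
        smooth_fun_on (base E) (V \<inter> V') (\<lambda>m. \<sigma> m (inv_into (fibre E m) (\<tau> m) x))"
    using * by fast
qed

lemma trivs_cover:
  assumes "vector_bundle E" "m \<in> points (base E)"
  obtains V \<tau> where "(V, \<tau>) \<in> trivs E" "m \<in> V"
proof -
  have "m \<in> (\<Union>(V, \<tau>)\<in>trivs E. V)" using assms by (simp add: vector_bundle_def)
  then show ?thesis using that by auto
qed

lemma triv_inv:
  assumes "vector_bundle E" "(V, \<tau>) \<in> trivs E" "m \<in> V"
  shows "e \<in> fibre E m \<Longrightarrow> \<tau> m e \<in> fmodel E"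
    "e \<in> fibre E m \<Longrightarrow> inv_into (fibre E m) (\<tau> m) (\<tau> m e) = e"
    "y \<in> fmodel E \<Longrightarrow> inv_into (fibre E m) (\<tau> m) y \<in> fibre E m"
    "y \<in> fmodel E \<Longrightarrow> \<tau> m (inv_into (fibre E m) (\<tau> m) y) = y"
    "lin_on (fmodel E) (inv_into (fibre E m) (\<tau> m))"
proof -
  note b = vector_bundleD(7)[OF assms]
  show "e \<in> fibre E m \<Longrightarrow> \<tau> m e \<in> fmodel E"
    "e \<in> fibre E m \<Longrightarrow> inv_into (fibre E m) (\<tau> m) (\<tau> m e) = e"
    "y \<in> fmodel E \<Longrightarrow> inv_into (fibre E m) (\<tau> m) y \<in> fibre E m"
    "y \<in> fmodel E \<Longrightarrow> \<tau> m (inv_into (fibre E m) (\<tau> m) y) = y"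
    using b by (auto simp: bij_betw_def inv_into_into f_inv_into_f)
  have "m \<in> points (base E)" using vector_bundleD(5)[OF assms(1,2)] assms(3) by blast
  then show "lin_on (fmodel E) (inv_into (fibre E m) (\<tau> m))"
    using lin_on_inv_into[OF vector_bundleD(6)[OF assms] b] vector_bundleD(3)[OF assms(1)] by blast
qed

text \<open>The fibre model is a subspace without a distinguished basis. Orthonormality makes the
  coordinates inner products, which are bounded linear on the whole ambient space and so preserve
  smoothness.\<close>

lemma orthonormal_basis_expansion:
  fixes F :: "'a::euclidean_space set"
  assumes "subspace F"
  obtains Bs where "finite Bs" "Bs \<subseteq> F" "\<And>x. x \<in> F \<Longrightarrow> x = (\<Sum>i\<in>Bs. (x \<bullet> i) *\<^sub>R i)"
proof -
  obtain Bs where Bs: "Bs \<subseteq> F" "pairwise orthogonal Bs" "\<And>x. x \<in> Bs \<Longrightarrow> norm x = 1"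
    "independent Bs" "span Bs = F"
    using orthonormal_basis_subspace[OF assms] by metis
  have fin: "finite Bs" using independent_imp_finite[OF Bs(4)] .
  have "x = (\<Sum>i\<in>Bs. (x \<bullet> i) *\<^sub>R i)" if "x \<in> F" for x
  proof -
    have "x \<in> range (\<lambda>u. \<Sum>i\<in>Bs. u i *\<^sub>R i)"
      using that Bs(5) span_finite[OF fin] by simp
    then obtain u where u: "x = (\<Sum>i\<in>Bs. u i *\<^sub>R i)" by (rule rangeE)
    have "x \<bullet> j = u j" if j: "j \<in> Bs" for j
    proof -
      have "x \<bullet> j = (\<Sum>i\<in>Bs. u i * (i \<bullet> j))" by (simp add: u inner_sum_left)
      also have "\<dots> = (\<Sum>i\<in>Bs. if i = j then u j else 0)"
      proof (intro sum.cong refl)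
        fix i assume "i \<in> Bs"
        then have "i \<bullet> j = (if i = j then 1 else 0)"
          using Bs(2) Bs(3)[OF j] j by (auto simp: pairwise_def orthogonal_def norm_eq_1)
        then show "u i * (i \<bullet> j) = (if i = j then u j else 0)" by simp
      qed
      finally show ?thesis using fin j by simp
    qed
    then have "(\<Sum>i\<in>Bs. u i *\<^sub>R i) = (\<Sum>i\<in>Bs. (x \<bullet> i) *\<^sub>R i)"
      by (intro sum.cong) simp_all
    with u show ?thesis by (rule trans)
  qed
  then show ?thesis using that fin Bs(1) by blast
qed

section \<open>Total spaces\<close>

lemma lin_fun_comp: "\<ell> \<psi> p = \<psi> (fst p) (snd p)"
  by (simp add: lin_fun_def split_beta)

lemma points_total: "points (total E) = Sigma (points (base E)) (fibre E)"
  by (simp add: total_def)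

lemma atlas_totalI:
  "(U, \<phi>) \<in> atlas (base E) \<Longrightarrow> (V, \<tau>) \<in> trivs E \<Longrightarrow>
    (Sigma (U \<inter> V) (fibre E), \<lambda>(m, v). (\<phi> m, \<tau> m v)) \<in> atlas (total E)"
  by (auto simp: total_def)

lemma atlas_totalE:
  assumes "(X, \<theta>) \<in> atlas (total E)"
  obtains U \<phi> V \<tau> where "(U, \<phi>) \<in> atlas (base E)" "(V, \<tau>) \<in> trivs E"
    "X = Sigma (U \<inter> V) (fibre E)" "\<theta> = (\<lambda>(m, v). (\<phi> m, \<tau> m v))"
  using assms by (auto simp: total_def)

context
  fixes E :: "('m, 'e::euclidean_space, 'v::real_vector, 'f::euclidean_space) vbundle"
  assumes E: "vector_bundle E"
begin

lemma base_charted: "charted (base E)" and base_atlas: "smooth_atlas (base E)"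
  using vector_bundleD(1)[OF E] by (auto intro: smooth_manifold_charted smooth_manifold_atlas)

lemma total_chart_inj:
  assumes "(U, \<phi>) \<in> atlas (base E)" "(V, \<tau>) \<in> trivs E"
  shows "inj_on (\<lambda>(m, v). (\<phi> m, \<tau> m v)) (Sigma (U \<inter> V) (fibre E))"
proof (rule inj_onI, clarsimp)
  fix m v m' v' assume *: "m \<in> U" "m \<in> V" "v \<in> fibre E m" "m' \<in> U" "m' \<in> V" "v' \<in> fibre E m'"
    "\<phi> m = \<phi> m'" "\<tau> m v = \<tau> m' v'"
  have "m = m'" using chartedD(1)[OF base_charted assms(1)] * by (auto simp: inj_on_def)
  then show "m = m' \<and> v = v'"
    using * triv_inv(2)[OF E assms(2)] by metis
qed

lemma total_chart_image:
  assumes "(V, \<tau>) \<in> trivs E" "W \<subseteq> V"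
  shows "(\<lambda>(m, v). (\<phi> m, \<tau> m v)) ` Sigma W (fibre E) = \<phi> ` W \<times> fmodel E"
proof
  show "(\<lambda>(m, v). (\<phi> m, \<tau> m v)) ` Sigma W (fibre E) \<subseteq> \<phi> ` W \<times> fmodel E"
    using triv_inv(1)[OF E assms(1)] assms(2) by auto
  show "\<phi> ` W \<times> fmodel E \<subseteq> (\<lambda>(m, v). (\<phi> m, \<tau> m v)) ` Sigma W (fibre E)"
  proof clarify
    fix m y assume "m \<in> W" "y \<in> fmodel E"
    then show "(\<phi> m, y) \<in> (\<lambda>(m, v). (\<phi> m, \<tau> m v)) ` Sigma W (fibre E)"
      using triv_inv(3,4)[OF E assms(1), of m y] assms(2)
      by (intro image_eqI[of _ _ "(m, inv_into (fibre E m) (\<tau> m) y)"]) auto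
  qed
qed

lemma total_chart_inv:
  assumes "(U, \<phi>) \<in> atlas (base E)" "(V, \<tau>) \<in> trivs E" "m \<in> U" "m \<in> V" "y \<in> fmodel E"
  shows "inv_into (Sigma (U \<inter> V) (fibre E)) (\<lambda>(m, v). (\<phi> m, \<tau> m v)) (\<phi> m, y) =
    (m, inv_into (fibre E m) (\<tau> m) y)"
  using triv_inv(3,4)[OF E assms(2,4,5)] assms(3,4)
  by (intro inv_into_f_eq[OF total_chart_inj[OF assms(1,2)]]) auto

lemma total_charted: "charted (total E)"
  unfolding charted_def
proof (intro conjI)
  show "(\<Union>(U, \<phi>)\<in>atlas (total E). U) = points (total E)"
  proof
    show "(\<Union>(U, \<phi>)\<in>atlas (total E). U) \<subseteq> points (total E)"
      using vector_bundleD(5)[OF E] by (fastforce elim!: atlas_totalE simp: points_total)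
    show "points (total E) \<subseteq> (\<Union>(U, \<phi>)\<in>atlas (total E). U)"
    proof
      fix p assume "p \<in> points (total E)"
      then obtain m e where p: "p = (m, e)" "m \<in> points (base E)" "e \<in> fibre E m"
        by (auto simp: points_total)
      obtain U \<phi> where U: "(U, \<phi>) \<in> atlas (base E)" "m \<in> U" using charted_cover[OF base_charted p(2)] .
      obtain V \<tau> where V: "(V, \<tau>) \<in> trivs E" "m \<in> V" using trivs_cover[OF E p(2)] .
      show "p \<in> (\<Union>(U, \<phi>)\<in>atlas (total E). U)"
        using atlas_totalI[OF U(1) V(1)] U(2) V(2) p by (intro UN_I) auto
    qed
  qed
  show "\<forall>(X, \<theta>)\<in>atlas (total E). inj_on \<theta> X \<and> openin (top_of_set (model (total E))) (\<theta> ` X)"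
  proof clarify
    fix X \<theta> assume X: "(X, \<theta>) \<in> atlas (total E)"
    obtain U \<phi> V \<tau> where *: "(U, \<phi>) \<in> atlas (base E)" "(V, \<tau>) \<in> trivs E"
      "X = Sigma (U \<inter> V) (fibre E)" "\<theta> = (\<lambda>(m, v). (\<phi> m, \<tau> m v))"
      by (rule atlas_totalE[OF X])
    have "openin (top_of_set (model (base E))) (\<phi> ` (V \<inter> U))"
      using vector_bundleD(4)[OF E *(2)] *(1) by (auto simp: mfd_open_def)
    then have "openin (top_of_set (model (base E) \<times> fmodel E)) (\<phi> ` (U \<inter> V) \<times> fmodel E)"
      by (simp add: openin_Times Int_commute)
    then show "inj_on \<theta> X \<and> openin (top_of_set (model (total E))) (\<theta> ` X)"
      using total_chart_inj[OF *(1,2)] total_chart_image[OF *(2), of "U \<inter> V" \<phi>] *(3,4)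
      by (simp add: total_def)
  qed
qed

lemma smooth_map_fst: "smooth_map (total E) (base E) fst"
  unfolding smooth_map_def
proof (intro conjI)
  show "fst ` points (total E) \<subseteq> points (base E)" by (auto simp: points_total)
  show "\<forall>(X, \<theta>)\<in>atlas (total E). \<forall>(U', \<phi>')\<in>atlas (base E).
      openin (top_of_set (model (total E))) (\<theta> ` (X \<inter> fst -` U')) \<and>
      smooth_on (\<theta> ` (X \<inter> fst -` U')) (\<phi>' \<circ> fst \<circ> inv_into X \<theta>)"
  proof clarify
    fix X \<theta> U' \<phi>' assume X: "(X, \<theta>) \<in> atlas (total E)" and U': "(U', \<phi>') \<in> atlas (base E)"
    obtain U \<phi> V \<tau> where *: "(U, \<phi>) \<in> atlas (base E)" "(V, \<tau>) \<in> trivs E"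
      "X = Sigma (U \<inter> V) (fibre E)" "\<theta> = (\<lambda>(m, v). (\<phi> m, \<tau> m v))"
      by (rule atlas_totalE[OF X])
    have "X \<inter> fst -` U' = Sigma (U \<inter> U' \<inter> V) (fibre E)" using * by auto
    then have im: "\<theta> ` (X \<inter> fst -` U') = \<phi> ` (U \<inter> U' \<inter> V) \<times> fmodel E"
      using total_chart_image[OF *(2), of "U \<inter> U' \<inter> V" \<phi>] * by auto
    have "mfd_open (base E) (U' \<inter> V)"
      using mfd_open_chart[OF base_atlas U' open_UNIV] vector_bundleD(4)[OF E *(2)]
      by (intro mfd_open_Int[OF base_atlas]) auto
    then have "openin (top_of_set (model (base E))) (\<phi> ` (U \<inter> U' \<inter> V))"
      using *(1) by (auto simp: mfd_open_def Int_ac)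
    then have "openin (top_of_set (model (total E))) (\<theta> ` (X \<inter> fst -` U'))"
      unfolding im by (simp add: openin_Times total_def)
    moreover have "smooth_on (\<phi> ` (U \<inter> U')) (\<phi>' \<circ> inv_into U \<phi>)"
      using base_atlas *(1) U' unfolding smooth_atlas_def by blast
    then have "smooth_on (\<theta> ` (X \<inter> fst -` U')) (\<lambda>x. (\<phi>' \<circ> inv_into U \<phi>) (fst x))"
      by (rule smooth_on_compose[OF smooth_on_fst]) (auto simp: im)
    then have "smooth_on (\<theta> ` (X \<inter> fst -` U')) (\<phi>' \<circ> fst \<circ> inv_into X \<theta>)"
    proof (rule smooth_on_cong[rotated])
      fix x assume "x \<in> \<theta> ` (X \<inter> fst -` U')"
      then obtain m y where "x = (\<phi> m, y)" "m \<in> U" "m \<in> U'" "m \<in> V" "y \<in> fmodel E"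
        unfolding im by auto
      then show "(\<phi>' \<circ> inv_into U \<phi>) (fst x) = (\<phi>' \<circ> fst \<circ> inv_into X \<theta>) x"
        using total_chart_inv[OF *(1,2), of m y] chartedD(1)[OF base_charted *(1)] *(3,4) by simp
    qed
    ultimately show "openin (top_of_set (model (total E))) (\<theta> ` (X \<inter> fst -` U')) \<and>
      smooth_on (\<theta> ` (X \<inter> fst -` U')) (\<phi>' \<circ> fst \<circ> inv_into X \<theta>)" ..
  qed
qed

text \<open>Transition functions are assumed smooth at each fixed model vector. Expanding the
  variable vector in a finite basis of the fibre model gives smoothness in base and fibre variables
  jointly.\<close>

lemma smooth_fun_on_triv:
  assumes V: "(V, \<tau>) \<in> trivs E"
  shows "smooth_fun_on (total E) (fst -` V) (\<lambda>p. \<tau> (fst p) (snd p))"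
proof (rule smooth_fun_onI)
  fix X \<theta> assume X: "(X, \<theta>) \<in> atlas (total E)"
  obtain U \<phi> V' \<sigma> where *: "(U, \<phi>) \<in> atlas (base E)" "(V', \<sigma>) \<in> trivs E"
    "X = Sigma (U \<inter> V') (fibre E)" "\<theta> = (\<lambda>(m, v). (\<phi> m, \<sigma> m v))"
    by (rule atlas_totalE[OF X])
  obtain Bs where Bs: "finite Bs" "Bs \<subseteq> fmodel E" "\<And>x. x \<in> fmodel E \<Longrightarrow> x = (\<Sum>i\<in>Bs. (x \<bullet> i) *\<^sub>R i)"
    using orthonormal_basis_expansion[OF vector_bundleD(2)[OF E]] by blast
  let ?S = "\<phi> ` (U \<inter> (V' \<inter> V)) \<times> fmodel E"
  have "X \<inter> fst -` V = Sigma (U \<inter> (V' \<inter> V)) (fibre E)" using *(3) by auto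
  moreover have "U \<inter> (V' \<inter> V) \<subseteq> V'" by blast
  ultimately have im: "\<theta> ` (X \<inter> fst -` V) = ?S"
    using total_chart_image[OF *(2), of "U \<inter> (V' \<inter> V)" \<phi>] *(4) by simp
  let ?f = "\<lambda>i m. \<tau> m (inv_into (fibre E m) (\<sigma> m) i)"
  have "smooth_on ?S (\<lambda>x. \<Sum>i\<in>Bs. (snd x \<bullet> i) *\<^sub>R (?f i \<circ> inv_into U \<phi>) (fst x))"
  proof (intro smooth_on_sum smooth_on_scaleR smooth_on_inner_left smooth_on_snd)
    fix i assume "i \<in> Bs"
    then have "smooth_fun_on (base E) (V' \<inter> V) (?f i)"
      using vector_bundleD(8)[OF E *(2) V] Bs(2) by blast
    then have "smooth_on (\<phi> ` (U \<inter> (V' \<inter> V))) (?f i \<circ> inv_into U \<phi>)"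
      using *(1) by (rule smooth_fun_onD)
    then show "smooth_on ?S (\<lambda>x. (?f i \<circ> inv_into U \<phi>) (fst x))"
      by (rule smooth_on_compose[OF smooth_on_fst]) auto
  qed
  then show "smooth_on (\<theta> ` (X \<inter> fst -` V)) ((\<lambda>p. \<tau> (fst p) (snd p)) \<circ> inv_into X \<theta>)"
    unfolding im
  proof (rule smooth_on_cong[rotated])
    fix x assume "x \<in> ?S"
    then obtain m y where x: "x = (\<phi> m, y)" "m \<in> U" "m \<in> V" "m \<in> V'" "y \<in> fmodel E" by auto
    note inv = triv_inv[OF E *(2) x(4)]
    have sub: "subspace (fibre E m)" using vector_bundleD(3,5)[OF E] V x(3) by blast
    have "inv_into (fibre E m) (\<sigma> m) y = inv_into (fibre E m) (\<sigma> m) (\<Sum>i\<in>Bs. (y \<bullet> i) *\<^sub>R i)"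
      using Bs(3)[OF x(5)] by simp
    also have "\<dots> = (\<Sum>i\<in>Bs. (y \<bullet> i) *\<^sub>R inv_into (fibre E m) (\<sigma> m) i)"
      using Bs(2) by (subst lin_on_sum[OF inv(5)])
        (auto simp: vector_bundleD(2)[OF E] lin_onD(2)[OF inv(5)] subspace_scale subset_iff intro!: sum.cong)
    also have "\<tau> m \<dots> = (\<Sum>i\<in>Bs. (y \<bullet> i) *\<^sub>R ?f i m)"
      using Bs(2) inv(3) lin_on_sum[OF vector_bundleD(6)[OF E V x(3)] sub]
      by (subst lin_on_sum[OF vector_bundleD(6)[OF E V x(3)] sub])
        (auto simp: lin_onD(2)[OF vector_bundleD(6)[OF E V x(3)]] subspace_scale[OF sub] subset_iff intro!: sum.cong)
    finally show "(\<Sum>i\<in>Bs. (snd x \<bullet> i) *\<^sub>R (?f i \<circ> inv_into U \<phi>) (fst x)) =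
        ((\<lambda>p. \<tau> (fst p) (snd p)) \<circ> inv_into X \<theta>) x"
      using total_chart_inv[OF *(1,2) x(2,4,5)] chartedD(1)[OF base_charted *(1)] *(3,4) x by simp
  qed
qed

lemma smooth_fun_on_triv_map:
  fixes N :: "('n, 'k::euclidean_space) manifold"
  assumes "charted N" "smooth_map N (total E) G" "(V, \<tau>) \<in> trivs E"
  shows "smooth_fun_on N ((fst \<circ> G) -` V) (\<lambda>p. \<tau> (fst (G p)) (snd (G p)))"
  using smooth_fun_on_pullback[OF assms(1) total_charted assms(2) smooth_fun_on_triv[OF assms(3)]]
  by (simp add: vimage_comp)

text \<open>\<open>smooth_map\<close> also asks for open preimages of the charts of the total space.
  Continuity of f provides them, since such a chart contains whole fibres.\<close>

lemma smooth_map_into_total: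
  fixes N :: "('n, 'k::euclidean_space) manifold"
  assumes N: "charted N" and f: "smooth_map N (base E) f"
    and s: "\<And>p. p \<in> points N \<Longrightarrow> s p \<in> fibre E (f p)"
    and smooth: "\<And>V \<tau>. (V, \<tau>) \<in> trivs E \<Longrightarrow> smooth_fun_on N (f -` V) (\<lambda>p. \<tau> (f p) (s p))"
  shows "smooth_map N (total E) (\<lambda>p. (f p, s p))"
  unfolding smooth_map_def
proof (intro conjI)
  show "(\<lambda>p. (f p, s p)) ` points N \<subseteq> points (total E)"
    using smooth_mapD(1)[OF f] s by (auto simp: points_total)
  show "\<forall>(U, \<phi>)\<in>atlas N. \<forall>(X, \<theta>)\<in>atlas (total E).
      openin (top_of_set (model N)) (\<phi> ` (U \<inter> (\<lambda>p. (f p, s p)) -` X)) \<and>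
      smooth_on (\<phi> ` (U \<inter> (\<lambda>p. (f p, s p)) -` X)) (\<theta> \<circ> (\<lambda>p. (f p, s p)) \<circ> inv_into U \<phi>)"
  proof clarify
    fix U \<phi> X \<theta> assume U: "(U, \<phi>) \<in> atlas N" and X: "(X, \<theta>) \<in> atlas (total E)"
    obtain U' \<psi> V \<tau> where *: "(U', \<psi>) \<in> atlas (base E)" "(V, \<tau>) \<in> trivs E"
      "X = Sigma (U' \<inter> V) (fibre E)" "\<theta> = (\<lambda>(m, v). (\<psi> m, \<tau> m v))"
      by (rule atlas_totalE[OF X])
    note inj = chartedD[OF N U]
    have eq: "U \<inter> (\<lambda>p. (f p, s p)) -` X = U \<inter> f -` (U' \<inter> V)"
      using s inj(3) *(3) by auto
    have "mfd_open (base E) (U' \<inter> V)"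
      using mfd_open_chart[OF base_atlas *(1) open_UNIV] vector_bundleD(4)[OF E *(2)]
      by (intro mfd_open_Int[OF base_atlas]) auto
    from smooth_map_preimage_open[OF N base_charted f this]
    have "openin (top_of_set (model N)) (\<phi> ` (points N \<inter> f -` (U' \<inter> V) \<inter> U))"
      using U by (auto simp: mfd_open_def)
    moreover have "points N \<inter> f -` (U' \<inter> V) \<inter> U = U \<inter> f -` (U' \<inter> V)" using inj(3) by blast
    ultimately have "openin (top_of_set (model N)) (\<phi> ` (U \<inter> (\<lambda>p. (f p, s p)) -` X))"
      by (simp add: eq)
    moreover have "smooth_on (\<phi> ` (U \<inter> f -` (U' \<inter> V))) (\<psi> \<circ> f \<circ> inv_into U \<phi>)"
      by (rule smooth_on_subset[OF smooth_mapD(3)[OF f U *(1)]]) blast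
    moreover have "smooth_on (\<phi> ` (U \<inter> f -` (U' \<inter> V))) ((\<lambda>p. \<tau> (f p) (s p)) \<circ> inv_into U \<phi>)"
      by (rule smooth_on_subset[OF smooth_fun_onD[OF smooth[OF *(2)] U]]) blast
    ultimately show "openin (top_of_set (model N)) (\<phi> ` (U \<inter> (\<lambda>p. (f p, s p)) -` X)) \<and>
      smooth_on (\<phi> ` (U \<inter> (\<lambda>p. (f p, s p)) -` X)) (\<theta> \<circ> (\<lambda>p. (f p, s p)) \<circ> inv_into U \<phi>)"
      unfolding eq *(4) o_def using smooth_on_Pair[of _ "\<lambda>x. \<psi> (f (inv_into U \<phi> x))"] by (simp add: o_def)
  qed
qed

lemma smooth_map_id: "smooth_map (base E) (base E) (\<lambda>m. m)"
  using base_atlas unfolding smooth_map_def smooth_atlas_def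
  by (auto simp: o_def vimage_def)

section \<open>The module of sections\<close>

lemma sections_iff:
  "s \<in> \<Gamma> E \<longleftrightarrow> (\<forall>m\<in>points (base E). s m \<in> fibre E m) \<and> (\<forall>m. m \<notin> points (base E) \<longrightarrow> s m = 0) \<and>
     (\<forall>(V, \<tau>)\<in>trivs E. smooth_fun_on (base E) V (\<lambda>m. \<tau> m (s m)))"
proof -
  have "smooth_map (base E) (total E) (\<lambda>m. (m, s m)) \<longleftrightarrow>
      (\<forall>(V, \<tau>)\<in>trivs E. smooth_fun_on (base E) V (\<lambda>m. \<tau> m (s m)))"
    if "\<forall>m\<in>points (base E). s m \<in> fibre E m"
  proof
    assume *: "smooth_map (base E) (total E) (\<lambda>m. (m, s m))"
    show "\<forall>(V, \<tau>)\<in>trivs E. smooth_fun_on (base E) V (\<lambda>m. \<tau> m (s m))"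
      using smooth_fun_on_triv_map[OF base_charted *] by (auto simp: o_def)
  next
    assume *: "\<forall>(V, \<tau>)\<in>trivs E. smooth_fun_on (base E) V (\<lambda>m. \<tau> m (s m))"
    show "smooth_map (base E) (total E) (\<lambda>m. (m, s m))"
      by (rule smooth_map_into_total[OF base_charted smooth_map_id]) (use * that in auto)
  qed
  then show ?thesis by (auto simp: sections_def)
qed

lemma sectionsD:
  assumes "s \<in> \<Gamma> E"
  shows "m \<in> points (base E) \<Longrightarrow> s m \<in> fibre E m" "m \<notin> points (base E) \<Longrightarrow> s m = 0"
    "(V, \<tau>) \<in> trivs E \<Longrightarrow> smooth_fun_on (base E) V (\<lambda>m. \<tau> m (s m))"
    "smooth_map (base E) (total E) (\<lambda>m. (m, s m))"
  using assms sections_iff[of s] by (auto simp: sections_def)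

lemma sections_0: "(\<lambda>m. 0) \<in> \<Gamma> E"
proof -
  have "smooth_fun_on (base E) V (\<lambda>m. \<tau> m 0)" if V: "(V, \<tau>) \<in> trivs E" for V \<tau>
    by (rule smooth_fun_on_cong[OF base_charted smooth_fun_on_const[of _ _ 0]])
      (simp add: lin_on_0[OF vector_bundleD(6)[OF E V]] vector_bundleD(3)[OF E])
  then show ?thesis
    by (auto simp: sections_iff subspace_0 vector_bundleD(3)[OF E])
qed

lemma sections_add:
  assumes "s \<in> \<Gamma> E" "t \<in> \<Gamma> E"
  shows "(\<lambda>m. s m + t m) \<in> \<Gamma> E"
proof -
  have "smooth_fun_on (base E) V (\<lambda>m. \<tau> m (s m + t m))" if V: "(V, \<tau>) \<in> trivs E" for V \<tau>
    by (rule smooth_fun_on_cong[OF base_charted smooth_fun_on_add[OF sectionsD(3)[OF assms(1) V] sectionsD(3)[OF assms(2) V]]])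
      (simp add: lin_onD(1)[OF vector_bundleD(6)[OF E V]] sectionsD(1)[OF assms(1)] sectionsD(1)[OF assms(2)])
  then show ?thesis
    using sectionsD(1,2)[OF assms(1)] sectionsD(1,2)[OF assms(2)]
    by (auto simp: sections_iff subspace_add vector_bundleD(3)[OF E])
qed

lemma sections_scale:
  assumes "f \<in> smooth_funs (base E)" "s \<in> \<Gamma> E"
  shows "(\<lambda>m. f m *\<^sub>R s m) \<in> \<Gamma> E"
proof -
  have "smooth_fun_on (base E) V (\<lambda>m. \<tau> m (f m *\<^sub>R s m))" if V: "(V, \<tau>) \<in> trivs E" for V \<tau>
  proof (rule smooth_fun_on_cong[OF base_charted smooth_fun_on_scaleR[OF _ sectionsD(3)[OF assms(2) V]]])
    show "smooth_fun_on (base E) V f"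
      using assms(1) vector_bundleD(5)[OF E V] by (auto simp: smooth_funs_def intro: smooth_fun_on_subset)
  qed (simp add: lin_onD(2)[OF vector_bundleD(6)[OF E V]] sectionsD(1)[OF assms(2)])
  then show ?thesis
    using sectionsD(1,2)[OF assms(2)] by (auto simp: sections_iff subspace_scale vector_bundleD(3)[OF E])
qed

lemma sections_sum_list:
  "(\<And>x. x \<in> set xs \<Longrightarrow> s x \<in> \<Gamma> E) \<Longrightarrow> (\<lambda>m. \<Sum>x\<leftarrow>xs. s x m) \<in> \<Gamma> E"
  by (induction xs) (auto intro: sections_add sections_0)

section \<open>Linear forms and local dual bases\<close>

lemma dual_sectionsI:
  assumes "\<And>m. m \<in> points (base E) \<Longrightarrow> lin_on (fibre E m) (\<psi> m)" "\<ell> \<psi> \<in> smooth_funs (total E)"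
  shows "\<psi> \<in> dual_sections E"
  using assms smooth_funs_pullback[OF base_charted total_charted sectionsD(4) assms(2)]
  by (auto simp: dual_sections_def lin_fun_def)

text \<open>Smoothness of the fibrewise linear function is proved directly in charts, because the
  general \<open>lin_fun_smooth\<close> rests on the dual bases built from these forms. The same
  functions later serve as fibre coordinates on the total space.\<close>

lemma cutoff_coordinate_form:
  assumes V: "(V, \<tau>) \<in> trivs E" and \<eta>: "\<eta> \<in> smooth_funs (base E)"
    and K: "K \<subseteq> V" "mfd_open (base E) (points (base E) - K)" "\<And>q. q \<notin> K \<Longrightarrow> \<eta> q = 0"
  shows "\<ell> (\<lambda>m x. \<eta> m * (\<tau> m x \<bullet> i)) \<in> smooth_funs (total E)"
    and "(\<lambda>m x. \<eta> m * (\<tau> m x \<bullet> i)) \<in> dual_sections E"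
proof -
  note Vo = vector_bundleD(4)[OF E V] and lin = vector_bundleD(6)[OF E V]
  define \<psi> where "\<psi> m x = \<eta> m * (\<tau> m x \<bullet> i)" for m x
  have \<eta>W: "smooth_fun_on (base E) W \<eta>" for W
    using smooth_fun_on_Int_points[OF base_charted smooth_fun_on_subset[of _ "points (base E)"]] \<eta>
    by (simp add: smooth_funs_def)
  have eq: "\<ell> \<psi> = (\<lambda>p. \<eta> (fst p) * (\<tau> (fst p) (snd p) \<bullet> i))"
    by (simp add: fun_eq_iff lin_fun_comp \<psi>_def)
  have V': "mfd_open (total E) (points (total E) \<inter> fst -` V)"
    by (rule smooth_map_preimage_open[OF total_charted base_charted smooth_map_fst Vo])
  have "mfd_open (total E) (points (total E) \<inter> fst -` (points (base E) - K))"
    by (rule smooth_map_preimage_open[OF total_charted base_charted smooth_map_fst K(2)])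
  moreover have "points (total E) \<inter> fst -` (points (base E) - K)
      = points (total E) - (points (total E) \<inter> fst -` K)"
    by (auto simp: points_total)
  ultimately have K': "mfd_open (total E) (points (total E) - (points (total E) \<inter> fst -` K))" by simp
  have "smooth_fun_on (total E) (fst -` V) (\<ell> \<psi>)"
    unfolding eq
    by (intro smooth_fun_on_mult smooth_fun_on_pullback[OF total_charted base_charted smooth_map_fst \<eta>W]
        smooth_fun_on_linear[OF smooth_fun_on_triv[OF V] bounded_linear_inner_left])
  then have "smooth_fun_on (total E) (points (total E) \<inter> (points (total E) \<inter> fst -` V)) (\<ell> \<psi>)"
    by (rule smooth_fun_on_subset) blast
  then have "smooth_fun_on (total E) (points (total E)) (\<ell> \<psi>)"
    by (rule smooth_fun_on_extend_zero[OF total_charted V' K', rotated]) (use K(1,3) in \<open>auto simp: eq\<close>)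
  then have l: "\<ell> \<psi> \<in> smooth_funs (total E)" by (simp add: smooth_funs_def)
  have "lin_on (fibre E m) (\<psi> m)" for m
  proof (cases "m \<in> V")
    case True
    then show ?thesis
      using lin_onD[OF lin[OF True]] by (auto simp: lin_on_def \<psi>_def inner_add_left distrib_left)
  next
    case False
    then have "\<eta> m = 0" using K(1,3) by blast
    then show ?thesis by (simp add: \<psi>_def lin_on_def)
  qed
  from l dual_sectionsI[OF this l]
  show "\<ell> (\<lambda>m x. \<eta> m * (\<tau> m x \<bullet> i)) \<in> smooth_funs (total E)"
    "(\<lambda>m x. \<eta> m * (\<tau> m x \<bullet> i)) \<in> dual_sections E"
    unfolding \<psi>_def .
qed

text \<open>
  A dual basis over a trivializing neighbourhood of \<open>m\<^sub>0\<close>, made global by a cut-off function.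
\<close>

lemma local_dual_basis_aux:
  assumes m0: "m\<^sub>0 \<in> points (base E)"
  obtains \<kappa> ps where "\<kappa> \<in> smooth_funs (base E)" "\<kappa> m\<^sub>0 = 1"
    "set ps \<subseteq> dual_sections E \<times> \<Gamma> E" "\<And>\<psi> e. (\<psi>, e) \<in> set ps \<Longrightarrow> \<ell> \<psi> \<in> smooth_funs (total E)"
    "\<And>m x. m \<in> points (base E) \<Longrightarrow> x \<in> fibre E m \<Longrightarrow> \<kappa> m *\<^sub>R x = (\<Sum>(\<psi>, e)\<leftarrow>ps. \<psi> m x *\<^sub>R e m)"
proof -
  obtain V \<tau> where V: "(V, \<tau>) \<in> trivs E" "m\<^sub>0 \<in> V" using trivs_cover[OF E m0] .
  note Vo = vector_bundleD(4)[OF E V(1)] and inv = triv_inv[OF E V(1)]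
    and lin = vector_bundleD(6)[OF E V(1)]
  obtain \<eta> K where \<eta>: "\<eta> \<in> smooth_funs (base E)" "\<eta> m\<^sub>0 = 1" "K \<subseteq> V" "mfd_open (base E) (points (base E) - K)"
    "\<And>q. q \<notin> K \<Longrightarrow> \<eta> q = 0"
    by (rule manifold_bump[OF vector_bundleD(1)[OF E] Vo V(2)]) blast
  have \<eta>V: "smooth_fun_on (base E) W \<eta>" for W
    using smooth_fun_on_Int_points[OF base_charted smooth_fun_on_subset[of _ "points (base E)"]] \<eta>(1)
    by (simp add: smooth_funs_def)
  obtain Bs where Bs: "finite Bs" "Bs \<subseteq> fmodel E" "\<And>x. x \<in> fmodel E \<Longrightarrow> x = (\<Sum>i\<in>Bs. (x \<bullet> i) *\<^sub>R i)"
    using orthonormal_basis_expansion[OF vector_bundleD(2)[OF E]] by blast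
  obtain bs where bs: "set bs = Bs" "distinct bs" using finite_distinct_list[OF Bs(1)] by blast
  define \<psi> where "\<psi> i m x = \<eta> m * (\<tau> m x \<bullet> i)" for i m x
  define e where "e i m = \<eta> m *\<^sub>R inv_into (fibre E m) (\<tau> m) i" for i m
  note form = cutoff_coordinate_form[OF V(1) \<eta>(1,3-5)]
  have l\<psi>: "\<ell> (\<psi> i) \<in> smooth_funs (total E)" and \<psi>: "\<psi> i \<in> dual_sections E" for i
    using form[of i] by (simp_all add: \<psi>_def[abs_def])
  have e: "e i \<in> \<Gamma> E" if i: "i \<in> Bs" for i
  proof -
    have "e i m \<in> fibre E m" if m: "m \<in> points (base E)" for m
    proof (cases "m \<in> V")
      case True
      then show ?thesis
        using inv(3) Bs(2) i subspace_scale[OF vector_bundleD(3)[OF E m]] by (auto simp: e_def)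
    next
      case False
      then have "\<eta> m = 0" using \<eta>(3,5) by blast
      then show ?thesis using subspace_0[OF vector_bundleD(3)[OF E m]] by (simp add: e_def)
    qed
    moreover have "e i m = 0" if "m \<notin> points (base E)" for m
      using that \<eta>(3,5) vector_bundleD(5)[OF E V(1)] by (auto simp: e_def)
    moreover have "smooth_fun_on (base E) V' (\<lambda>m. \<sigma> m (e i m))" if V': "(V', \<sigma>) \<in> trivs E" for V' \<sigma>
    proof (rule smooth_fun_on_extend_zero[OF base_charted Vo \<eta>(4,3)])
      have i': "i \<in> fmodel E" using i Bs(2) by blast
      have "smooth_fun_on (base E) (V \<inter> V') (\<lambda>m. \<eta> m *\<^sub>R \<sigma> m (inv_into (fibre E m) (\<tau> m) i))"
        by (intro smooth_fun_on_scaleR \<eta>V vector_bundleD(8)[OF E V(1) V' i'])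
      then show "smooth_fun_on (base E) (V' \<inter> V) (\<lambda>m. \<sigma> m (e i m))"
        unfolding Int_commute[of V' V]
        by (rule smooth_fun_on_cong[OF base_charted])
          (simp add: e_def lin_onD(2)[OF vector_bundleD(6)[OF E V']] inv(3) i')
    next
      fix m assume m: "m \<in> points (base E)" "m \<in> V'" "m \<notin> K"
      then have "e i m = 0" using \<eta>(5) by (simp add: e_def)
      then show "\<sigma> m (e i m) = 0"
        using lin_on_0[OF vector_bundleD(6)[OF E V' m(2)] vector_bundleD(3)[OF E m(1)]] by simp
    qed
    ultimately show ?thesis by (auto simp: sections_iff)
  qed
  show thesis
  proof
    \<comment> \<open>Form and section each carry a factor \<eta> in order to be global, so the
      expansion reproduces x times the square.\<close>
    show "(\<lambda>m. \<eta> m * \<eta> m) \<in> smooth_funs (base E)" by (intro smooth_funs_mult \<eta>)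
    show "\<eta> m\<^sub>0 * \<eta> m\<^sub>0 = 1" by (simp add: \<eta>)
    show "set (map (\<lambda>i. (\<psi> i, e i)) bs) \<subseteq> dual_sections E \<times> \<Gamma> E" using \<psi> e bs by auto
    show "\<ell> \<psi>' \<in> smooth_funs (total E)" if "(\<psi>', e') \<in> set (map (\<lambda>i. (\<psi> i, e i)) bs)" for \<psi>' e'
      using that l\<psi> by auto
    fix m x assume m: "m \<in> points (base E)" and x: "x \<in> fibre E m"
    have "(\<eta> m * \<eta> m) *\<^sub>R x = (\<Sum>i\<in>Bs. \<psi> i m x *\<^sub>R e i m)"
    proof (cases "m \<in> V")
      case True
      have "x = inv_into (fibre E m) (\<tau> m) (\<Sum>i\<in>Bs. (\<tau> m x \<bullet> i) *\<^sub>R i)"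
        using Bs(3)[OF inv(1)[OF True x]] inv(2)[OF True x] by simp
      also have "\<dots> = (\<Sum>i\<in>Bs. (\<tau> m x \<bullet> i) *\<^sub>R inv_into (fibre E m) (\<tau> m) i)"
        using Bs(2) by (subst lin_on_sum[OF inv(5)[OF True]])
          (auto simp: vector_bundleD(2)[OF E] lin_onD(2)[OF inv(5)[OF True]] subspace_scale subset_iff intro!: sum.cong)
      finally have "(\<eta> m * \<eta> m) *\<^sub>R x = (\<eta> m * \<eta> m) *\<^sub>R (\<Sum>i\<in>Bs. (\<tau> m x \<bullet> i) *\<^sub>R inv_into (fibre E m) (\<tau> m) i)"
        by simp
      then show ?thesis by (simp add: \<psi>_def e_def scaleR_sum_right mult_ac)
    next
      case False
      then have "\<eta> m = 0" using \<eta>(3,5) by blast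
      then show ?thesis by (simp add: \<psi>_def)
    qed
    then show "(\<eta> m * \<eta> m) *\<^sub>R x = (\<Sum>(\<psi>, e)\<leftarrow>map (\<lambda>i. (\<psi> i, e i)) bs. \<psi> m x *\<^sub>R e m)"
      using bs by (simp add: o_def sum_list_distinct_conv_sum_set)
  qed
qed

end

lemma dual_sectionsD:
  assumes "\<psi> \<in> dual_sections E"
  shows "m \<in> points (base E) \<Longrightarrow> lin_on (fibre E m) (\<psi> m)"
    and "s \<in> \<Gamma> E \<Longrightarrow> (\<lambda>m. \<psi> m (s m)) \<in> smooth_funs (base E)"
  using assms by (auto simp: dual_sections_def)

lemma local_dual_basis:
  assumes "vector_bundle E" "m\<^sub>0 \<in> points (base E)"
  obtains \<kappa> ps where "\<kappa> \<in> smooth_funs (base E)" "\<kappa> m\<^sub>0 = 1" "set ps \<subseteq> dual_sections E \<times> \<Gamma> E"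
    "\<And>m x. m \<in> points (base E) \<Longrightarrow> x \<in> fibre E m \<Longrightarrow> \<kappa> m *\<^sub>R x = (\<Sum>(\<psi>, e)\<leftarrow>ps. \<psi> m x *\<^sub>R e m)"
  by (rule local_dual_basis_aux[OF assms]) blast

text \<open>\<open>dual_sections\<close> require smoothness along sections. The dual basis writes
  \<kappa> \<psi> as a combination of the basis forms with the coefficients \<psi>(e), which are
  functions on the base, and for the basis forms the claim is already known.\<close>

lemma lin_fun_smooth:
  assumes E: "vector_bundle E" and \<psi>: "\<psi> \<in> dual_sections E"
  shows "\<ell> \<psi> \<in> smooth_funs (total E)"
  unfolding smooth_funs_def mem_Collect_eq
proof (rule smooth_fun_on_cutoff[OF total_charted[OF E]])
  fix p assume "p \<in> points (total E)"
  then have m: "fst p \<in> points (base E)" by (auto simp: points_total)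
  obtain \<kappa> ps where ps: "\<kappa> \<in> smooth_funs (base E)" "\<kappa> (fst p) = 1" "set ps \<subseteq> dual_sections E \<times> \<Gamma> E"
    "\<And>\<psi> e. (\<psi>, e) \<in> set ps \<Longrightarrow> \<ell> \<psi> \<in> smooth_funs (total E)"
    "\<And>m x. m \<in> points (base E) \<Longrightarrow> x \<in> fibre E m \<Longrightarrow> \<kappa> m *\<^sub>R x = (\<Sum>(\<psi>, e)\<leftarrow>ps. \<psi> m x *\<^sub>R e m)"
    by (rule local_dual_basis_aux[OF E m]) blast
  note pull = smooth_funs_pullback[OF total_charted[OF E] base_charted[OF E] smooth_map_fst[OF E]]
  have "(\<lambda>q. \<Sum>x\<leftarrow>ps. \<ell> (fst x) q * \<psi> (fst q) (snd x (fst q))) \<in> smooth_funs (total E)"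
  proof (rule smooth_funs_sum_list, rule smooth_funs_mult)
    fix x assume x: "x \<in> set ps"
    then show "\<ell> (fst x) \<in> smooth_funs (total E)" using ps(4)[of "fst x" "snd x"] by simp
    have "snd x \<in> \<Gamma> E" using x ps(3) by auto
    from pull[OF dual_sectionsD(2)[OF \<psi> this]]
    show "(\<lambda>q. \<psi> (fst q) (snd x (fst q))) \<in> smooth_funs (total E)" .
  qed
  then have "(\<lambda>q. \<kappa> (fst q) *\<^sub>R \<ell> \<psi> q) \<in> smooth_funs (total E)"
  proof (rule smooth_funs_cong[OF total_charted[OF E]])
    fix q assume "q \<in> points (total E)"
    then have q: "fst q \<in> points (base E)" "snd q \<in> fibre E (fst q)" by (auto simp: points_total)
    note lin = dual_sectionsD(1)[OF \<psi> q(1)] and sub = vector_bundleD(3)[OF E q(1)]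
    have e: "snd x (fst q) \<in> fibre E (fst q)" if "x \<in> set ps" for x
      using that ps(3) sectionsD(1)[OF E _ q(1)] by auto
    have "\<kappa> (fst q) *\<^sub>R \<ell> \<psi> q = \<psi> (fst q) (\<kappa> (fst q) *\<^sub>R snd q)"
      by (simp add: lin_fun_comp lin_onD(2)[OF lin q(2)])
    also have "\<dots> = \<psi> (fst q) (\<Sum>x\<leftarrow>ps. fst x (fst q) (snd q) *\<^sub>R snd x (fst q))"
      by (simp add: ps(5)[OF q] case_prod_unfold)
    also have "\<dots> = (\<Sum>x\<leftarrow>ps. \<psi> (fst q) (fst x (fst q) (snd q) *\<^sub>R snd x (fst q)))"
      by (rule lin_on_sum_list(1)[OF lin sub]) (use e subspace_scale[OF sub] in blast)
    also have "\<dots> = (\<Sum>x\<leftarrow>ps. \<ell> (fst x) q * \<psi> (fst q) (snd x (fst q)))"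
      using e by (intro arg_cong[where f = sum_list] map_cong) (simp_all add: lin_onD(2)[OF lin] lin_fun_comp)
    finally show "(\<Sum>x\<leftarrow>ps. \<ell> (fst x) q * \<psi> (fst q) (snd x (fst q))) = \<kappa> (fst q) *\<^sub>R \<ell> \<psi> q" by simp
  qed
  then have "smooth_fun_on (total E) (points (total E)) (\<lambda>q. \<kappa> (fst q) *\<^sub>R \<ell> \<psi> q)"
    by (simp add: smooth_funs_def)
  then show "\<exists>\<kappa>\<in>smooth_funs (total E). \<kappa> p \<noteq> 0 \<and> smooth_fun_on (total E) (points (total E)) (\<lambda>q. \<kappa> q *\<^sub>R \<ell> \<psi> q)"
    using pull[OF ps(1)] ps(2) by (intro bexI[of _ "\<lambda>q. \<kappa> (fst q)"]) auto
qed

lemma smooth_funs_dual_along: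
  assumes "vector_bundle E" "\<psi> \<in> dual_sections E" "charted N" "smooth_map N (total E) G"
  shows "(\<lambda>p. \<psi> (fst (G p)) (snd (G p))) \<in> smooth_funs N"
  using smooth_funs_pullback[OF assms(3) total_charted[OF assms(1)] assms(4) lin_fun_smooth[OF assms(1,2)]]
  by (simp add: lin_fun_comp)

text \<open>The expansion of x at m in the local frame, with its coefficients kept constant, is a
  global section.\<close>

lemma section_through:
  assumes E: "vector_bundle E" and m: "m \<in> points (base E)" and x: "x \<in> fibre E m"
  obtains s where "s \<in> \<Gamma> E" "s m = x"
proof -
  obtain \<kappa> ps where ps: "\<kappa> \<in> smooth_funs (base E)" "\<kappa> m = 1" "set ps \<subseteq> dual_sections E \<times> \<Gamma> E"
    "\<And>m x. m \<in> points (base E) \<Longrightarrow> x \<in> fibre E m \<Longrightarrow> \<kappa> m *\<^sub>R x = (\<Sum>(\<psi>, e)\<leftarrow>ps. \<psi> m x *\<^sub>R e m)"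
    by (rule local_dual_basis[OF E m]) blast
  have x_eq: "x = (\<Sum>y\<leftarrow>ps. fst y m x *\<^sub>R snd y m)"
    using ps(4)[OF m x] ps(2) by (simp add: case_prod_unfold)
  have "(\<lambda>q. \<Sum>y\<leftarrow>ps. fst y m x *\<^sub>R snd y q) \<in> \<Gamma> E"
    using ps(3) by (intro sections_sum_list[OF E] sections_scale[OF E smooth_funs_const]) auto
  then show thesis using that x_eq[symmetric] by blast
qed

lemma dual_sections_separate:
  assumes E: "vector_bundle E" and m: "m \<in> points (base E)" and x: "x \<in> fibre E m"
    and "\<And>\<psi>. \<psi> \<in> dual_sections E \<Longrightarrow> \<psi> m x = 0"
  shows "x = 0"
proof -
  obtain \<kappa> ps where ps: "\<kappa> \<in> smooth_funs (base E)" "\<kappa> m = 1" "set ps \<subseteq> dual_sections E \<times> \<Gamma> E"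
    "\<And>m x. m \<in> points (base E) \<Longrightarrow> x \<in> fibre E m \<Longrightarrow> \<kappa> m *\<^sub>R x = (\<Sum>(\<psi>, e)\<leftarrow>ps. \<psi> m x *\<^sub>R e m)"
    by (rule local_dual_basis[OF E m]) blast
  have x_eq: "x = (\<Sum>y\<leftarrow>ps. fst y m x *\<^sub>R snd y m)"
    using ps(4)[OF m x] ps(2) by (simp add: case_prod_unfold)
  have "(\<Sum>y\<leftarrow>ps. fst y m x *\<^sub>R snd y m) = (\<Sum>y\<leftarrow>ps. 0)"
    using assms(4) ps(3) by (intro arg_cong[where f = sum_list] map_cong) auto
  then show ?thesis using x_eq by simp
qed

section \<open>Bundle morphisms and tensoriality\<close>

lemma vb_morphismD:
  assumes "vb_morphism E E' f G"
  shows "smooth_map (base E) (base E') f" "smooth_map (total E) (total E') G"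
    "m \<in> points (base E) \<Longrightarrow> e \<in> fibre E m \<Longrightarrow> fst (G (m, e)) = f m"
    "m \<in> points (base E) \<Longrightarrow> lin_on (fibre E m) (\<lambda>e. snd (G (m, e)))"
    "m \<in> points (base E) \<Longrightarrow> e \<in> fibre E m \<Longrightarrow> snd (G (m, e)) \<in> fibre E' (f m)"
    "m \<in> points (base E) \<Longrightarrow> f m \<in> points (base E')"
proof -
  show f: "smooth_map (base E) (base E') f" and G: "smooth_map (total E) (total E') G"
    and fst: "m \<in> points (base E) \<Longrightarrow> e \<in> fibre E m \<Longrightarrow> fst (G (m, e)) = f m"
    and "m \<in> points (base E) \<Longrightarrow> lin_on (fibre E m) (\<lambda>e. snd (G (m, e)))" for m e
    using assms by (auto simp: vb_morphism_def)
  show "m \<in> points (base E) \<Longrightarrow> f m \<in> points (base E')" using smooth_mapD(1)[OF f] .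
  show "m \<in> points (base E) \<Longrightarrow> e \<in> fibre E m \<Longrightarrow> snd (G (m, e)) \<in> fibre E' (f m)"
    using smooth_mapD(1)[OF G, of "(m, e)"] fst[of m e] by (cases "G (m, e)") (auto simp: points_total)
qed

lemma bundle_mapD:
  assumes "bundle_map E E' \<phi>" "m \<in> points (base E)"
  shows "lin_on (fibre E m) (\<phi> m)" "e \<in> fibre E m \<Longrightarrow> \<phi> m e \<in> fibre E' m"
proof -
  have "vb_morphism E E' id (total_map \<phi>)" using assms(1) by (simp add: bundle_map_def)
  from vb_morphismD(4)[OF this assms(2)] vb_morphismD(5)[OF this assms(2)]
  show "lin_on (fibre E m) (\<phi> m)" "e \<in> fibre E m \<Longrightarrow> \<phi> m e \<in> fibre E' m"
    by (simp_all add: total_map_def)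
qed

lemma apply_map_sections:
  assumes E: "vector_bundle E" and E': "vector_bundle E'" and \<phi>: "bundle_map E E' \<phi>" and s: "s \<in> \<Gamma> E"
  shows "apply_map (base E) \<phi> s \<in> \<Gamma> E'"
proof -
  have vb: "vb_morphism E E' id (total_map \<phi>)" and base: "base E' = base E"
    using \<phi> by (auto simp: bundle_map_def)
  have "smooth_fun_on (base E) V (\<lambda>m. \<tau> m (apply_map (base E) \<phi> s m))" if V: "(V, \<tau>) \<in> trivs E'" for V \<tau>
  proof -
    note * = smooth_fun_on_triv_map[OF E' total_charted[OF E] vb_morphismD(2)[OF vb] V]
    from smooth_fun_on_pullback[OF base_charted[OF E] total_charted[OF E] sectionsD(4)[OF E s] *]
    have "smooth_fun_on (base E) V (\<lambda>m. \<tau> m (\<phi> m (s m)))"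
      by (simp add: total_map_def vimage_def)
    then show ?thesis
      by (rule smooth_fun_on_cong[OF base_charted[OF E]]) (simp add: apply_map_def off_zero_def)
  qed
  then show ?thesis
    using bundle_mapD(2)[OF \<phi>] sectionsD(1)[OF E s]
    by (auto simp: sections_iff[OF E'] base apply_map_def off_zero_def)
qed

text \<open>Expanding \<kappa> X in a local dual basis gives T X as the sum of the numbers
  \<psi>(X)(m) T(e), in which X enters only through X m.\<close>

lemma tensorial_cong:
  fixes T :: "('m \<Rightarrow> 'v::real_vector) \<Rightarrow> real"
  assumes E: "vector_bundle E" and m: "m \<in> points (base E)"
    and add: "\<And>X Y. X \<in> \<Gamma> E \<Longrightarrow> Y \<in> \<Gamma> E \<Longrightarrow> T (\<lambda>q. X q + Y q) = T X + T Y"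
    and scale: "\<And>f X. f \<in> smooth_funs (base E) \<Longrightarrow> X \<in> \<Gamma> E \<Longrightarrow> T (\<lambda>q. f q *\<^sub>R X q) = f m * T X"
    and X: "X \<in> \<Gamma> E" and Y: "Y \<in> \<Gamma> E" and eq: "X m = Y m"
  shows "T X = T Y"
proof -
  obtain \<kappa> ps where ps: "\<kappa> \<in> smooth_funs (base E)" "\<kappa> m = 1" "set ps \<subseteq> dual_sections E \<times> \<Gamma> E"
    "\<And>m x. m \<in> points (base E) \<Longrightarrow> x \<in> fibre E m \<Longrightarrow> \<kappa> m *\<^sub>R x = (\<Sum>(\<psi>, e)\<leftarrow>ps. \<psi> m x *\<^sub>R e m)"
    by (rule local_dual_basis[OF E m]) blast
  have T0: "T (\<lambda>q. 0) = 0"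
    using scale[OF smooth_funs_const sections_0[OF E], of 0] by simp
  have Tsum: "T (\<lambda>q. \<Sum>x\<leftarrow>xs. fst x q (Z q) *\<^sub>R snd x q) = (\<Sum>x\<leftarrow>xs. fst x m (Z m) * T (snd x))"
    if Z: "Z \<in> \<Gamma> E" and "set xs \<subseteq> dual_sections E \<times> \<Gamma> E" for Z xs
    using that(2)
  proof (induction xs)
    case (Cons x xs)
    have f: "(\<lambda>q. fst y q (Z q)) \<in> smooth_funs (base E)" "snd y \<in> \<Gamma> E" if "y \<in> set (x # xs)" for y
      using dual_sectionsD(2)[OF _ Z, of "fst y"] Cons.prems that by auto
    have "(\<lambda>q. \<Sum>x\<leftarrow>xs. fst x q (Z q) *\<^sub>R snd x q) \<in> \<Gamma> E"
      by (intro sections_sum_list[OF E] sections_scale[OF E]) (use f in auto)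
    then show ?case
      using f Cons by (simp add: add sections_scale[OF E] scale)
  qed (simp add: T0)
  have TZ: "T Z = (\<Sum>x\<leftarrow>ps. fst x m (Z m) * T (snd x))" if Z: "Z \<in> \<Gamma> E" for Z
  proof -
    \<comment> \<open>The premises on T concern functions on the whole type, so the expansion must
      hold off the base too, where sections are normalized to 0.\<close>
    have "(\<lambda>q. \<kappa> q *\<^sub>R Z q) = (\<lambda>q. \<Sum>x\<leftarrow>ps. fst x q (Z q) *\<^sub>R snd x q)"
    proof
      fix q show "\<kappa> q *\<^sub>R Z q = (\<Sum>x\<leftarrow>ps. fst x q (Z q) *\<^sub>R snd x q)"
      proof (cases "q \<in> points (base E)")
        case True
        then show ?thesis using ps(4)[OF True sectionsD(1)[OF E Z True]] by (simp add: case_prod_unfold)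
      next
        case False
        have "(\<Sum>x\<leftarrow>ps. fst x q (Z q) *\<^sub>R snd x q) = (\<Sum>x\<leftarrow>ps. 0)"
          using sectionsD(2)[OF E _ False] ps(3) by (intro arg_cong[where f = sum_list] map_cong) auto
        then show ?thesis using sectionsD(2)[OF E Z False] by simp
      qed
    qed
    then show ?thesis using scale[OF ps(1) Z] Tsum[OF Z ps(3)] ps(2) by simp
  qed
  show ?thesis by (simp add: TZ X Y eq)
qed


section \<open>Lie algebroids\<close>

lemma lie_algebroidD:
  assumes "lie_algebroid A"
  shows "vector_bundle (vbun A)"
    "m \<in> points (base (vbun A)) \<Longrightarrow> e \<in> fibre (vbun A) m \<Longrightarrow> tangent_vector (base (vbun A)) m (anchor A m e)"
    "m \<in> points (base (vbun A)) \<Longrightarrow> f \<in> smooth_funs (base (vbun A)) \<Longrightarrow>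
      lin_on (fibre (vbun A) m) (\<lambda>e. anchor A m e f)"
    "X \<in> \<Gamma> (vbun A) \<Longrightarrow> f \<in> smooth_funs (base (vbun A)) \<Longrightarrow> (\<lambda>m. anchor A m (X m) f) \<in> smooth_funs (base (vbun A))"
    "X \<in> \<Gamma> (vbun A) \<Longrightarrow> Y \<in> \<Gamma> (vbun A) \<Longrightarrow> bracket A X Y \<in> \<Gamma> (vbun A)"
    "X \<in> \<Gamma> (vbun A) \<Longrightarrow> Y \<in> \<Gamma> (vbun A) \<Longrightarrow> bracket A X Y = (\<lambda>m. - bracket A Y X m)"
    "X \<in> \<Gamma> (vbun A) \<Longrightarrow> Y \<in> \<Gamma> (vbun A) \<Longrightarrow> Z \<in> \<Gamma> (vbun A) \<Longrightarrow>
      bracket A X (\<lambda>m. Y m + Z m) = (\<lambda>m. bracket A X Y m + bracket A X Z m)"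
    "X \<in> \<Gamma> (vbun A) \<Longrightarrow> Y \<in> \<Gamma> (vbun A) \<Longrightarrow> f \<in> smooth_funs (base (vbun A)) \<Longrightarrow>
      bracket A X (\<lambda>m. f m *\<^sub>R Y m) = (\<lambda>m. f m *\<^sub>R bracket A X Y m + anchor A m (X m) f *\<^sub>R Y m)"
proof -
  note * = assms[unfolded lie_algebroid_def Let_def]
  show "vector_bundle (vbun A)" using * by blast
  have b: "bundle_map_to_tangent (vbun A) (anchor A)" using * by blast
  show "m \<in> points (base (vbun A)) \<Longrightarrow> e \<in> fibre (vbun A) m \<Longrightarrow> tangent_vector (base (vbun A)) m (anchor A m e)"
    "m \<in> points (base (vbun A)) \<Longrightarrow> f \<in> smooth_funs (base (vbun A)) \<Longrightarrow>
      lin_on (fibre (vbun A) m) (\<lambda>e. anchor A m e f)"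
    "X \<in> \<Gamma> (vbun A) \<Longrightarrow> f \<in> smooth_funs (base (vbun A)) \<Longrightarrow> (\<lambda>m. anchor A m (X m) f) \<in> smooth_funs (base (vbun A))"
    using b unfolding bundle_map_to_tangent_def by blast+
  show "X \<in> \<Gamma> (vbun A) \<Longrightarrow> Y \<in> \<Gamma> (vbun A) \<Longrightarrow> bracket A X Y \<in> \<Gamma> (vbun A)"
    using * by blast
  show "X \<in> \<Gamma> (vbun A) \<Longrightarrow> Y \<in> \<Gamma> (vbun A) \<Longrightarrow> bracket A X Y = (\<lambda>m. - bracket A Y X m)"
    using * by blast
  show "X \<in> \<Gamma> (vbun A) \<Longrightarrow> Y \<in> \<Gamma> (vbun A) \<Longrightarrow> Z \<in> \<Gamma> (vbun A) \<Longrightarrow>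
      bracket A X (\<lambda>m. Y m + Z m) = (\<lambda>m. bracket A X Y m + bracket A X Z m)"
    using * by blast
  show "X \<in> \<Gamma> (vbun A) \<Longrightarrow> Y \<in> \<Gamma> (vbun A) \<Longrightarrow> f \<in> smooth_funs (base (vbun A)) \<Longrightarrow>
      bracket A X (\<lambda>m. f m *\<^sub>R Y m) = (\<lambda>m. f m *\<^sub>R bracket A X Y m + anchor A m (X m) f *\<^sub>R Y m)"
    using * by blast
qed

text \<open>The Chevalley--Eilenberg differential of \<open>\<xi> \<in> \<Gamma>(A\<^sup>*)\<close>.\<close>

definition ce_d ::
  "('m, 'e, 'v, 'f) lie_algd \<Rightarrow> ('m \<Rightarrow> 'v \<Rightarrow> real) \<Rightarrow> ('m \<Rightarrow> 'v) \<Rightarrow> ('m \<Rightarrow> 'v) \<Rightarrow> 'm \<Rightarrow> real" where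
  "ce_d A \<xi> X Y m =
     anchor A m (X m) (\<lambda>q. \<xi> q (Y q)) - anchor A m (Y m) (\<lambda>q. \<xi> q (X q)) - \<xi> m (bracket A X Y m)"

context
  fixes A :: "('m, 'e::euclidean_space, 'v::real_vector, 'f::euclidean_space) lie_algd" and \<xi> m
  assumes A: "lie_algebroid A" and \<xi>: "\<xi> \<in> dual_sections (vbun A)" and m: "m \<in> points (base (vbun A))"
begin

private lemmas E = lie_algebroidD(1)[OF A]
private lemmas lin = dual_sectionsD(1)[OF \<xi> m]
private lemmas \<rho>_lin = lie_algebroidD(3)[OF A m]

lemma ce_d_antisym:
  assumes "X \<in> \<Gamma> (vbun A)" "Y \<in> \<Gamma> (vbun A)"
  shows "ce_d A \<xi> X Y m = - ce_d A \<xi> Y X m"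
  using lin_on_minus[OF lin sectionsD(1)[OF E lie_algebroidD(5)[OF A assms(2,1)] m]]
    fun_cong[OF lie_algebroidD(6)[OF A assms], of m]
  by (simp add: ce_d_def)

lemma ce_d_add:
  assumes X: "X \<in> \<Gamma> (vbun A)" and Y: "Y \<in> \<Gamma> (vbun A)" and Z: "Z \<in> \<Gamma> (vbun A)"
  shows "ce_d A \<xi> X (\<lambda>q. Y q + Z q) m = ce_d A \<xi> X Y m + ce_d A \<xi> X Z m"
proof -
  note sec = sectionsD(1)[OF E _ m]
  note tv = lie_algebroidD(2)[OF A m sec[OF X]]
  note fY = dual_sectionsD(2)[OF \<xi> Y] and fZ = dual_sectionsD(2)[OF \<xi> Z]
  have "anchor A m (X m) (\<lambda>q. \<xi> q (Y q + Z q)) = anchor A m (X m) (\<lambda>q. \<xi> q (Y q) + \<xi> q (Z q))"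
    by (rule tangent_vector_cong[OF base_charted[OF E] tv dual_sectionsD(2)[OF \<xi> sections_add[OF E Y Z]]])
      (simp add: lin_onD(1)[OF dual_sectionsD(1)[OF \<xi>]] sectionsD(1)[OF E] Y Z)
  also have "\<dots> = anchor A m (X m) (\<lambda>q. \<xi> q (Y q)) + anchor A m (X m) (\<lambda>q. \<xi> q (Z q))"
    by (rule tangent_vectorD(2)[OF tv fY fZ])
  finally show ?thesis
    using lin_onD(1)[OF \<rho>_lin[OF dual_sectionsD(2)[OF \<xi> X]] sec[OF Y] sec[OF Z]]
      lin_onD(1)[OF lin sec[OF lie_algebroidD(5)[OF A X Y]] sec[OF lie_algebroidD(5)[OF A X Z]]]
    by (simp add: ce_d_def lie_algebroidD(7)[OF A X Y Z])
qed

text \<open>Differentiating \<xi>(f Y) produces \<xi>(Y) times the derivative of f along X, and the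
  Leibniz rule of the bracket produces the same term with the opposite sign. This cancellation makes
  \<open>ce_d\<close> tensorial.\<close>

lemma ce_d_scale:
  assumes f: "f \<in> smooth_funs (base (vbun A))" and X: "X \<in> \<Gamma> (vbun A)" and Y: "Y \<in> \<Gamma> (vbun A)"
  shows "ce_d A \<xi> X (\<lambda>q. f q *\<^sub>R Y q) m = f m * ce_d A \<xi> X Y m"
proof -
  note sec = sectionsD(1)[OF E _ m] and sub = vector_bundleD(3)[OF E m]
  note tv = lie_algebroidD(2)[OF A m sec[OF X]]
  note fY = dual_sectionsD(2)[OF \<xi> Y]
  have "anchor A m (X m) (\<lambda>q. \<xi> q (f q *\<^sub>R Y q)) = anchor A m (X m) (\<lambda>q. f q * \<xi> q (Y q))"
    by (rule tangent_vector_cong[OF base_charted[OF E] tv dual_sectionsD(2)[OF \<xi> sections_scale[OF E f Y]]])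
      (simp add: lin_onD(2)[OF dual_sectionsD(1)[OF \<xi>]] sectionsD(1)[OF E] Y)
  also have "\<dots> = f m * anchor A m (X m) (\<lambda>q. \<xi> q (Y q)) + \<xi> m (Y m) * anchor A m (X m) f"
    by (rule tangent_vectorD(3)[OF tv f fY])
  finally show ?thesis
    using lin_onD(2)[OF \<rho>_lin[OF dual_sectionsD(2)[OF \<xi> X]] sec[OF Y], of "f m"]
      lin_onD(1)[OF lin subspace_scale[OF sub sec[OF lie_algebroidD(5)[OF A X Y]], of "f m"]
        subspace_scale[OF sub sec[OF Y], of "anchor A m (X m) f"]]
      lin_onD(2)[OF lin sec[OF lie_algebroidD(5)[OF A X Y]], of "f m"]
      lin_onD(2)[OF lin sec[OF Y], of "anchor A m (X m) f"]
    by (simp add: ce_d_def lie_algebroidD(8)[OF A X Y f] algebra_simps)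
qed

lemma ce_d_cong:
  assumes X: "X \<in> \<Gamma> (vbun A)" "X' \<in> \<Gamma> (vbun A)" "X m = X' m"
    and Y: "Y \<in> \<Gamma> (vbun A)" "Y' \<in> \<Gamma> (vbun A)" "Y m = Y' m"
  shows "ce_d A \<xi> X Y m = ce_d A \<xi> X' Y' m"
proof -
  have *: "ce_d A \<xi> X Y m = ce_d A \<xi> X Y' m"
    if "X \<in> \<Gamma> (vbun A)" "Y \<in> \<Gamma> (vbun A)" "Y' \<in> \<Gamma> (vbun A)" "Y m = Y' m" for X Y Y'
    by (rule tensorial_cong[OF E m, of "\<lambda>Y. ce_d A \<xi> X Y m"]) (use that ce_d_add ce_d_scale in auto)
  have "ce_d A \<xi> X Y m = ce_d A \<xi> X Y' m" by (rule * [OF X(1) Y])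
  also have "\<dots> = - ce_d A \<xi> Y' X m" by (rule ce_d_antisym[OF X(1) Y(2)])
  also have "\<dots> = - ce_d A \<xi> Y' X' m" using *[OF Y(2) X] by simp
  also have "\<dots> = ce_d A \<xi> X' Y' m" using ce_d_antisym[OF X(2) Y(2)] by simp
  finally show ?thesis .
qed

lemma ce_d_sum_list_right:
  assumes X: "X \<in> \<Gamma> (vbun A)" and "\<And>y. y \<in> set ys \<Longrightarrow> s y \<in> \<Gamma> (vbun A)"
  shows "ce_d A \<xi> X (\<lambda>q. \<Sum>y\<leftarrow>ys. c y *\<^sub>R s y q) m = (\<Sum>y\<leftarrow>ys. c y * ce_d A \<xi> X (s y) m)"
  using assms(2)
proof (induction ys)
  case Nil
  show ?case using ce_d_scale[OF smooth_funs_const X sections_0[OF E], of 0] by simp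
next
  case (Cons y ys)
  have "(\<lambda>q. \<Sum>y\<leftarrow>ys. c y *\<^sub>R s y q) \<in> \<Gamma> (vbun A)"
    using Cons.prems by (intro sections_sum_list[OF E] sections_scale[OF E smooth_funs_const]) auto
  then show ?case
    using Cons by (simp add: ce_d_add[OF X] ce_d_scale[OF smooth_funs_const X] sections_scale[OF E smooth_funs_const])
qed

text \<open>The coefficients are constants because decompositions enter the bracket identity with
  their coefficient functions frozen at one point. Antisymmetry takes care of the first
  argument.\<close>

lemma ce_d_sum_list:
  assumes X: "\<And>x. x \<in> set xs \<Longrightarrow> r x \<in> \<Gamma> (vbun A)" and Y: "\<And>y. y \<in> set ys \<Longrightarrow> s y \<in> \<Gamma> (vbun A)"
  shows "ce_d A \<xi> (\<lambda>q. \<Sum>x\<leftarrow>xs. b x *\<^sub>R r x q) (\<lambda>q. \<Sum>y\<leftarrow>ys. c y *\<^sub>R s y q) m =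
    (\<Sum>x\<leftarrow>xs. \<Sum>y\<leftarrow>ys. (b x * c y) * ce_d A \<xi> (r x) (s y) m)"
proof -
  let ?Y = "\<lambda>q. \<Sum>y\<leftarrow>ys. c y *\<^sub>R s y q" and ?X = "\<lambda>q. \<Sum>x\<leftarrow>xs. b x *\<^sub>R r x q"
  have Y': "?Y \<in> \<Gamma> (vbun A)"
    using Y by (intro sections_sum_list[OF E] sections_scale[OF E smooth_funs_const]) auto
  have X': "?X \<in> \<Gamma> (vbun A)"
    using X by (intro sections_sum_list[OF E] sections_scale[OF E smooth_funs_const]) auto
  have "ce_d A \<xi> ?X ?Y m = - (\<Sum>x\<leftarrow>xs. b x * ce_d A \<xi> ?Y (r x) m)"
    using ce_d_antisym[OF X' Y'] ce_d_sum_list_right[OF Y' X] by simp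
  also have "\<dots> = (\<Sum>x\<leftarrow>xs. b x * ce_d A \<xi> (r x) ?Y m)"
    unfolding uminus_sum_list_map o_def
    using ce_d_antisym[OF Y' X] by (intro arg_cong[where f = sum_list] map_cong) auto
  also have "\<dots> = (\<Sum>x\<leftarrow>xs. \<Sum>y\<leftarrow>ys. (b x * c y) * ce_d A \<xi> (r x) (s y) m)"
    using X by (intro arg_cong[where f = sum_list] map_cong)
      (auto simp: ce_d_sum_list_right[OF _ Y] sum_list_const_mult[symmetric] mult.assoc)
  finally show ?thesis .
qed

end

lemma sum_list_swap:
  fixes f :: "'x \<Rightarrow> 'y \<Rightarrow> 'c::comm_monoid_add"
  shows "(\<Sum>x\<leftarrow>xs. \<Sum>y\<leftarrow>ys. f x y) = (\<Sum>y\<leftarrow>ys. \<Sum>x\<leftarrow>xs. f x y)"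
  by (induction xs) (simp_all add: sum_list_addf)

lemma sum_list_cong: "(\<And>x. x \<in> set xs \<Longrightarrow> f x = g x) \<Longrightarrow> (\<Sum>x\<leftarrow>xs. f x) = (\<Sum>x\<leftarrow>xs. g x)"
  by (induction xs) auto

lemma lin_on_combination:
  fixes f :: "'v::real_vector \<Rightarrow> real"
  assumes f: "lin_on S f" and S: "subspace S" and s: "\<And>x. x \<in> set xs \<Longrightarrow> s x \<in> S"
  shows "f (\<Sum>x\<leftarrow>xs. c x *\<^sub>R s x) = (\<Sum>x\<leftarrow>xs. c x * f (s x))"
proof -
  have "f (\<Sum>x\<leftarrow>xs. c x *\<^sub>R s x) = (\<Sum>x\<leftarrow>xs. f (c x *\<^sub>R s x))"
    by (rule lin_on_sum_list(1)[OF f S subspace_scale[OF S s]])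
  also have "\<dots> = (\<Sum>x\<leftarrow>xs. c x * f (s x))"
    by (rule sum_list_cong) (simp add: lin_onD(2)[OF f s])
  finally show ?thesis .
qed

section \<open>Lie algebroid morphisms through the differential of forms\<close>

definition pullback_form ::
  "('m \<Rightarrow> 'n) \<Rightarrow> ('m \<times> 'v \<Rightarrow> 'n \<times> 'w) \<Rightarrow> ('n \<Rightarrow> 'w \<Rightarrow> real) \<Rightarrow> 'm \<Rightarrow> 'v \<Rightarrow> real" where
  "pullback_form f G \<xi> m e = \<xi> (f m) (snd (G (m, e)))"

lemma pullback_form_dual:
  assumes E: "vector_bundle E" and E': "vector_bundle E'" and G: "vb_morphism E E' f G"
    and \<xi>: "\<xi> \<in> dual_sections E'"
  shows "pullback_form f G \<xi> \<in> dual_sections E"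
proof -
  note vb = vb_morphismD[OF G]
  have "lin_on (fibre E m) (pullback_form f G \<xi> m)" if m: "m \<in> points (base E)" for m
    using lin_onD[OF dual_sectionsD(1)[OF \<xi> vb(6)[OF m]]] lin_onD[OF vb(4)[OF m]] vb(5)[OF m]
    by (auto simp: lin_on_def pullback_form_def)
  moreover have "(\<lambda>m. pullback_form f G \<xi> m (s m)) \<in> smooth_funs (base E)" if s: "s \<in> \<Gamma> E" for s
  proof -
    have "(\<lambda>m. \<xi> (fst (G (m, s m))) (snd (G (m, s m)))) \<in> smooth_funs (base E)"
      using smooth_funs_pullback[OF base_charted[OF E] total_charted[OF E] sectionsD(4)[OF E s]
        smooth_funs_dual_along[OF E' \<xi> total_charted[OF E] vb(2)]] .
    then show ?thesis
      by (rule smooth_funs_cong[OF base_charted[OF E]])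
        (simp add: vb(3) sectionsD(1)[OF E s] pullback_form_def)
  qed
  ultimately show ?thesis by (simp add: dual_sections_def)
qed

text \<open>The anchor clause of \<open>la_morphism\<close>, split off because the dual form of the
  bracket clause is derived from it.\<close>

definition anchor_compatible ::
  "('m, 'e::euclidean_space, 'v::real_vector, 'f::euclidean_space) lie_algd \<Rightarrow>
   ('n, 'k::euclidean_space, 'w::real_vector, 'g::euclidean_space) lie_algd \<Rightarrow>
   ('m \<Rightarrow> 'n) \<Rightarrow> ('m \<times> 'v \<Rightarrow> 'n \<times> 'w) \<Rightarrow> bool" where
  "anchor_compatible A A' f G \<longleftrightarrow>
     (\<forall>m\<in>points (base (vbun A)). \<forall>e\<in>fibre (vbun A) m.
        tv_eq (base (vbun A')) (anchor A' (f m) (snd (G (m, e)))) (pushforward f (anchor A m e)))"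

lemma anchor_compatibleD:
  assumes "anchor_compatible A A' f G" "m \<in> points (base (vbun A))" "e \<in> fibre (vbun A) m"
    "g \<in> smooth_funs (base (vbun A'))"
  shows "anchor A m e (\<lambda>q. g (f q)) = anchor A' (f m) (snd (G (m, e))) g"
  using assms by (auto simp: anchor_compatible_def tv_eq_def pushforward_def o_def)

context
  fixes A :: "('m, 'e::euclidean_space, 'v::real_vector, 'f::euclidean_space) lie_algd"
    and A' :: "('n, 'k::euclidean_space, 'w::real_vector, 'g::euclidean_space) lie_algd"
    and f G
  assumes A: "lie_algebroid A" and A': "lie_algebroid A'"
    and vb: "vb_morphism (vbun A) (vbun A') f G" and ac: "anchor_compatible A A' f G"
begin

private lemmas eA = lie_algebroidD(1)[OF A]
private lemmas eA' = lie_algebroidD(1)[OF A']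

text \<open>The pulled-back pairing is a sum of products of a function v with some \<xi>(Y') along
  f. The Leibniz rule splits off the derivatives of v; anchor compatibility moves the derivative of
  the other factor to A', where the image of X is expanded by \<open>ds\<close>.\<close>

private lemma anchor_pullback_form:
  assumes \<xi>: "\<xi> \<in> dual_sections (vbun A')" and m: "m \<in> points (base (vbun A))"
    and X: "X \<in> \<Gamma> (vbun A)" and Y: "Y \<in> \<Gamma> (vbun A)"
    and ds: "decomposes (vbun A) (vbun A') f G X ds" and es: "decomposes (vbun A) (vbun A') f G Y es"
  shows "anchor A m (X m) (\<lambda>q. pullback_form f G \<xi> q (Y q)) =
    (\<Sum>x\<leftarrow>ds. \<Sum>y\<leftarrow>es. (fst x m * fst y m) * anchor A' (f m) (snd x (f m)) (\<lambda>p. \<xi> p (snd y p))) +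
    (\<Sum>y\<leftarrow>es. anchor A m (X m) (fst y) * \<xi> (f m) (snd y (f m)))"
proof -
  have fm: "f m \<in> points (base (vbun A'))" using vb_morphismD(6)[OF vb m] .
  have ds': "fst x \<in> smooth_funs (base (vbun A))" "snd x \<in> \<Gamma> (vbun A')" if "x \<in> set ds" for x
    using ds that by (auto simp: decomposes_def)
  have es': "fst y \<in> smooth_funs (base (vbun A))" "snd y \<in> \<Gamma> (vbun A')" if "y \<in> set es" for y
    using es that by (auto simp: decomposes_def)
  note tv = lie_algebroidD(2)[OF A m sectionsD(1)[OF eA X m]]
  have \<xi>f: "(\<lambda>q. \<xi> (f q) (s (f q))) \<in> smooth_funs (base (vbun A))" if "s \<in> \<Gamma> (vbun A')" for s
    using smooth_funs_pullback[OF base_charted[OF eA] base_charted[OF eA'] vb_morphismD(1)[OF vb] dual_sectionsD(2)[OF \<xi> that]] .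
  have "anchor A m (X m) (\<lambda>q. pullback_form f G \<xi> q (Y q)) =
      anchor A m (X m) (\<lambda>q. \<Sum>y\<leftarrow>es. fst y q * \<xi> (f q) (snd y (f q)))"
  proof (rule tangent_vector_cong[OF base_charted[OF eA] tv dual_sectionsD(2)[OF pullback_form_dual[OF eA eA' vb \<xi>] Y]])
    fix q assume q: "q \<in> points (base (vbun A))"
    have fq: "f q \<in> points (base (vbun A'))" using vb_morphismD(6)[OF vb q] .
    have "snd (G (q, Y q)) = (\<Sum>y\<leftarrow>es. fst y q *\<^sub>R snd y (f q))"
      using es q by (simp add: decomposes_def case_prod_unfold)
    then have "pullback_form f G \<xi> q (Y q) = \<xi> (f q) (\<Sum>y\<leftarrow>es. fst y q *\<^sub>R snd y (f q))"
      by (simp add: pullback_form_def)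
    also have "\<dots> = (\<Sum>y\<leftarrow>es. \<xi> (f q) (fst y q *\<^sub>R snd y (f q)))"
      by (rule lin_on_sum_list(1)[OF dual_sectionsD(1)[OF \<xi> fq] vector_bundleD(3)[OF eA' fq]])
        (rule subspace_scale[OF vector_bundleD(3)[OF eA' fq] sectionsD(1)[OF eA' es'(2) fq]])
    also have "\<dots> = (\<Sum>y\<leftarrow>es. fst y q * \<xi> (f q) (snd y (f q)))"
      by (rule sum_list_cong) (simp add: lin_onD(2)[OF dual_sectionsD(1)[OF \<xi> fq]] sectionsD(1)[OF eA' es'(2) fq])
    finally show "pullback_form f G \<xi> q (Y q) = (\<Sum>y\<leftarrow>es. fst y q * \<xi> (f q) (snd y (f q)))" .
  qed
  also have "\<dots> = (\<Sum>y\<leftarrow>es. anchor A m (X m) (\<lambda>q. fst y q * \<xi> (f q) (snd y (f q))))"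
    by (rule tangent_vector_sum_list[OF tv]) (intro smooth_funs_mult es' \<xi>f)
  also have "\<dots> = (\<Sum>y\<leftarrow>es. (\<Sum>x\<leftarrow>ds. (fst x m * fst y m) * anchor A' (f m) (snd x (f m)) (\<lambda>p. \<xi> p (snd y p)))
      + anchor A m (X m) (fst y) * \<xi> (f m) (snd y (f m)))"
  proof (rule sum_list_cong)
    fix y assume y: "y \<in> set es"
    let ?g = "\<lambda>p. \<xi> p (snd y p)"
    note g = dual_sectionsD(2)[OF \<xi> es'(2)[OF y]]
    have lin: "lin_on (fibre (vbun A') (f m)) (\<lambda>e. anchor A' (f m) e ?g)" by (rule lie_algebroidD(3)[OF A' fm g])
    have "anchor A m (X m) (\<lambda>q. \<xi> (f q) (snd y (f q))) = anchor A' (f m) (snd (G (m, X m))) ?g"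
      using anchor_compatibleD[OF ac m sectionsD(1)[OF eA X m] g] .
    also have "snd (G (m, X m)) = (\<Sum>x\<leftarrow>ds. fst x m *\<^sub>R snd x (f m))"
      using ds m by (simp add: decomposes_def case_prod_unfold)
    also have "anchor A' (f m) \<dots> ?g = (\<Sum>x\<leftarrow>ds. anchor A' (f m) (fst x m *\<^sub>R snd x (f m)) ?g)"
      by (rule lin_on_sum_list(1)[OF lin vector_bundleD(3)[OF eA' fm]])
        (rule subspace_scale[OF vector_bundleD(3)[OF eA' fm] sectionsD(1)[OF eA' ds'(2) fm]])
    also have "\<dots> = (\<Sum>x\<leftarrow>ds. fst x m * anchor A' (f m) (snd x (f m)) ?g)"
      by (rule sum_list_cong) (simp add: lin_onD(2)[OF lin] sectionsD(1)[OF eA' ds'(2) fm])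
    finally show "anchor A m (X m) (\<lambda>q. fst y q * \<xi> (f q) (snd y (f q))) =
      (\<Sum>x\<leftarrow>ds. (fst x m * fst y m) * anchor A' (f m) (snd x (f m)) ?g)
      + anchor A m (X m) (fst y) * \<xi> (f m) (snd y (f m))"
      using tangent_vectorD(3)[OF tv es'(1)[OF y] \<xi>f[OF es'(2)[OF y]]]
      by (simp add: sum_list_const_mult[symmetric] mult_ac)
  qed
  also have "\<dots> = (\<Sum>x\<leftarrow>ds. \<Sum>y\<leftarrow>es. (fst x m * fst y m) * anchor A' (f m) (snd x (f m)) (\<lambda>p. \<xi> p (snd y p))) +
    (\<Sum>y\<leftarrow>es. anchor A m (X m) (fst y) * \<xi> (f m) (snd y (f m)))"
    by (simp add: sum_list_addf sum_list_swap[of _ es ds])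
  finally show ?thesis .
qed

text \<open>The derivatives of u and v in R are those that the Leibniz rule produces on the left,
  while the sections on the right have frozen coefficients and produce none. Hence the bracket
  equation paired with \<xi> holds exactly when the two differentials agree.\<close>

private lemma bracket_identity:
  assumes \<xi>: "\<xi> \<in> dual_sections (vbun A')" and m: "m \<in> points (base (vbun A))"
    and X: "X \<in> \<Gamma> (vbun A)" and Y: "Y \<in> \<Gamma> (vbun A)"
    and ds: "decomposes (vbun A) (vbun A') f G X ds" and es: "decomposes (vbun A) (vbun A') f G Y es"
    and R: "R = (\<Sum>(u, X')\<leftarrow>ds. \<Sum>(v, Y')\<leftarrow>es. (u m * v m) *\<^sub>R bracket A' X' Y' (f m))
            + (\<Sum>(v, Y')\<leftarrow>es. anchor A m (X m) v *\<^sub>R Y' (f m))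
            - (\<Sum>(u, X')\<leftarrow>ds. anchor A m (Y m) u *\<^sub>R X' (f m))"
  shows "ce_d A (pullback_form f G \<xi>) X Y m + \<xi> (f m) (snd (G (m, bracket A X Y m))) =
      ce_d A' \<xi> (\<lambda>q. \<Sum>x\<leftarrow>ds. fst x m *\<^sub>R snd x q) (\<lambda>q. \<Sum>y\<leftarrow>es. fst y m *\<^sub>R snd y q) (f m) + \<xi> (f m) R"
    and "R \<in> fibre (vbun A') (f m)"
proof -
  have fm: "f m \<in> points (base (vbun A'))" using vb_morphismD(6)[OF vb m] .
  have ds': "snd x \<in> \<Gamma> (vbun A')" if "x \<in> set ds" for x
    using ds that by (auto simp: decomposes_def)
  have es': "snd y \<in> \<Gamma> (vbun A')" if "y \<in> set es" for y
    using es that by (auto simp: decomposes_def)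
  note sub = vector_bundleD(3)[OF eA' fm] and lin = dual_sectionsD(1)[OF \<xi> fm]
  define R1 where "R1 = (\<Sum>x\<leftarrow>ds. \<Sum>y\<leftarrow>es. (fst x m * fst y m) *\<^sub>R bracket A' (snd x) (snd y) (f m))"
  define R2 where "R2 = (\<Sum>y\<leftarrow>es. anchor A m (X m) (fst y) *\<^sub>R snd y (f m))"
  define R3 where "R3 = (\<Sum>x\<leftarrow>ds. anchor A m (Y m) (fst x) *\<^sub>R snd x (f m))"
  have R': "R = R1 + R2 - R3" by (simp add: R R1_def R2_def R3_def case_prod_unfold)
  have br: "bracket A' (snd x) (snd y) (f m) \<in> fibre (vbun A') (f m)" if "x \<in> set ds" "y \<in> set es" for x y
    by (rule sectionsD(1)[OF eA' lie_algebroidD(5)[OF A' ds'[OF that(1)] es'[OF that(2)]] fm])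
  have s: "snd x (f m) \<in> fibre (vbun A') (f m)" if "x \<in> set ds \<union> set es" for x
    using that sectionsD(1)[OF eA' _ fm] ds' es' by blast
  have mem1: "(\<Sum>y\<leftarrow>es. (fst x m * fst y m) *\<^sub>R bracket A' (snd x) (snd y) (f m)) \<in> fibre (vbun A') (f m)"
    if "x \<in> set ds" for x
    by (rule lin_on_sum_list(2)[OF sub subspace_scale[OF sub br[OF that]]])
  have "R1 \<in> fibre (vbun A') (f m)"
    unfolding R1_def by (rule lin_on_sum_list(2)[OF sub mem1])
  moreover have "R2 \<in> fibre (vbun A') (f m)"
    unfolding R2_def by (rule lin_on_sum_list(2)[OF sub subspace_scale[OF sub s]]) blast
  moreover have "R3 \<in> fibre (vbun A') (f m)"
    unfolding R3_def by (rule lin_on_sum_list(2)[OF sub subspace_scale[OF sub s]]) blast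
  ultimately have mem: "R1 \<in> fibre (vbun A') (f m)" "R2 \<in> fibre (vbun A') (f m)" "R3 \<in> fibre (vbun A') (f m)" .
  then show "R \<in> fibre (vbun A') (f m)" by (simp add: R' subspace_add[OF sub] subspace_diff[OF sub])
  have "\<xi> (f m) R1 = (\<Sum>x\<leftarrow>ds. \<xi> (f m) (\<Sum>y\<leftarrow>es. (fst x m * fst y m) *\<^sub>R bracket A' (snd x) (snd y) (f m)))"
    unfolding R1_def by (rule lin_on_sum_list(1)[OF lin sub mem1])
  also have "\<dots> = (\<Sum>x\<leftarrow>ds. \<Sum>y\<leftarrow>es. (fst x m * fst y m) * \<xi> (f m) (bracket A' (snd x) (snd y) (f m)))"
    by (rule sum_list_cong) (rule lin_on_combination[OF lin sub br])
  finally have \<xi>R1: "\<xi> (f m) R1 = (\<Sum>x\<leftarrow>ds. \<Sum>y\<leftarrow>es. (fst x m * fst y m) * \<xi> (f m) (bracket A' (snd x) (snd y) (f m)))" .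
  have \<xi>R2: "\<xi> (f m) R2 = (\<Sum>y\<leftarrow>es. anchor A m (X m) (fst y) * \<xi> (f m) (snd y (f m)))"
    unfolding R2_def by (rule lin_on_combination[OF lin sub s]) blast
  have \<xi>R3: "\<xi> (f m) R3 = (\<Sum>x\<leftarrow>ds. anchor A m (Y m) (fst x) * \<xi> (f m) (snd x (f m)))"
    unfolding R3_def by (rule lin_on_combination[OF lin sub s]) blast
  have \<xi>R: "\<xi> (f m) R = \<xi> (f m) R1 + \<xi> (f m) R2 - \<xi> (f m) R3"
    using mem by (simp add: R' lin_on_diff[OF lin sub] lin_onD(1)[OF lin] subspace_add[OF sub])
  let ?c = "\<lambda>x y. fst x m * fst y m" and ?\<rho> = "\<lambda>x y. anchor A' (f m) (snd x (f m)) (\<lambda>p. \<xi> p (snd y p))"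
  have "ce_d A' \<xi> (\<lambda>q. \<Sum>x\<leftarrow>ds. fst x m *\<^sub>R snd x q) (\<lambda>q. \<Sum>y\<leftarrow>es. fst y m *\<^sub>R snd y q) (f m)
      = (\<Sum>x\<leftarrow>ds. \<Sum>y\<leftarrow>es. ?c x y * ce_d A' \<xi> (snd x) (snd y) (f m))"
    by (rule ce_d_sum_list[OF A' \<xi> fm ds' es'])
  also have "\<dots> = (\<Sum>x\<leftarrow>ds. \<Sum>y\<leftarrow>es. ?c x y * ?\<rho> x y) - (\<Sum>x\<leftarrow>ds. \<Sum>y\<leftarrow>es. ?c x y * ?\<rho> y x)
      - (\<Sum>x\<leftarrow>ds. \<Sum>y\<leftarrow>es. ?c x y * \<xi> (f m) (bracket A' (snd x) (snd y) (f m)))"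
    by (simp add: ce_d_def right_diff_distrib sum_list_subtractf)
  finally show "ce_d A (pullback_form f G \<xi>) X Y m + \<xi> (f m) (snd (G (m, bracket A X Y m))) =
      ce_d A' \<xi> (\<lambda>q. \<Sum>x\<leftarrow>ds. fst x m *\<^sub>R snd x q) (\<lambda>q. \<Sum>y\<leftarrow>es. fst y m *\<^sub>R snd y q) (f m) + \<xi> (f m) R"
    unfolding \<xi>R \<xi>R1 \<xi>R2 \<xi>R3
    using anchor_pullback_form[OF \<xi> m X Y ds es] anchor_pullback_form[OF \<xi> m Y X es ds]
    by (simp add: ce_d_def pullback_form_def mult.commute sum_list_swap[of _ es ds])
qed

text \<open>The bracket clause says nothing about an X without a decomposition. A local dual basis
  of A' near \<open>f m\<close>, pulled back along f, decomposes \<kappa> X, and this agrees with X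
  at m, which is all that a tensorial expression sees.\<close>

lemma cutoff_decomposition:
  assumes m: "m \<in> points (base (vbun A))"
  obtains \<kappa> where "\<kappa> \<in> smooth_funs (base (vbun A))" "\<kappa> m = 1"
    "\<And>X. X \<in> \<Gamma> (vbun A) \<Longrightarrow> \<exists>ds. decomposes (vbun A) (vbun A') f G (\<lambda>q. \<kappa> q *\<^sub>R X q) ds"
proof -
  have fm: "f m \<in> points (base (vbun A'))" using vb_morphismD(6)[OF vb m] .
  obtain \<kappa> ps where ps: "\<kappa> \<in> smooth_funs (base (vbun A'))" "\<kappa> (f m) = 1"
    "set ps \<subseteq> dual_sections (vbun A') \<times> \<Gamma> (vbun A')"
    "\<And>m x. m \<in> points (base (vbun A')) \<Longrightarrow> x \<in> fibre (vbun A') m \<Longrightarrow> \<kappa> m *\<^sub>R x = (\<Sum>(\<psi>, e)\<leftarrow>ps. \<psi> m x *\<^sub>R e m)"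
    by (rule local_dual_basis[OF eA' fm]) blast
  have \<kappa>: "(\<lambda>q. \<kappa> (f q)) \<in> smooth_funs (base (vbun A))"
    by (rule smooth_funs_pullback[OF base_charted[OF eA] base_charted[OF eA'] vb_morphismD(1)[OF vb] ps(1)])
  have "decomposes (vbun A) (vbun A') f G (\<lambda>q. \<kappa> (f q) *\<^sub>R X q)
      (map (\<lambda>x. (\<lambda>q. pullback_form f G (fst x) q (X q), snd x)) ps)" if X: "X \<in> \<Gamma> (vbun A)" for X
    unfolding decomposes_def
  proof (intro conjI ballI)
    show "set (map (\<lambda>x. (\<lambda>q. pullback_form f G (fst x) q (X q), snd x)) ps)
        \<subseteq> smooth_funs (base (vbun A)) \<times> \<Gamma> (vbun A')"
      using ps(3) dual_sectionsD(2)[OF pullback_form_dual[OF eA eA' vb] X] by auto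
    fix q assume q: "q \<in> points (base (vbun A))"
    note Xq = sectionsD(1)[OF eA X q]
    have "snd (G (q, \<kappa> (f q) *\<^sub>R X q)) = \<kappa> (f q) *\<^sub>R snd (G (q, X q))"
      using lin_onD(2)[OF vb_morphismD(4)[OF vb q] Xq] by simp
    also have "\<dots> = (\<Sum>x\<leftarrow>ps. fst x (f q) (snd (G (q, X q))) *\<^sub>R snd x (f q))"
      using ps(4)[OF vb_morphismD(6)[OF vb q] vb_morphismD(5)[OF vb q Xq]] by (simp add: case_prod_unfold)
    finally show "snd (G (q, \<kappa> (f q) *\<^sub>R X q)) =
      (\<Sum>(u, X')\<leftarrow>map (\<lambda>x. (\<lambda>q. pullback_form f G (fst x) q (X q), snd x)) ps. u q *\<^sub>R X' (f q))"
      by (simp add: o_def pullback_form_def)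
  qed
  then show thesis using that[of "\<lambda>q. \<kappa> (f q)"] \<kappa> ps(2) by blast
qed

text \<open>
  Pairing the bracket condition with \<open>\<xi> \<in> \<Gamma>(A'\<^sup>*)\<close> turns it into \<open>d (G\<^sup>*\<xi>) = G\<^sup>* (d \<xi>)\<close>, where no
  decomposition of \<open>G \<circ> X\<close> occurs; it suffices to test with forms that separate the points of each fibre.
\<close>

lemma bracket_condition_iff:
  assumes \<Xi>: "\<Xi> \<subseteq> dual_sections (vbun A')"
    and separating: "\<forall>p\<in>points (base (vbun A')). \<forall>e\<in>fibre (vbun A') p. (\<forall>\<xi>\<in>\<Xi>. \<xi> p e = 0) \<longrightarrow> e = 0"
  shows "la_morphism A A' f G \<longleftrightarrow>
    (\<forall>\<xi>\<in>\<Xi>. \<forall>X\<in>\<Gamma> (vbun A). \<forall>Y\<in>\<Gamma> (vbun A). \<forall>m\<in>points (base (vbun A)). \<forall>X'\<in>\<Gamma> (vbun A'). \<forall>Y'\<in>\<Gamma> (vbun A').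
       X' (f m) = snd (G (m, X m)) \<longrightarrow> Y' (f m) = snd (G (m, Y m)) \<longrightarrow>
       ce_d A (pullback_form f G \<xi>) X Y m = ce_d A' \<xi> X' Y' (f m))"
    (is "_ \<longleftrightarrow> ?Q")
proof -
  have sep: "e = 0" if "p \<in> points (base (vbun A'))" "e \<in> fibre (vbun A') p" "\<And>\<xi>. \<xi> \<in> \<Xi> \<Longrightarrow> \<xi> p e = 0" for p e
    using separating that by blast
  let ?R = "\<lambda>m X Y ds es. (\<Sum>(u, X')\<leftarrow>ds. \<Sum>(v, Y')\<leftarrow>es. (u m * v m) *\<^sub>R bracket A' X' Y' (f m))
            + (\<Sum>(v, Y')\<leftarrow>es. anchor A m (X m) v *\<^sub>R Y' (f m))
            - (\<Sum>(u, X')\<leftarrow>ds. anchor A m (Y m) u *\<^sub>R X' (f m))"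
  have sec: "(\<lambda>q. \<Sum>x\<leftarrow>ds. fst x m *\<^sub>R snd x q) \<in> \<Gamma> (vbun A')"
    "(\<lambda>q. \<Sum>x\<leftarrow>ds. fst x m *\<^sub>R snd x q) (f m) = snd (G (m, X m))"
    if "decomposes (vbun A) (vbun A') f G X ds" "m \<in> points (base (vbun A))" for X ds m
    using that by (auto simp: decomposes_def case_prod_unfold intro!: sections_sum_list[OF eA'] sections_scale[OF eA' smooth_funs_const])
  have la: "la_morphism A A' f G \<longleftrightarrow> (\<forall>X\<in>\<Gamma> (vbun A). \<forall>Y\<in>\<Gamma> (vbun A). \<forall>ds es.
         decomposes (vbun A) (vbun A') f G X ds \<and> decomposes (vbun A) (vbun A') f G Y es \<longrightarrow>
         (\<forall>m\<in>points (base (vbun A)). snd (G (m, bracket A X Y m)) = ?R m X Y ds es))" (is "_ \<longleftrightarrow> ?B")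
    using vb ac by (simp add: la_morphism_def anchor_compatible_def Let_def)
  show ?thesis unfolding la
  proof
    assume B: ?B
    show ?Q
    proof (intro ballI impI)
      fix \<xi> X Y m X' Y'
      assume "\<xi> \<in> \<Xi>" and X: "X \<in> \<Gamma> (vbun A)" and Y: "Y \<in> \<Gamma> (vbun A)" and m: "m \<in> points (base (vbun A))"
        and X': "X' \<in> \<Gamma> (vbun A')" "X' (f m) = snd (G (m, X m))"
        and Y': "Y' \<in> \<Gamma> (vbun A')" "Y' (f m) = snd (G (m, Y m))"
      then have \<xi>: "\<xi> \<in> dual_sections (vbun A')" using \<Xi> by blast
      have fm: "f m \<in> points (base (vbun A'))" using vb_morphismD(6)[OF vb m] .
      obtain \<kappa> where \<kappa>: "\<kappa> \<in> smooth_funs (base (vbun A))" "\<kappa> m = 1"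
        "\<And>X. X \<in> \<Gamma> (vbun A) \<Longrightarrow> \<exists>ds. decomposes (vbun A) (vbun A') f G (\<lambda>q. \<kappa> q *\<^sub>R X q) ds"
        by (rule cutoff_decomposition[OF m]) blast
      obtain ds es where ds: "decomposes (vbun A) (vbun A') f G (\<lambda>q. \<kappa> q *\<^sub>R X q) ds"
        and es: "decomposes (vbun A) (vbun A') f G (\<lambda>q. \<kappa> q *\<^sub>R Y q) es"
        using \<kappa>(3) X Y by blast
      note \<kappa>X = sections_scale[OF eA \<kappa>(1) X] and \<kappa>Y = sections_scale[OF eA \<kappa>(1) Y]
      have "snd (G (m, bracket A (\<lambda>q. \<kappa> q *\<^sub>R X q) (\<lambda>q. \<kappa> q *\<^sub>R Y q) m))
          = ?R m (\<lambda>q. \<kappa> q *\<^sub>R X q) (\<lambda>q. \<kappa> q *\<^sub>R Y q) ds es"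
        using B[rule_format, OF \<kappa>X \<kappa>Y _ m] ds es by blast
      with bracket_identity(1)[OF \<xi> m \<kappa>X \<kappa>Y ds es refl]
      have "ce_d A (pullback_form f G \<xi>) (\<lambda>q. \<kappa> q *\<^sub>R X q) (\<lambda>q. \<kappa> q *\<^sub>R Y q) m =
         ce_d A' \<xi> (\<lambda>q. \<Sum>x\<leftarrow>ds. fst x m *\<^sub>R snd x q) (\<lambda>q. \<Sum>y\<leftarrow>es. fst y m *\<^sub>R snd y q) (f m)"
        by simp
      moreover have "ce_d A (pullback_form f G \<xi>) (\<lambda>q. \<kappa> q *\<^sub>R X q) (\<lambda>q. \<kappa> q *\<^sub>R Y q) m =
          ce_d A (pullback_form f G \<xi>) X Y m"
        by (rule ce_d_cong[OF A pullback_form_dual[OF eA eA' vb \<xi>] m \<kappa>X X _ \<kappa>Y Y]) (simp_all add: \<kappa>(2))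
      moreover have "ce_d A' \<xi> (\<lambda>q. \<Sum>x\<leftarrow>ds. fst x m *\<^sub>R snd x q) (\<lambda>q. \<Sum>y\<leftarrow>es. fst y m *\<^sub>R snd y q) (f m)
          = ce_d A' \<xi> X' Y' (f m)"
        by (rule ce_d_cong[OF A' \<xi> fm sec(1)[OF ds m] X'(1) _ sec(1)[OF es m] Y'(1)])
          (simp_all add: sec(2)[OF ds m] sec(2)[OF es m] \<kappa>(2) X'(2) Y'(2))
      ultimately show "ce_d A (pullback_form f G \<xi>) X Y m = ce_d A' \<xi> X' Y' (f m)" by simp
    qed
  next
    assume Q: ?Q
    show ?B
    proof (intro ballI allI impI)
      fix X Y ds es m
      assume X: "X \<in> \<Gamma> (vbun A)" and Y: "Y \<in> \<Gamma> (vbun A)" and m: "m \<in> points (base (vbun A))"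
        and "decomposes (vbun A) (vbun A') f G X ds \<and> decomposes (vbun A) (vbun A') f G Y es"
      then have ds: "decomposes (vbun A) (vbun A') f G X ds" and es: "decomposes (vbun A) (vbun A') f G Y es"
        by auto
      have fm: "f m \<in> points (base (vbun A'))" using vb_morphismD(6)[OF vb m] .
      note sub = vector_bundleD(3)[OF eA' fm]
      let ?b = "snd (G (m, bracket A X Y m))" and ?r = "?R m X Y ds es"
      have b: "?b \<in> fibre (vbun A') (f m)"
        by (rule vb_morphismD(5)[OF vb m sectionsD(1)[OF eA lie_algebroidD(5)[OF A X Y] m]])
      \<comment> \<open>That R lies in the fibre must be known before forms can separate. The second
        claim of \<open>bracket_identity\<close> does not mention the form, so the zero form serves
        as its instance.\<close>
      have "(\<lambda>m e. 0) \<in> dual_sections (vbun A')"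
        by (simp add: dual_sections_def lin_on_def smooth_funs_const)
      note r_fibre = bracket_identity(2)[OF this m X Y ds es refl]
      have "?b - ?r = 0"
      proof (rule sep[OF fm subspace_diff[OF sub b r_fibre]])
        fix \<xi> assume \<xi>': "\<xi> \<in> \<Xi>"
        then have \<xi>: "\<xi> \<in> dual_sections (vbun A')" using \<Xi> by blast
        note r = bracket_identity[OF \<xi> m X Y ds es refl]
        have "ce_d A (pullback_form f G \<xi>) X Y m =
           ce_d A' \<xi> (\<lambda>q. \<Sum>x\<leftarrow>ds. fst x m *\<^sub>R snd x q) (\<lambda>q. \<Sum>y\<leftarrow>es. fst y m *\<^sub>R snd y q) (f m)"
          using Q[rule_format, OF \<xi>' X Y m sec(1)[OF ds m] sec(1)[OF es m] sec(2)[OF ds m] sec(2)[OF es m]] .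
        with r(1) have "\<xi> (f m) ?b = \<xi> (f m) ?r" by simp
        then show "\<xi> (f m) (?b - ?r) = 0"
          by (simp add: lin_on_diff[OF dual_sectionsD(1)[OF \<xi> fm] sub b r_fibre])
      qed
      then show "?b = ?r" by simp
    qed
  qed
qed

end

section \<open>Tangent vectors of a total space, and change of base map\<close>

lemma tangent_vector_pushforward:
  assumes N: "charted N" and N': "charted N'" and f: "smooth_map N N' f" and v: "tangent_vector N p v"
  shows "tangent_vector N' (f p) (pushforward f v)"
proof -
  note pull = smooth_funs_pullback[OF N N' f]
  show ?thesis
    unfolding tangent_vector_def pushforward_def o_def
    using smooth_mapD(1)[OF f tangent_vectorD(1)[OF v]] tangent_vectorD(2-4)[OF v] pull by simp
qed

text \<open>A chart of the total space consists of base coordinates and fibre coordinates. After a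
  cut-off by a function of the base the former are pulled back and the latter fibrewise linear, so
  the two hypotheses cover them all.\<close>

lemma tangent_vector_total_eq_0I:
  fixes E :: "('m, 'e::euclidean_space, 'v::real_vector, 'f::euclidean_space) vbundle"
  assumes E: "vector_bundle E" and N: "smooth_manifold (total E)" and u: "tangent_vector (total E) p u"
    and base: "\<And>f. f \<in> smooth_funs (base E) \<Longrightarrow> u (\<lambda>q. f (fst q)) = 0"
    and fib: "\<And>\<psi>. \<psi> \<in> dual_sections E \<Longrightarrow> u (\<ell> \<psi>) = 0"
    and g: "g \<in> smooth_funs (total E)"
  shows "u g = 0"
proof -
  note ch = base_charted[OF E] and at = base_atlas[OF E]
  have m: "fst p \<in> points (base E)" "snd p \<in> fibre E (fst p)"
    using tangent_vectorD(1)[OF u] by (auto simp: points_total)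
  obtain U \<phi> where U: "(U, \<phi>) \<in> atlas (base E)" "fst p \<in> U" using charted_cover[OF ch m(1)] .
  obtain V \<tau> where V: "(V, \<tau>) \<in> trivs E" "fst p \<in> V" using trivs_cover[OF E m(1)] .
  have Uo: "mfd_open (base E) U" using mfd_open_chart[OF at U(1) open_UNIV] by simp
  have "mfd_open (base E) (U \<inter> V)" by (rule mfd_open_Int[OF at Uo vector_bundleD(4)[OF E V(1)]])
  then obtain \<eta> K where \<eta>: "\<eta> \<in> smooth_funs (base E)" "\<eta> (fst p) = 1" "K \<subseteq> U \<inter> V"
    "mfd_open (base E) (points (base E) - K)" "\<And>q. q \<notin> K \<Longrightarrow> \<eta> q = 0"
    by (rule manifold_bump[OF vector_bundleD(1)[OF E], of _ "fst p"]) (use U V in auto)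
  have K: "K \<subseteq> U" "K \<subseteq> V" using \<eta>(3) by auto
  have f: "(\<lambda>m. \<eta> m * (\<phi> m \<bullet> i)) \<in> smooth_funs (base E)" for i
    unfolding smooth_funs_def mem_Collect_eq
  proof (rule smooth_fun_on_extend_zero[OF ch Uo \<eta>(4) K(1)])
    have "smooth_fun_on (base E) (points (base E) \<inter> U) \<phi>"
      using smooth_fun_on_subset[OF smooth_fun_on_chart[OF at U(1) smooth_on_linear[OF bounded_linear_ident, of UNIV]]]
      by auto
    moreover have "smooth_fun_on (base E) (points (base E) \<inter> U) \<eta>"
      using \<eta>(1) by (auto simp: smooth_funs_def intro: smooth_fun_on_subset)
    ultimately show "smooth_fun_on (base E) (points (base E) \<inter> U) (\<lambda>m. \<eta> m * (\<phi> m \<bullet> i))"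
      by (intro smooth_fun_on_mult smooth_fun_on_linear[OF _ bounded_linear_inner_left])
  qed (simp add: \<eta>(5))
  note pull = smooth_funs_pullback[OF total_charted[OF E] ch smooth_map_fst[OF E]]
  note form = cutoff_coordinate_form[OF E V(1) \<eta>(1) K(2) \<eta>(4,5)]
  show ?thesis
  proof (rule tangent_vector_eq_0I[OF N u atlas_totalI[OF U(1) V(1)] _ pull[OF \<eta>(1)] _ base[OF \<eta>(1)] _ _ _ g])
    show "p \<in> Sigma (U \<inter> V) (fibre E)" using U V m by (cases p) auto
    show "\<eta> (fst p) = 1" by (rule \<eta>(2))
    \<comment> \<open>The inner product with a basis vector of a product space is the sum of those
      with its two components, so one formula covers both kinds of coordinates.\<close>
    let ?y = "\<lambda>i q. \<eta> (fst q) * (\<phi> (fst q) \<bullet> fst i) + \<ell> (\<lambda>m x. \<eta> m * (\<tau> m x \<bullet> snd i)) q"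
    fix i :: "'e \<times> 'f"
    show "?y i \<in> smooth_funs (total E)" by (rule smooth_funs_add[OF pull[OF f] form(1)])
    show "u (?y i) = 0"
      using tangent_vectorD(2)[OF u pull[OF f[of "fst i"]] form(1)[of "snd i"]]
        base[OF f[of "fst i"]] fib[OF form(2)[of "snd i"]] by simp
    fix q assume "q \<in> Sigma (U \<inter> V) (fibre E)"
    show "?y i q = \<eta> (fst q) * ((case q of (m, v) \<Rightarrow> (\<phi> m, \<tau> m v)) \<bullet> i)"
      by (cases q, cases i) (simp add: lin_fun_def distrib_left)
  qed
qed

lemma vb_morphism_cong:
  assumes "vb_morphism E E' f G" "smooth_map (base E) (base E') f'" "\<And>m. m \<in> points (base E) \<Longrightarrow> f' m = f m"
  shows "vb_morphism E E' f' G"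
  using assms by (simp add: vb_morphism_def)

text \<open>A bundle map fixes its base map only on \<open>points\<close>, and base maps hidden
  under existential quantifiers have to be exchanged for known ones. The pushforwards along f and f'
  are different terms, hence the use of \<open>tangent_vector_cong\<close>.\<close>

lemma la_morphism_cong:
  assumes A: "lie_algebroid A" and A': "lie_algebroid A'" and la: "la_morphism A A' f G"
    and f': "smooth_map (base (vbun A)) (base (vbun A')) f'" and eq: "\<And>m. m \<in> points (base (vbun A)) \<Longrightarrow> f' m = f m"
  shows "la_morphism A A' f' G"
proof -
  note E = lie_algebroidD(1)[OF A] and E' = lie_algebroidD(1)[OF A']
  have vb: "vb_morphism (vbun A) (vbun A') f G" using la by (simp add: la_morphism_def Let_def)
  have "decomposes (vbun A) (vbun A') f' G X ds = decomposes (vbun A) (vbun A') f G X ds" for X ds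
    by (simp add: decomposes_def eq)
  moreover have "tv_eq (base (vbun A')) (anchor A' (f' m) (snd (G (m, e)))) (pushforward f' (anchor A m e))"
    if m: "m \<in> points (base (vbun A))" and e: "e \<in> fibre (vbun A) m" for m e
    unfolding tv_eq_def
  proof
    fix g assume g: "g \<in> smooth_funs (base (vbun A'))"
    have "anchor A' (f m) (snd (G (m, e))) g = anchor A m e (\<lambda>q. g (f q))"
      using la m e g by (auto simp: la_morphism_def Let_def tv_eq_def pushforward_def o_def)
    also have "\<dots> = anchor A m e (\<lambda>q. g (f' q))"
      by (rule tangent_vector_cong[OF base_charted[OF E] lie_algebroidD(2)[OF A m e]
            smooth_funs_pullback[OF base_charted[OF E] base_charted[OF E'] vb_morphismD(1)[OF vb] g]])
        (simp add: eq)
    finally show "anchor A' (f' m) (snd (G (m, e))) g = pushforward f' (anchor A m e) g"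
      by (simp add: eq[OF m] pushforward_def o_def)
  qed
  ultimately show ?thesis
    using la vb_morphism_cong[OF vb f' eq] by (simp add: la_morphism_def Let_def eq)
qed

lemma smooth_fun_on_Pair:
  "smooth_fun_on M W f \<Longrightarrow> smooth_fun_on M W g \<Longrightarrow> smooth_fun_on M W (\<lambda>p. (f p, g p))"
  by (auto simp: smooth_fun_on_def o_def intro: smooth_on_Pair)

lemma dual_sections_0: "(\<lambda>m e. 0) \<in> dual_sections E"
  by (simp add: dual_sections_def lin_on_def smooth_funs_const)


section \<open>Trivial double vector bundles\<close>

lemma dvb_over_B_simps:
  "base (dvb_over_B A B C) = total B"
  "fibre (dvb_over_B A B C) p = fibre A (fst p) \<times> fibre C (fst p)"
  by (simp_all add: dvb_over_B_def pullback_bundle_def direct_sum_def)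

lemma trivs_dvb_iff:
  "(X, \<theta>) \<in> trivs (dvb_over_B A B C) \<longleftrightarrow> (\<exists>U \<alpha> V \<gamma>. (U, \<alpha>) \<in> trivs A \<and> (V, \<gamma>) \<in> trivs C \<and>
     X = points (total B) \<inter> fst -` (U \<inter> V) \<and> \<theta> = (\<lambda>p (x, y). (\<alpha> (fst p) x, \<gamma> (fst p) y)))"
proof
  assume "(X, \<theta>) \<in> trivs (dvb_over_B A B C)"
  then obtain W \<tau> where W: "(W, \<tau>) \<in> trivs (A \<oplus>\<^sub>b C)" "X = points (total B) \<inter> fst -` W" "\<theta> = (\<lambda>p. \<tau> (fst p))"
    unfolding dvb_over_B_def pullback_bundle_def by auto
  moreover obtain U \<alpha> V \<gamma> where "(U, \<alpha>) \<in> trivs A" "(V, \<gamma>) \<in> trivs C" "W = U \<inter> V"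
    "\<tau> = (\<lambda>m (x, y). (\<alpha> m x, \<gamma> m y))"
    using W(1) unfolding direct_sum_def by auto
  ultimately show "\<exists>U \<alpha> V \<gamma>. (U, \<alpha>) \<in> trivs A \<and> (V, \<gamma>) \<in> trivs C \<and>
     X = points (total B) \<inter> fst -` (U \<inter> V) \<and> \<theta> = (\<lambda>p (x, y). (\<alpha> (fst p) x, \<gamma> (fst p) y))"
    by blast
next
  assume "\<exists>U \<alpha> V \<gamma>. (U, \<alpha>) \<in> trivs A \<and> (V, \<gamma>) \<in> trivs C \<and>
     X = points (total B) \<inter> fst -` (U \<inter> V) \<and> \<theta> = (\<lambda>p (x, y). (\<alpha> (fst p) x, \<gamma> (fst p) y))"
  then obtain U \<alpha> V \<gamma> where *: "(U, \<alpha>) \<in> trivs A" "(V, \<gamma>) \<in> trivs C"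
    "X = points (total B) \<inter> fst -` (U \<inter> V)" "\<theta> = (\<lambda>p (x, y). (\<alpha> (fst p) x, \<gamma> (fst p) y))"
    by blast
  then have "(U \<inter> V, \<lambda>m (x, y). (\<alpha> m x, \<gamma> m y)) \<in> trivs (A \<oplus>\<^sub>b C)"
    unfolding direct_sum_def by auto
  then have "(points (total B) \<inter> fst -` (U \<inter> V), \<lambda>p. (\<lambda>m (x, y). (\<alpha> m x, \<gamma> m y)) (fst p)) \<in> trivs (dvb_over_B A B C)"
    unfolding dvb_over_B_def pullback_bundle_def vbundle.simps mem_Collect_eq
    by (intro exI[of _ "U \<inter> V"] exI[of _ "\<lambda>m (x, y). (\<alpha> m x, \<gamma> m y)"] conjI refl)
  then show "(X, \<theta>) \<in> trivs (dvb_over_B A B C)"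
    unfolding *(3,4) .
qed

text \<open>The horizontal lift and the core section are the cases in which c or a is zero. By
  \<open>section_through\<close> every vector in a fibre of D over B is a value of a lift, so
  tensorial identities need only be checked on lifts.\<close>

definition lift ::
  "('m, 'e::euclidean_space, 'b, 'fb::euclidean_space) vbundle \<Rightarrow> ('m \<Rightarrow> 'a::real_vector) \<Rightarrow> ('m \<Rightarrow> 'c::real_vector) \<Rightarrow>
   'm \<times> 'b \<Rightarrow> 'a \<times> 'c" where
  "lift B a c = off_zero (total B) (\<lambda>p. (a (fst p), c (fst p)))"

lemma horizontal_lift_eq: "horizontal_lift B a = lift B a (\<lambda>m. 0)"
  and core_section_eq: "core_section B c = lift B (\<lambda>m. 0) c"
  by (auto simp: horizontal_lift_def core_section_def lift_def off_zero_def fun_eq_iff)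

lemma lift_apply: "p \<in> points (total B) \<Longrightarrow> lift B a c p = (a (fst p), c (fst p))"
  by (simp add: lift_def off_zero_def)

lemma lift_eq_add: "lift B a c = (\<lambda>p. horizontal_lift B a p + core_section B c p)"
  by (auto simp: horizontal_lift_def core_section_def lift_def off_zero_def fun_eq_iff)

definition sum_form :: "('m \<Rightarrow> 'a \<Rightarrow> real) \<Rightarrow> ('m \<Rightarrow> 'c \<Rightarrow> real) \<Rightarrow> 'm \<times> 'b \<Rightarrow> 'a \<times> 'c \<Rightarrow> real" where
  "sum_form \<alpha> \<gamma> p e = \<alpha> (fst p) (fst e) + \<gamma> (fst p) (snd e)"

context
  fixes A :: "('m, 'e::euclidean_space, 'a::real_vector, 'fa::euclidean_space) vbundle"
    and B :: "('m, 'e, 'b::real_vector, 'fb::euclidean_space) vbundle"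
    and C :: "('m, 'e, 'c::real_vector, 'fc::euclidean_space) vbundle"
  assumes A: "vector_bundle A" and B: "vector_bundle B" and C: "vector_bundle C"
    and base: "base B = base A" "base C = base A" and dvb: "vector_bundle (dvb_over_B A B C)"
begin

private lemmas chB = total_charted[OF B]

lemma smooth_map_fst_A: "smooth_map (total B) (base A) fst"
  and smooth_map_fst_C: "smooth_map (total B) (base C) fst"
  using smooth_map_fst[OF B] by (simp_all add: base)

lemma lift_sections:
  assumes a: "a \<in> \<Gamma> A" and c: "c \<in> \<Gamma> C"
  shows "lift B a c \<in> \<Gamma> (dvb_over_B A B C)"
proof -
  have "smooth_fun_on (total B) X (\<lambda>p. \<theta> p (lift B a c p))" if "(X, \<theta>) \<in> trivs (dvb_over_B A B C)" for X \<theta>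
  proof -
    obtain U \<alpha> V \<gamma> where *: "(U, \<alpha>) \<in> trivs A" "(V, \<gamma>) \<in> trivs C"
      "X = points (total B) \<inter> fst -` (U \<inter> V)" "\<theta> = (\<lambda>p (x, y). (\<alpha> (fst p) x, \<gamma> (fst p) y))"
      using \<open>(X, \<theta>) \<in> _\<close> unfolding trivs_dvb_iff by blast
    have "smooth_fun_on (total B) (fst -` U) (\<lambda>p. \<alpha> (fst p) (a (fst p)))"
      by (rule smooth_fun_on_pullback[OF chB base_charted[OF A] smooth_map_fst_A sectionsD(3)[OF A a *(1)]])
    moreover have "smooth_fun_on (total B) (fst -` V) (\<lambda>p. \<gamma> (fst p) (c (fst p)))"
      by (rule smooth_fun_on_pullback[OF chB base_charted[OF C] smooth_map_fst_C sectionsD(3)[OF C c *(2)]])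
    ultimately have "smooth_fun_on (total B) X (\<lambda>p. (\<alpha> (fst p) (a (fst p)), \<gamma> (fst p) (c (fst p))))"
      unfolding *(3) by (intro smooth_fun_on_Pair; elim smooth_fun_on_subset) auto
    then show ?thesis
      by (rule smooth_fun_on_cong[OF chB]) (simp add: lift_apply *(4))
  qed
  then show ?thesis
    using sectionsD(1)[OF A a] sectionsD(1)[OF C c]
    by (auto simp: sections_iff[OF dvb] dvb_over_B_simps lift_def off_zero_def points_total base)
qed

text \<open>A trivialization of D over B lives over the intersection of one for A and one for C. To
  reach all of the domain of a trivialization of one bundle, one of the other bundle is adjoined
  around each point.\<close>

lemma sections_dvb_components:
  assumes X: "X \<in> \<Gamma> (dvb_over_B A B C)"
  shows "smooth_map (total B) (total A) (\<lambda>p. (fst p, fst (X p)))"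
    and "smooth_map (total B) (total C) (\<lambda>p. (fst p, snd (X p)))"
proof -
  have fib: "fst (X p) \<in> fibre A (fst p)" "snd (X p) \<in> fibre C (fst p)" if "p \<in> points (total B)" for p
    using sectionsD(1)[OF dvb X, of p] that by (auto simp: dvb_over_B_simps)
  have *: "smooth_fun_on (total B) (points (total B) \<inter> fst -` (U \<inter> V)) (\<lambda>p. (\<alpha> (fst p) (fst (X p)), \<gamma> (fst p) (snd (X p))))"
    if "(U, \<alpha>) \<in> trivs A" "(V, \<gamma>) \<in> trivs C" for U \<alpha> V \<gamma>
  proof -
    have "(points (total B) \<inter> fst -` (U \<inter> V), \<lambda>p (x, y). (\<alpha> (fst p) x, \<gamma> (fst p) y)) \<in> trivs (dvb_over_B A B C)"
      using that unfolding trivs_dvb_iff by blast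
    from sectionsD(3)[OF dvb X this] show ?thesis by (simp add: dvb_over_B_simps case_prod_unfold)
  qed
  have open_fst: "mfd_open (total B) (points (total B) \<inter> fst -` W)" if "mfd_open (base A) W" for W
    by (rule smooth_map_preimage_open[OF chB base_charted[OF A] smooth_map_fst_A that])
  show "smooth_map (total B) (total A) (\<lambda>p. (fst p, fst (X p)))"
  proof (rule smooth_map_into_total[OF A chB smooth_map_fst_A fib(1)])
    fix U \<alpha> assume U: "(U, \<alpha>) \<in> trivs A"
    show "smooth_fun_on (total B) (fst -` U) (\<lambda>p. \<alpha> (fst p) (fst (X p)))"
    proof (rule smooth_fun_on_local[OF chB])
      fix p assume p: "p \<in> points (total B)" "p \<in> fst -` U"
      then have "fst p \<in> points (base C)" by (auto simp: points_total base)
      then obtain V \<gamma> where V: "(V, \<gamma>) \<in> trivs C" "fst p \<in> V" using trivs_cover[OF C] by blast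
      have "smooth_fun_on (total B) (fst -` U \<inter> (points (total B) \<inter> fst -` V)) (\<lambda>p. \<alpha> (fst p) (fst (X p)))"
        using smooth_fun_on_linear[OF *[OF U V(1)] bounded_linear_fst, unfolded fst_conv]
        by (rule smooth_fun_on_subset) auto
      then show "\<exists>W'. mfd_open (total B) W' \<and> p \<in> W' \<and> smooth_fun_on (total B) (fst -` U \<inter> W') (\<lambda>p. \<alpha> (fst p) (fst (X p)))"
        using open_fst[of V] vector_bundleD(4)[OF C V(1)] V(2) p by (auto simp: base)
    qed
  qed
  show "smooth_map (total B) (total C) (\<lambda>p. (fst p, snd (X p)))"
  proof (rule smooth_map_into_total[OF C chB smooth_map_fst_C fib(2)])
    fix V \<gamma> assume V: "(V, \<gamma>) \<in> trivs C"
    show "smooth_fun_on (total B) (fst -` V) (\<lambda>p. \<gamma> (fst p) (snd (X p)))"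
    proof (rule smooth_fun_on_local[OF chB])
      fix p assume p: "p \<in> points (total B)" "p \<in> fst -` V"
      then have "fst p \<in> points (base A)" by (auto simp: points_total base)
      then obtain U \<alpha> where U: "(U, \<alpha>) \<in> trivs A" "fst p \<in> U" using trivs_cover[OF A] by blast
      have "smooth_fun_on (total B) (fst -` V \<inter> (points (total B) \<inter> fst -` U)) (\<lambda>p. \<gamma> (fst p) (snd (X p)))"
        using smooth_fun_on_linear[OF *[OF U(1) V] bounded_linear_snd, unfolded snd_conv]
        by (rule smooth_fun_on_subset) auto
      then show "\<exists>W'. mfd_open (total B) W' \<and> p \<in> W' \<and> smooth_fun_on (total B) (fst -` V \<inter> W') (\<lambda>p. \<gamma> (fst p) (snd (X p)))"
        using open_fst[of U] vector_bundleD(4)[OF A U(1)] U(2) p by auto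
    qed
  qed
qed

lemma sum_form_dual:
  assumes \<alpha>: "\<alpha> \<in> dual_sections A" and \<gamma>: "\<gamma> \<in> dual_sections C"
  shows "sum_form \<alpha> \<gamma> \<in> dual_sections (dvb_over_B A B C)"
proof -
  have "lin_on (fibre A (fst p) \<times> fibre C (fst p)) (sum_form \<alpha> \<gamma> p)" if p: "p \<in> points (total B)" for p
  proof -
    have m: "fst p \<in> points (base A)" "fst p \<in> points (base C)" using p by (auto simp: points_total base)
    show ?thesis
      using lin_onD[OF dual_sectionsD(1)[OF \<alpha> m(1)]] lin_onD[OF dual_sectionsD(1)[OF \<gamma> m(2)]]
      by (auto simp: lin_on_def sum_form_def distrib_left)
  qed
  moreover have "(\<lambda>p. sum_form \<alpha> \<gamma> p (X p)) \<in> smooth_funs (total B)" if X: "X \<in> \<Gamma> (dvb_over_B A B C)" for X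
    using smooth_funs_add[OF smooth_funs_dual_along[OF A \<alpha> chB sections_dvb_components(1)[OF X]]
        smooth_funs_dual_along[OF C \<gamma> chB sections_dvb_components(2)[OF X]]]
    by (simp add: sum_form_def)
  ultimately show ?thesis by (simp add: dual_sections_def dvb_over_B_simps)
qed

lemma sum_form_separate:
  assumes p: "p \<in> points (total B)" and e: "e \<in> fibre (dvb_over_B A B C) p"
    and 0: "\<And>\<alpha> \<gamma>. \<alpha> \<in> dual_sections A \<Longrightarrow> \<gamma> \<in> dual_sections C \<Longrightarrow> sum_form \<alpha> \<gamma> p e = 0"
  shows "e = 0"
proof -
  have m: "fst p \<in> points (base A)" "fst p \<in> points (base C)" using p by (auto simp: points_total base)
  have f: "fst e \<in> fibre A (fst p)" "snd e \<in> fibre C (fst p)" using e by (auto simp: dvb_over_B_simps)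
  have "fst e = 0"
    by (rule dual_sections_separate[OF A m(1) f(1)]) (use 0[OF _ dual_sections_0] in \<open>simp add: sum_form_def\<close>)
  moreover have "snd e = 0"
    by (rule dual_sections_separate[OF C m(2) f(2)]) (use 0[OF dual_sections_0] in \<open>simp add: sum_form_def\<close>)
  ultimately show ?thesis by (simp add: prod_eq_iff)
qed

end


section \<open>VB-algebroids and their representations\<close>

lemma connectionD:
  assumes "connection A E nab" "a \<in> \<Gamma> (vbun A)"
  shows "s \<in> \<Gamma> E \<Longrightarrow> nab a s \<in> \<Gamma> E"
    "s \<in> \<Gamma> E \<Longrightarrow> t \<in> \<Gamma> E \<Longrightarrow> nab a (\<lambda>m. s m + t m) = (\<lambda>m. nab a s m + nab a t m)"
  using assms by (auto simp: connection_def)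

lemma connection_zero:
  assumes "connection A E nab" "a \<in> \<Gamma> (vbun A)" "vector_bundle E"
  shows "nab a (\<lambda>m. 0) m = 0"
  using fun_cong[OF connectionD(2)[OF assms(1,2) sections_0[OF assms(3)] sections_0[OF assms(3)]], of m] by simp

context
  fixes A :: "('m, 'e::euclidean_space, 'a::real_vector, 'fa::euclidean_space) lie_algd"
    and B :: "('m, 'e, 'b::real_vector, 'fb::euclidean_space) vbundle"
    and C :: "('m, 'e, 'c::real_vector, 'fc::euclidean_space) vbundle"
    and D :: "('m \<times> 'b, 'e \<times> 'fb, 'a \<times> 'c, 'fa \<times> 'fc) lie_algd"
    and V :: "('m, 'e, 'a, 'c, 'fc, 'b, 'fb) ruth"
  assumes vba: "vb_algebroid A B C D" and ruth: "associated_ruth A B C D V"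
begin

lemma vb_algebroid_facts:
  shows "lie_algebroid A" "vector_bundle (vbun A)" "vector_bundle B" "vector_bundle C"
    "base B = base (vbun A)" "base C = base (vbun A)" "lie_algebroid D" "vbun D = dvb_over_B (vbun A) B C"
    "vector_bundle (dvb_over_B (vbun A) B C)" "smooth_manifold (total B)" "linear_anchor A B C (anchor D)"
proof -
  show *: "lie_algebroid A" "vector_bundle B" "vector_bundle C"
    "base B = base (vbun A)" "base C = base (vbun A)" "lie_algebroid D" "vbun D = dvb_over_B (vbun A) B C"
    "linear_anchor A B C (anchor D)"
    using vba by (simp_all add: vb_algebroid_def)
  show "vector_bundle (vbun A)" by (rule lie_algebroidD(1)[OF *(1)])
  show dvb: "vector_bundle (dvb_over_B (vbun A) B C)" using lie_algebroidD(1)[OF *(6)] *(7) by simp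
  \<comment> \<open>\<open>total B\<close> is the base of D -> B, so its being a Hausdorff manifold
    is part of \<open>vector_bundle\<close>.\<close>
  show "smooth_manifold (total B)" using vector_bundleD(1)[OF dvb] by (simp add: dvb_over_B_simps)
qed

lemma associated_ruth_facts:
  shows "is_ruth A V" "deg0 V = C" "deg1 V = B" "connection A C (conn0 V)" "connection A B (conn1 V)"
    "bundle_map C B (bdry V)" "curv V \<in> hom_two_forms (vbun A) B C"
    "a \<in> \<Gamma> (vbun A) \<Longrightarrow> linear_vector_field_of A B (conn1 V) a (\<lambda>p. anchor D p (horizontal_lift B a p))"
    "c \<in> \<Gamma> C \<Longrightarrow> p \<in> points (total B) \<Longrightarrow> tv_eq (total B) (anchor D p (core_section B c p))
      (vertical_lift (apply_map (base (vbun A)) (bdry V) c) p)"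
    "c \<in> \<Gamma> C \<Longrightarrow> c' \<in> \<Gamma> C \<Longrightarrow> bracket D (core_section B c) (core_section B c') = (\<lambda>_. 0)"
    "a \<in> \<Gamma> (vbun A) \<Longrightarrow> c \<in> \<Gamma> C \<Longrightarrow>
      bracket D (horizontal_lift B a) (core_section B c) = core_section B (conn0 V a c)"
    "a \<in> \<Gamma> (vbun A) \<Longrightarrow> a' \<in> \<Gamma> (vbun A) \<Longrightarrow> bracket D (horizontal_lift B a) (horizontal_lift B a') =
      (\<lambda>p. horizontal_lift B (bracket A a a') p + hat_section B (\<lambda>m. curv V m (a m) (a' m)) p)"
proof -
  note * = ruth[unfolded associated_ruth_def Let_def]
  show r: "is_ruth A V" "deg0 V = C" "deg1 V = B" using * by blast+
  show "connection A C (conn0 V)" "connection A B (conn1 V)" "bundle_map C B (bdry V)"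
    "curv V \<in> hom_two_forms (vbun A) B C"
    using r(1) by (simp_all add: is_ruth_def Let_def r(2,3))
  show "a \<in> \<Gamma> (vbun A) \<Longrightarrow> linear_vector_field_of A B (conn1 V) a (\<lambda>p. anchor D p (horizontal_lift B a p))"
    "c \<in> \<Gamma> C \<Longrightarrow> p \<in> points (total B) \<Longrightarrow> tv_eq (total B) (anchor D p (core_section B c p))
      (vertical_lift (apply_map (base (vbun A)) (bdry V) c) p)"
    "c \<in> \<Gamma> C \<Longrightarrow> c' \<in> \<Gamma> C \<Longrightarrow> bracket D (core_section B c) (core_section B c') = (\<lambda>_. 0)"
    "a \<in> \<Gamma> (vbun A) \<Longrightarrow> c \<in> \<Gamma> C \<Longrightarrow>
      bracket D (horizontal_lift B a) (core_section B c) = core_section B (conn0 V a c)"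
    "a \<in> \<Gamma> (vbun A) \<Longrightarrow> a' \<in> \<Gamma> (vbun A) \<Longrightarrow> bracket D (horizontal_lift B a) (horizontal_lift B a') =
      (\<lambda>p. horizontal_lift B (bracket A a a') p + hat_section B (\<lambda>m. curv V m (a m) (a' m)) p)"
    using * by blast+
qed

private lemmas fA = vb_algebroid_facts(1) and vA = vb_algebroid_facts(2) and vB = vb_algebroid_facts(3)
  and vC = vb_algebroid_facts(4) and bB = vb_algebroid_facts(5) and bC = vb_algebroid_facts(6)
  and fD = vb_algebroid_facts(7) and vD = vb_algebroid_facts(8) and dvb = vb_algebroid_facts(9)
private lemmas dvb_facts = vA vB vC bB bC dvb

lemma lift_in_sections: "a \<in> \<Gamma> (vbun A) \<Longrightarrow> c \<in> \<Gamma> C \<Longrightarrow> lift B a c \<in> \<Gamma> (vbun D)"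
  unfolding vD by (rule lift_sections[OF dvb_facts])

lemma anchor_D_tangent:
  assumes "m \<in> points (base (vbun A))" "b \<in> fibre B m" "a \<in> fibre (vbun A) m" "c \<in> fibre C m"
  shows "tangent_vector (total B) (m, b) (anchor D (m, b) (a, c))"
  using lie_algebroidD(2)[OF fD, of "(m, b)" "(a, c)"] assms
  by (simp add: vD dvb_over_B_simps points_total bB)

lemma anchor_D_base:
  assumes m: "m \<in> points (base (vbun A))" and b: "b \<in> fibre B m" and a: "a \<in> fibre (vbun A) m"
    and c: "c \<in> fibre C m" and f: "f \<in> smooth_funs (base (vbun A))"
  shows "anchor D (m, b) (a, c) (\<lambda>q. f (fst q)) = anchor A m a f"
proof -
  have "tv_eq (base B) (pushforward fst (anchor D (m, b) (a, c))) (anchor A m a)"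
    using vb_algebroid_facts(11) m a b c unfolding linear_anchor_def bB by blast
  then show ?thesis using f by (simp add: tv_eq_def bB pushforward_def o_def)
qed

text \<open>The fibre point is written \<open>s m\<close> because the dual connection is known
  through its pairing with sections. The horizontal part contributes the dual connection, the core
  part the derivative at 0 of the affine function sending t to \<psi>(s + t \<partial>c).\<close>

lemma anchor_D_linear:
  assumes m: "m \<in> points (base (vbun A))" and a: "a \<in> \<Gamma> (vbun A)" and s: "s \<in> \<Gamma> B" and c: "c \<in> \<Gamma> C"
    and \<psi>: "\<psi> \<in> dual_sections B"
  shows "anchor D (m, s m) (a m, c m) (\<ell> \<psi>) =
    anchor A m (a m) (\<lambda>x. \<psi> x (s x)) - \<psi> m (conn1 V a s m) + \<psi> m (bdry V m (c m))"
proof -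
  have mB: "m \<in> points (base B)" "m \<in> points (base C)" using m by (simp_all add: bB bC)
  have sm: "s m \<in> fibre B m" and cm: "c m \<in> fibre C m" and am: "a m \<in> fibre (vbun A) m"
    using sectionsD(1)[OF vB s mB(1)] sectionsD(1)[OF vC c mB(2)] sectionsD(1)[OF vA a m] .
  have p: "(m, s m) \<in> points (total B)" using mB(1) sm by (simp add: points_total)
  note l = lin_fun_smooth[OF vB \<psi>]
  have lin: "lin_on (fibre (vbun A) m \<times> fibre C m) (\<lambda>e. anchor D (m, s m) e (\<ell> \<psi>))"
    using lie_algebroidD(3)[OF fD, of "(m, s m)" "\<ell> \<psi>"] p l by (simp add: vD dvb_over_B_simps)
  have "(a m, c m) = (a m, 0) + (0, c m)" by simp
  also have "anchor D (m, s m) \<dots> (\<ell> \<psi>) = anchor D (m, s m) (a m, 0) (\<ell> \<psi>) + anchor D (m, s m) (0, c m) (\<ell> \<psi>)"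
    by (rule lin_onD(1)[OF lin])
      (use am cm subspace_0[OF vector_bundleD(3)[OF vA m]] subspace_0[OF vector_bundleD(3)[OF vC mB(2)]] in auto)
  also have "anchor D (m, s m) (a m, 0) (\<ell> \<psi>) = anchor A m (a m) (\<lambda>x. \<psi> x (s x)) - \<psi> m (conn1 V a s m)"
  proof -
    obtain \<psi>' where \<psi>': "dual_conn_rel A B (conn1 V) a \<psi> \<psi>'"
      "\<forall>p\<in>points (total B). anchor D p (horizontal_lift B a p) (\<ell> \<psi>) = \<ell> \<psi>' p"
      using associated_ruth_facts(8)[OF a] \<psi> unfolding linear_vector_field_of_def by blast
    have "anchor D (m, s m) (a m, 0) (\<ell> \<psi>) = \<psi>' m (s m)"
      using bspec[OF \<psi>'(2) p] p by (simp add: horizontal_lift_eq lift_apply lin_fun_def)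
    then show ?thesis using \<psi>'(1) s mB(1) by (simp add: dual_conn_rel_def)
  qed
  also have "anchor D (m, s m) (0, c m) (\<ell> \<psi>) = \<psi> m (bdry V m (c m))"
  proof -
    let ?w = "bdry V m (c m)"
    have w: "?w \<in> fibre B m" using bundle_mapD(2)[OF associated_ruth_facts(6) mB(2) cm] .
    note lin = lin_onD[OF dual_sectionsD(1)[OF \<psi> mB(1)]]
    have "anchor D (m, s m) (0, c m) (\<ell> \<psi>) = deriv (\<lambda>t::real. \<psi> m (s m + t *\<^sub>R ?w)) 0"
      using associated_ruth_facts(9)[OF c p] l p m
      by (simp add: tv_eq_def core_section_eq lift_apply vertical_lift_def lin_fun_def apply_map_def off_zero_def)
    also have "(\<lambda>t::real. \<psi> m (s m + t *\<^sub>R ?w)) = (\<lambda>t. \<psi> m (s m) + t * \<psi> m ?w)"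
      using lin sm w subspace_scale[OF vector_bundleD(3)[OF vB mB(1)] w] by (simp add: fun_eq_iff)
    also have "deriv \<dots> 0 = \<psi> m ?w"
      by (rule DERIV_imp_deriv) (auto intro!: derivative_eq_intros)
    finally show ?thesis .
  qed
  finally show ?thesis by simp
qed

text \<open>The axioms give additivity of the bracket in the second argument; antisymmetry carries
  it over to the first. Core sections commute, so three brackets remain.\<close>

lemma bracket_lift:
  assumes a1: "a1 \<in> \<Gamma> (vbun A)" and c1: "c1 \<in> \<Gamma> C" and a2: "a2 \<in> \<Gamma> (vbun A)" and c2: "c2 \<in> \<Gamma> C"
    and p: "p \<in> points (total B)"
  shows "bracket D (lift B a1 c1) (lift B a2 c2) p =
    (bracket A a1 a2 (fst p),
     curv V (fst p) (a1 (fst p)) (a2 (fst p)) (snd p) + conn0 V a1 c2 (fst p) - conn0 V a2 c1 (fst p))"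
proof -
  have h: "horizontal_lift B a \<in> \<Gamma> (vbun D)" if "a \<in> \<Gamma> (vbun A)" for a
    unfolding horizontal_lift_eq by (rule lift_in_sections[OF that sections_0[OF vC]])
  have k: "core_section B c \<in> \<Gamma> (vbun D)" if "c \<in> \<Gamma> C" for c
    unfolding core_section_eq by (rule lift_in_sections[OF sections_0[OF vA] that])
  note add = lie_algebroidD(7)[OF fD] and anti = lie_algebroidD(6)[OF fD]
  have L: "lift B a c \<in> \<Gamma> (vbun D)" if "a \<in> \<Gamma> (vbun A)" "c \<in> \<Gamma> C" for a c
    using that by (rule lift_in_sections)
  have hL: "bracket D (horizontal_lift B a) (lift B a' c') p =
      bracket D (horizontal_lift B a) (horizontal_lift B a') p + bracket D (horizontal_lift B a) (core_section B c') p"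
    if "a \<in> \<Gamma> (vbun A)" "a' \<in> \<Gamma> (vbun A)" "c' \<in> \<Gamma> C" for a a' c'
    unfolding lift_eq_add[of B a' c'] using add[OF h[OF that(1)] h[OF that(2)] k[OF that(3)]] by simp
  have kL: "bracket D (core_section B c) (lift B a' c') p =
      bracket D (core_section B c) (horizontal_lift B a') p + bracket D (core_section B c) (core_section B c') p"
    if "c \<in> \<Gamma> C" "a' \<in> \<Gamma> (vbun A)" "c' \<in> \<Gamma> C" for c a' c'
    unfolding lift_eq_add[of B a' c'] using add[OF k[OF that(1)] h[OF that(2)] k[OF that(3)]] by simp
  have "bracket D (lift B a1 c1) (lift B a2 c2) p = - bracket D (lift B a2 c2) (lift B a1 c1) p"
    using fun_cong[OF anti[OF L[OF a1 c1] L[OF a2 c2]], of p] .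
  also have "bracket D (lift B a2 c2) (lift B a1 c1) p =
      bracket D (lift B a2 c2) (horizontal_lift B a1) p + bracket D (lift B a2 c2) (core_section B c1) p"
    unfolding lift_eq_add[of B a1 c1] using add[OF L[OF a2 c2] h[OF a1] k[OF c1]] by simp
  also have "- (bracket D (lift B a2 c2) (horizontal_lift B a1) p + bracket D (lift B a2 c2) (core_section B c1) p)
      = bracket D (horizontal_lift B a1) (lift B a2 c2) p + bracket D (core_section B c1) (lift B a2 c2) p"
    using fun_cong[OF anti[OF L[OF a2 c2] h[OF a1]], of p] fun_cong[OF anti[OF L[OF a2 c2] k[OF c1]], of p] by simp
  also have "\<dots> = bracket D (horizontal_lift B a1) (horizontal_lift B a2) p
      + bracket D (horizontal_lift B a1) (core_section B c2) p - bracket D (horizontal_lift B a2) (core_section B c1) p"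
    using fun_cong[OF anti[OF k[OF c1] h[OF a2]], of p] fun_cong[OF associated_ruth_facts(10)[OF c1 c2], of p]
    by (simp add: hL[OF a1 a2 c2] kL[OF c1 a2 c2])
  finally show ?thesis
    unfolding associated_ruth_facts(12)[OF a1 a2] associated_ruth_facts(11)[OF a1 c2] associated_ruth_facts(11)[OF a2 c1]
    using p by (cases p) (simp add: horizontal_lift_eq core_section_eq lift_apply hat_section_def off_zero_def)
qed

text \<open>
  The term \<open>\<theta>\<close> is there because the pullback along \<open>F\<close> of a form \<open>\<gamma>\<close> on \<open>C'\<close> contains \<open>\<gamma> \<circ> \<Phi>\<close>.
\<close>

lemma ce_d_lift:
  assumes m: "m \<in> points (base (vbun A))" and s: "s \<in> \<Gamma> B"
    and a1: "a1 \<in> \<Gamma> (vbun A)" and c1: "c1 \<in> \<Gamma> C" and a2: "a2 \<in> \<Gamma> (vbun A)" and c2: "c2 \<in> \<Gamma> C"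
    and \<alpha>: "\<alpha> \<in> dual_sections (vbun A)" and \<gamma>: "\<gamma> \<in> dual_sections C"
    and \<theta>: "\<And>a. a \<in> \<Gamma> (vbun A) \<Longrightarrow> (\<lambda>m. \<theta> m (a m)) \<in> dual_sections B"
    and \<zeta>: "\<And>m b x y. m \<in> points (base (vbun A)) \<Longrightarrow> b \<in> fibre B m \<Longrightarrow> x \<in> fibre (vbun A) m \<Longrightarrow> y \<in> fibre C m \<Longrightarrow>
      \<zeta> (m, b) (x, y) = \<alpha> m x + \<gamma> m y + \<theta> m x b"
  shows "ce_d D \<zeta> (lift B a1 c1) (lift B a2 c2) (m, s m) =
      (anchor A m (a1 m) (\<lambda>q. \<alpha> q (a2 q) + \<gamma> q (c2 q) + \<theta> q (a2 q) (s q))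
        - \<theta> m (a2 m) (conn1 V a1 s m) + \<theta> m (a2 m) (bdry V m (c1 m)))
    - (anchor A m (a2 m) (\<lambda>q. \<alpha> q (a1 q) + \<gamma> q (c1 q) + \<theta> q (a1 q) (s q))
        - \<theta> m (a1 m) (conn1 V a2 s m) + \<theta> m (a1 m) (bdry V m (c2 m)))
    - (\<alpha> m (bracket A a1 a2 m) + \<theta> m (bracket A a1 a2 m) (s m)
        + \<gamma> m (curv V m (a1 m) (a2 m) (s m) + conn0 V a1 c2 m - conn0 V a2 c1 m))"
proof -
  have mB: "m \<in> points (base B)" "m \<in> points (base C)" using m by (simp_all add: bB bC)
  have sm: "s m \<in> fibre B m" using sectionsD(1)[OF vB s mB(1)] .
  have p: "(m, s m) \<in> points (total B)" using mB(1) sm by (simp add: points_total)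
  have *: "anchor D (m, s m) (a m, c m) (\<lambda>q. \<zeta> q (lift B a' c' q)) =
      anchor A m (a m) (\<lambda>q. \<alpha> q (a' q) + \<gamma> q (c' q) + \<theta> q (a' q) (s q))
        - \<theta> m (a' m) (conn1 V a s m) + \<theta> m (a' m) (bdry V m (c m))"
    if a: "a \<in> \<Gamma> (vbun A)" and c: "c \<in> \<Gamma> C" and a': "a' \<in> \<Gamma> (vbun A)" and c': "c' \<in> \<Gamma> C" for a c a' c'
  proof -
    have am: "a m \<in> fibre (vbun A) m" and cm: "c m \<in> fibre C m"
      using sectionsD(1)[OF vA a m] sectionsD(1)[OF vC c mB(2)] .
    note tvD = anchor_D_tangent[OF m sm am cm] and tvA = lie_algebroidD(2)[OF fA m am]
    note \<theta>' = \<theta>[OF a']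
    \<comment> \<open>The pairing of \<zeta> with a lift is a function from the base plus a
      fibrewise linear one, the two kinds on which the anchor of D is known.\<close>
    let ?g = "\<lambda>q. \<alpha> q (a' q) + \<gamma> q (c' q)"
    have g: "?g \<in> smooth_funs (base (vbun A))"
      using smooth_funs_add[OF dual_sectionsD(2)[OF \<alpha> a'] dual_sectionsD(2)[OF \<gamma> c', unfolded bC]] .
    have g': "(\<lambda>q. ?g (fst q)) \<in> smooth_funs (total B)"
      using smooth_funs_pullback[OF total_charted[OF vB] base_charted[OF vA] smooth_map_fst_A[OF dvb_facts] g] .
    note l = lin_fun_smooth[OF vB \<theta>']
    have "anchor D (m, s m) (a m, c m) (\<lambda>q. \<zeta> q (lift B a' c' q)) =
        anchor D (m, s m) (a m, c m) (\<lambda>q. ?g (fst q) + \<ell> (\<lambda>m. \<theta> m (a' m)) q)"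
    proof (rule sym, rule tangent_vector_cong[OF total_charted[OF vB] tvD smooth_funs_add[OF g' l]])
      fix q assume q: "q \<in> points (total B)"
      then obtain n b where n: "q = (n, b)" "n \<in> points (base (vbun A))" "b \<in> fibre B n"
        by (auto simp: points_total bB)
      have nC: "n \<in> points (base C)" using n(2) by (simp add: bC)
      show "?g (fst q) + \<ell> (\<lambda>m. \<theta> m (a' m)) q = \<zeta> q (lift B a' c' q)"
        using \<zeta>[OF n(2,3) sectionsD(1)[OF vA a' n(2)] sectionsD(1)[OF vC c' nC]] q n(1)
        by (simp add: lift_apply lin_fun_def)
    qed
    also have "\<dots> = anchor D (m, s m) (a m, c m) (\<lambda>q. ?g (fst q)) + anchor D (m, s m) (a m, c m) (\<ell> (\<lambda>m. \<theta> m (a' m)))"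
      by (rule tangent_vectorD(2)[OF tvD g' l])
    also have "\<dots> = anchor A m (a m) ?g + (anchor A m (a m) (\<lambda>q. \<theta> q (a' q) (s q))
        - \<theta> m (a' m) (conn1 V a s m) + \<theta> m (a' m) (bdry V m (c m)))"
      by (simp only: anchor_D_base[OF m sm am cm g] anchor_D_linear[OF m a s c \<theta>'])
    also have "\<dots> = anchor A m (a m) (\<lambda>q. ?g q + \<theta> q (a' q) (s q))
        - \<theta> m (a' m) (conn1 V a s m) + \<theta> m (a' m) (bdry V m (c m))"
      using tangent_vectorD(2)[OF tvA g dual_sectionsD(2)[OF \<theta>' s, unfolded bB]] by simp
    finally show ?thesis .
  qed
  have br: "bracket A a1 a2 m \<in> fibre (vbun A) m"
    by (rule sectionsD(1)[OF vA lie_algebroidD(5)[OF fA a1 a2] m])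
  have "bracket D (lift B a1 c1) (lift B a2 c2) (m, s m) \<in> fibre (vbun D) (m, s m)"
    by (rule sectionsD(1)[OF lie_algebroidD(1)[OF fD] lie_algebroidD(5)[OF fD lift_in_sections[OF a1 c1] lift_in_sections[OF a2 c2]]])
      (simp add: vD dvb_over_B_simps p)
  then have "curv V m (a1 m) (a2 m) (s m) + conn0 V a1 c2 m - conn0 V a2 c1 m \<in> fibre C m"
    by (simp add: bracket_lift[OF a1 c1 a2 c2 p] vD dvb_over_B_simps)
  from \<zeta>[OF m sm br this] show ?thesis
    unfolding ce_d_def bracket_lift[OF a1 c1 a2 c2 p] lift_apply[OF p] fst_conv snd_conv
    using *[OF a1 c1 a2 c2] *[OF a2 c2 a1 c1] by simp
qed

end

section \<open>Morphisms\<close>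

lemma hom_one_formsD:
  assumes "\<Phi> \<in> hom_one_forms A E E'"
  shows "m \<in> points (base A) \<Longrightarrow> a \<in> fibre A m \<Longrightarrow> lin_on (fibre E m) (\<Phi> m a)"
    "m \<in> points (base A) \<Longrightarrow> a \<in> fibre A m \<Longrightarrow> e \<in> fibre E m \<Longrightarrow> \<Phi> m a e \<in> fibre E' m"
    "X \<in> \<Gamma> A \<Longrightarrow> s \<in> \<Gamma> E \<Longrightarrow> off_zero (base A) (\<lambda>m. \<Phi> m (X m) (s m)) \<in> \<Gamma> E'"
  using assms unfolding hom_one_forms_def by blast+

lemma hom_two_forms_mem:
  assumes "K \<in> hom_two_forms A E E'" "m \<in> points (base A)" "a \<in> fibre A m" "b \<in> fibre A m" "e \<in> fibre E m"
  shows "K m a b e \<in> fibre E' m"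
  using assms unfolding hom_two_forms_def by blast

context
  fixes A :: "('m, 'e::euclidean_space, 'a::real_vector, 'fa::euclidean_space) lie_algd"
    and A' :: "('m, 'e, 'a'::real_vector, 'fa'::euclidean_space) lie_algd"
    and B :: "('m, 'e, 'b::real_vector, 'fb::euclidean_space) vbundle"
    and C :: "('m, 'e, 'c::real_vector, 'fc::euclidean_space) vbundle"
    and B' :: "('m, 'e, 'b'::real_vector, 'fb'::euclidean_space) vbundle"
    and C' :: "('m, 'e, 'c'::real_vector, 'fc'::euclidean_space) vbundle"
    and D :: "('m \<times> 'b, 'e \<times> 'fb, 'a \<times> 'c, 'fa \<times> 'fc) lie_algd"
    and D' :: "('m \<times> 'b', 'e \<times> 'fb', 'a' \<times> 'c', 'fa' \<times> 'fc') lie_algd"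
    and V :: "('m, 'e, 'a, 'c, 'fc, 'b, 'fb) ruth"
    and W :: "('m, 'e, 'a', 'c', 'fc', 'b', 'fb') ruth"
    and F :: "'m \<times> 'a \<times> 'b \<times> 'c \<Rightarrow> 'm \<times> 'a' \<times> 'b' \<times> 'c'"
    and F_ver :: "'m \<Rightarrow> 'a \<Rightarrow> 'a'"
    and F_hor :: "'m \<Rightarrow> 'b \<Rightarrow> 'b'"
    and F_c :: "'m \<Rightarrow> 'c \<Rightarrow> 'c'"
    and \<Phi> :: "'m \<Rightarrow> 'a \<Rightarrow> 'b \<Rightarrow> 'c'"
  assumes base': "base (vbun A') = base (vbun A)"
    and vba: "vb_algebroid A B C D" and vba': "vb_algebroid A' B' C' D'"
    and ru: "associated_ruth A B C D V" and ru': "associated_ruth A' B' C' D' W"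
    and dm: "dvb_morphism (vbun A) B C (vbun A') B' C' id F"
    and Fv: "bundle_map (vbun A) (vbun A') F_ver" and Fh: "bundle_map B B' F_hor"
    and Fc: "bundle_map C C' F_c" and \<Phi>: "\<Phi> \<in> hom_one_forms (vbun A) B C'"
    and F: "\<And>m a b c. m \<in> points (base (vbun A)) \<Longrightarrow> a \<in> fibre (vbun A) m \<Longrightarrow> b \<in> fibre B m \<Longrightarrow> c \<in> fibre C m \<Longrightarrow>
           F (m, a, b, c) = (m, F_ver m a, F_hor m b, F_c m c + \<Phi> m a b)"
begin

private abbreviation (input) "M \<equiv> base (vbun A)"
private abbreviation (input) "H \<equiv> total_map F_hor"
private abbreviation (input) "G \<equiv> view_B F"
private abbreviation (input) "av \<equiv> apply_map M F_ver"
private abbreviation (input) "hv \<equiv> apply_map M F_hor"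
private abbreviation (input) "cv \<equiv> apply_map M F_c"
private abbreviation (input) "W' \<equiv> pullback_ruth M F_ver W"
private abbreviation (input) "ph a s \<equiv> off_zero M (\<lambda>m. \<Phi> m (a m) (s m))"
text \<open>The \<open>C'\<close>-component of the image of \<open>lift B a c\<close> along s.
  Restricting to s removes the dependence on the fibre point and leaves a section of
  \<open>C'\<close> over M.\<close>

private abbreviation (input) "cph a s c \<equiv> (\<lambda>m. cv c m + ph a s m)"

private lemmas fac = vb_algebroid_facts[OF vba ru] and fac' = vb_algebroid_facts[OF vba' ru', unfolded base']
private lemmas rf = associated_ruth_facts[OF vba ru] and rf' = associated_ruth_facts[OF vba' ru', unfolded base']

private lemma pts:
  "m \<in> points M \<Longrightarrow> m \<in> points (base B)" "m \<in> points M \<Longrightarrow> m \<in> points (base C)"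
  "m \<in> points M \<Longrightarrow> m \<in> points (base B')" "m \<in> points M \<Longrightarrow> m \<in> points (base C')"
  "m \<in> points M \<Longrightarrow> m \<in> points (base (vbun A'))"
  by (simp_all add: fac(5,6) fac'(5,6) base')

private lemma secs:
  shows "a \<in> \<Gamma> (vbun A) \<Longrightarrow> av a \<in> \<Gamma> (vbun A')"
    and "s \<in> \<Gamma> B \<Longrightarrow> hv s \<in> \<Gamma> B'"
    and "c \<in> \<Gamma> C \<Longrightarrow> cv c \<in> \<Gamma> C'"
    and "a \<in> \<Gamma> (vbun A) \<Longrightarrow> s \<in> \<Gamma> B \<Longrightarrow> ph a s \<in> \<Gamma> C'"
    and "a \<in> \<Gamma> (vbun A) \<Longrightarrow> s \<in> \<Gamma> B \<Longrightarrow> c \<in> \<Gamma> C \<Longrightarrow> cph a s c \<in> \<Gamma> C'"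
proof -
  show "a \<in> \<Gamma> (vbun A) \<Longrightarrow> av a \<in> \<Gamma> (vbun A')" by (rule apply_map_sections[OF fac(2) fac'(2) Fv])
  show "s \<in> \<Gamma> B \<Longrightarrow> hv s \<in> \<Gamma> B'" using apply_map_sections[OF fac(3) fac'(3) Fh] by (simp add: fac(5))
  show *: "c \<in> \<Gamma> C \<Longrightarrow> cv c \<in> \<Gamma> C'" using apply_map_sections[OF fac(4) fac'(4) Fc] by (simp add: fac(6))
  show **: "a \<in> \<Gamma> (vbun A) \<Longrightarrow> s \<in> \<Gamma> B \<Longrightarrow> ph a s \<in> \<Gamma> C'" by (rule hom_one_formsD(3)[OF \<Phi>])
  show "a \<in> \<Gamma> (vbun A) \<Longrightarrow> s \<in> \<Gamma> B \<Longrightarrow> c \<in> \<Gamma> C \<Longrightarrow> cph a s c \<in> \<Gamma> C'"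
    by (rule sections_add[OF fac'(4) * **])
qed

private lemma vals:
  assumes "m \<in> points M"
  shows "av a m = F_ver m (a m)" "hv s m = F_hor m (s m)" "cv c m = F_c m (c m)" "ph a s m = \<Phi> m (a m) (s m)"
  using assms by (simp_all add: apply_map_def off_zero_def)

private lemma G_eq:
  assumes "m \<in> points M" "b \<in> fibre B m" "x \<in> fibre (vbun A) m" "y \<in> fibre C m"
  shows "G ((m, b), (x, y)) = ((m, F_hor m b), (F_ver m x, F_c m y + \<Phi> m x b))"
  using F[OF assms(1,3,2,4)] by (simp add: view_B_def)

private lemma H_eq: "H (m, b) = (m, F_hor m b)"
  by (simp add: total_map_def)

private lemma vb_hor: "vb_morphism B B' id H" and vb_ver: "vb_morphism (vbun A) (vbun A') id (total_map F_ver)"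
  and vb_c: "vb_morphism C C' id (total_map F_c)"
  using Fh Fv Fc by (simp_all add: bundle_map_def)

private lemma smooth_H: "smooth_map (total B) (total B') H"
  by (rule vb_morphismD(2)[OF vb_hor])

text \<open>\<open>dvb_morphism\<close> hides the map B -> B' under an existential quantifier.
  Evaluating F at zero vectors identifies it with H on all points.\<close>

private lemma vb_D: "vb_morphism (vbun D) (vbun D') H G"
proof -
  obtain h where h: "vb_morphism (dvb_over_B (vbun A) B C) (dvb_over_B (vbun A') B' C') h G"
    using dm unfolding dvb_morphism_def by blast
  show ?thesis
    unfolding fac(8) fac'(8)
  proof (rule vb_morphism_cong[OF h])
    show "smooth_map (base (dvb_over_B (vbun A) B C)) (base (dvb_over_B (vbun A') B' C')) H"
      using smooth_H by (simp add: dvb_over_B_simps)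
    fix p assume p: "p \<in> points (base (dvb_over_B (vbun A) B C))"
    then obtain m b where mb: "p = (m, b)" "m \<in> points M" "b \<in> fibre B m"
      by (auto simp: dvb_over_B_simps points_total fac(5))
    have 0: "0 \<in> fibre (vbun A) m" "0 \<in> fibre C m"
      using subspace_0[OF vector_bundleD(3)[OF fac(2) mb(2)]] subspace_0[OF vector_bundleD(3)[OF fac(4) pts(2)[OF mb(2)]]] .
    have "fst (G ((m, b), (0, 0))) = h (m, b)"
      by (rule vb_morphismD(3)[OF h p[unfolded mb(1)]]) (use 0 in \<open>simp add: dvb_over_B_simps\<close>)
    then show "H p = h p" by (simp add: G_eq[OF mb(2,3) 0] mb(1) H_eq)
  qed
qed

private lemma vb_algebroid_morphism_iff: "vb_algebroid_morphism A B C D A' B' C' D' F \<longleftrightarrow> la_morphism D D' H G"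
proof
  assume "vb_algebroid_morphism A B C D A' B' C' D' F"
  then obtain h where h: "la_morphism D D' h G" by (auto simp: vb_algebroid_morphism_def)
  then have vb: "vb_morphism (vbun D) (vbun D') h G" by (simp add: la_morphism_def Let_def)
  show "la_morphism D D' H G"
  proof (rule la_morphism_cong[OF fac(7) fac'(7) h vb_morphismD(1)[OF vb_D]])
    fix p assume p: "p \<in> points (base (vbun D))"
    have 0: "0 \<in> fibre (vbun D) p" by (rule subspace_0[OF vector_bundleD(3)[OF lie_algebroidD(1)[OF fac(7)] p]])
    show "H p = h p" using vb_morphismD(3)[OF vb p 0] vb_morphismD(3)[OF vb_D p 0] by simp
  qed
next
  assume "la_morphism D D' H G"
  then show "vb_algebroid_morphism A B C D A' B' C' D' F"
    using dm unfolding vb_algebroid_morphism_def by blast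
qed

text \<open>
  The conditions \<open>\<phi>\<^sub>1 \<circ> \<partial> = \<partial> \<circ> \<phi>\<^sub>0\<close> and \<open>\<nabla>\<^sup>H\<^sup>o\<^sup>m\<^sub>a \<phi>\<^sub>1 = \<partial> \<circ> \<Phi>\<^sub>a\<close> appear in one anchor identity, hence the
  combined \<open>anch_defect\<close>.
\<close>

private definition anch_defect :: "('m \<Rightarrow> 'a) \<Rightarrow> ('m \<Rightarrow> 'b) \<Rightarrow> ('m \<Rightarrow> 'c) \<Rightarrow> 'm \<Rightarrow> 'b'" where
  "anch_defect a s c m = bdry W m (F_c m (c m)) - F_hor m (bdry V m (c m))
     - (hom_conn M (conn1 V) (conn1 W') a F_hor s m - bdry W m (\<Phi> m (a m) (s m)))"

private definition ver_defect :: "('m \<Rightarrow> 'a) \<Rightarrow> ('m \<Rightarrow> 'a) \<Rightarrow> 'm \<Rightarrow> 'a'" where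
  "ver_defect a b m = bracket A' (av a) (av b) m - F_ver m (bracket A a b m)"

private definition core_defect :: "('m \<Rightarrow> 'a) \<Rightarrow> ('m \<Rightarrow> 'c) \<Rightarrow> 'm \<Rightarrow> 'c'" where
  "core_defect a c m = hom_conn M (conn0 V) (conn0 W') a F_c c m - \<Phi> m (a m) (bdry V m (c m))"

private definition koszul_defect :: "('m \<Rightarrow> 'a) \<Rightarrow> ('m \<Rightarrow> 'a) \<Rightarrow> ('m \<Rightarrow> 'b) \<Rightarrow> 'm \<Rightarrow> 'c'" where
  "koszul_defect a b s m = koszul_d1 A (conn1 V) (conn0 W') \<Phi> a b s m
     - (F_c m (curv V m (a m) (b m) (s m)) - curv W' m (a m) (b m) (F_hor m (s m)))"

private lemma W'_simps: "conn0 W' a = conn0 W (av a)" "conn1 W' a = conn1 W (av a)" "bdry W' = bdry W"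
  "deg0 W' = C'" "deg1 W' = B'" "curv W' m x y = curv W m (F_ver m x) (F_ver m y)"
  by (simp_all add: pullback_ruth_def rf'(2,3))

context
  assumes ac: "anchor_compatible A A' id (total_map F_ver)"
begin

text \<open>Besides compatibility this absorbs a change of function off M: \<open>av\<close>,
  \<open>hv\<close> and \<open>cv\<close> are normalized to 0 there, the formulas for pulled-back
  forms are not.\<close>

private lemma anchor_A_eq:
  assumes m: "m \<in> points M" and a: "a \<in> \<Gamma> (vbun A)" and f: "f \<in> smooth_funs M"
    and eq: "\<And>q. q \<in> points M \<Longrightarrow> f q = g q"
  shows "anchor A' m (av a m) f = anchor A m (a m) g"
proof -
  note am = sectionsD(1)[OF fac(2) a m]
  have "anchor A m (a m) f = anchor A' m (av a m) f"
    using anchor_compatibleD[OF ac m am, of f] f by (simp add: base' total_map_def vals[OF m])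
  moreover have "anchor A m (a m) f = anchor A m (a m) g"
    by (rule tangent_vector_cong[OF base_charted[OF fac(2)] lie_algebroidD(2)[OF fac(1) m am] f eq])
  ultimately show ?thesis by simp
qed

text \<open>\<open>anchor_D_linear\<close> evaluates both anchors, on \<psi> and on its pullback
  along \<open>F_hor\<close>. The derivatives along a agree by anchor compatibility, which leaves
  \<psi> applied to a single vector.\<close>

lemma anch_identity:
  assumes m: "m \<in> points M" and a: "a \<in> \<Gamma> (vbun A)" and s: "s \<in> \<Gamma> B" and c: "c \<in> \<Gamma> C"
    and \<psi>: "\<psi> \<in> dual_sections B'"
  shows "anchor D' (m, hv s m) (av a m, cph a s c m) (\<ell> \<psi>) - anchor D (m, s m) (a m, c m) (\<lambda>q. \<ell> \<psi> (H q))
      = \<psi> m (anch_defect a s c m)"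
    and "anch_defect a s c m \<in> fibre B' m"
proof -
  let ?\<psi> = "pullback_form id H \<psi>"
  have \<psi>': "?\<psi> \<in> dual_sections B" by (rule pullback_form_dual[OF fac(3) fac'(3) vb_hor \<psi>])
  have pull: "?\<psi> q b = \<psi> q (F_hor q b)" for q b by (simp add: pullback_form_def H_eq)
  have "(\<lambda>q. \<ell> \<psi> (H q)) = \<ell> ?\<psi>"
    by (auto simp: fun_eq_iff lin_fun_def pull H_eq)
  then have 1: "anchor D (m, s m) (a m, c m) (\<lambda>q. \<ell> \<psi> (H q)) =
      anchor A m (a m) (\<lambda>x. \<psi> x (F_hor x (s x))) - \<psi> m (F_hor m (conn1 V a s m)) + \<psi> m (F_hor m (bdry V m (c m)))"
    using anchor_D_linear[OF vba ru m a s c \<psi>'] by (simp add: pull)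
  have "anchor A' m (av a m) (\<lambda>x. \<psi> x (hv s x)) = anchor A m (a m) (\<lambda>x. \<psi> x (F_hor x (s x)))"
    by (rule anchor_A_eq[OF m a dual_sectionsD(2)[OF \<psi> secs(2)[OF s], unfolded fac'(5)]]) (simp add: vals)
  then have 2: "anchor D' (m, hv s m) (av a m, cph a s c m) (\<ell> \<psi>) =
      anchor A m (a m) (\<lambda>x. \<psi> x (F_hor x (s x))) - \<psi> m (conn1 W (av a) (hv s) m) + \<psi> m (bdry W m (cph a s c m))"
    using anchor_D_linear[OF vba' ru' pts(5)[OF m] secs(1)[OF a] secs(2)[OF s] secs(5)[OF a s c] \<psi>] by simp
  note sub = vector_bundleD(3)[OF fac'(3) pts(3)[OF m]] and lin = dual_sectionsD(1)[OF \<psi> pts(3)[OF m]]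
  note am = sectionsD(1)[OF fac(2) a m] and sm = sectionsD(1)[OF fac(3) s pts(1)[OF m]]
    and cm = sectionsD(1)[OF fac(4) c pts(2)[OF m]]
  note bd = bundle_mapD[OF rf(6) pts(2)[OF m]] and bd' = bundle_mapD[OF rf'(6) pts(4)[OF m]]
    and hor = bundle_mapD[OF Fh pts(1)[OF m]] and fc = bundle_mapD[OF Fc pts(2)[OF m]]
  have mem: "bdry W m (F_c m (c m)) \<in> fibre B' m" "F_hor m (bdry V m (c m)) \<in> fibre B' m"
    "conn1 W (av a) (hv s) m \<in> fibre B' m" "F_hor m (conn1 V a s m) \<in> fibre B' m"
    "bdry W m (\<Phi> m (a m) (s m)) \<in> fibre B' m"
    using bd'(2)[OF fc(2)[OF cm]] hor(2)[OF bd(2)[OF cm]]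
      sectionsD(1)[OF fac'(3) connectionD(1)[OF rf'(5) secs(1)[OF a] secs(2)[OF s]] pts(3)[OF m]]
      hor(2)[OF sectionsD(1)[OF fac(3) connectionD(1)[OF rf(5) a s] pts(1)[OF m]]]
      bd'(2)[OF hom_one_formsD(2)[OF \<Phi> m am sm]] .
  have bdc: "bdry W m (cph a s c m) = bdry W m (F_c m (c m)) + bdry W m (\<Phi> m (a m) (s m))"
    using lin_onD(1)[OF bd'(1) fc(2)[OF cm] hom_one_formsD(2)[OF \<Phi> m am sm]] by (simp add: vals[OF m])
  have eq: "anch_defect a s c m = bdry W m (F_c m (c m)) - F_hor m (bdry V m (c m))
     - ((conn1 W (av a) (hv s) m - F_hor m (conn1 V a s m)) - bdry W m (\<Phi> m (a m) (s m)))"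
    by (simp add: anch_defect_def hom_conn_def W'_simps)
  show "anch_defect a s c m \<in> fibre B' m" by (simp add: eq mem subspace_diff[OF sub])
  show "anchor D' (m, hv s m) (av a m, cph a s c m) (\<ell> \<psi>) - anchor D (m, s m) (a m, c m) (\<lambda>q. \<ell> \<psi> (H q))
      = \<psi> m (anch_defect a s c m)"
    unfolding 1 2 bdc eq
    by (simp add: mem subspace_diff[OF sub] lin_on_diff[OF lin sub] lin_onD(1)[OF lin])
qed

text \<open>Anchor compatibility cancels the derivative terms, and only the bracket terms of the two
  differentials survive.\<close>

lemma ver_identity:
  assumes m: "m \<in> points M" and a: "a \<in> \<Gamma> (vbun A)" and b: "b \<in> \<Gamma> (vbun A)" and \<alpha>: "\<alpha> \<in> dual_sections (vbun A')"
  shows "ce_d A (pullback_form id (total_map F_ver) \<alpha>) a b m - ce_d A' \<alpha> (av a) (av b) m = \<alpha> m (ver_defect a b m)"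
    and "ver_defect a b m \<in> fibre (vbun A') m"
proof -
  have *: "anchor A' m (av a m) (\<lambda>q. \<alpha> q (av b q)) = anchor A m (a m) (\<lambda>q. \<alpha> q (F_ver q (b q)))"
    if "a \<in> \<Gamma> (vbun A)" "b \<in> \<Gamma> (vbun A)" for a b
    by (rule anchor_A_eq[OF m that(1) dual_sectionsD(2)[OF \<alpha> secs(1)[OF that(2)], unfolded base']]) (simp add: vals)
  have mem: "bracket A' (av a) (av b) m \<in> fibre (vbun A') m" "F_ver m (bracket A a b m) \<in> fibre (vbun A') m"
    using sectionsD(1)[OF fac'(2) lie_algebroidD(5)[OF fac'(1) secs(1)[OF a] secs(1)[OF b]] pts(5)[OF m]]
      bundle_mapD(2)[OF Fv m sectionsD(1)[OF fac(2) lie_algebroidD(5)[OF fac(1) a b] m]] .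
  note sub = vector_bundleD(3)[OF fac'(2) pts(5)[OF m]]
  show "ver_defect a b m \<in> fibre (vbun A') m" by (simp add: ver_defect_def mem subspace_diff[OF sub])
  show "ce_d A (pullback_form id (total_map F_ver) \<alpha>) a b m - ce_d A' \<alpha> (av a) (av b) m = \<alpha> m (ver_defect a b m)"
    by (simp add: ce_d_def *[OF a b] *[OF b a] pullback_form_def total_map_def ver_defect_def
        lin_on_diff[OF dual_sectionsD(1)[OF \<alpha> pts(5)[OF m]] sub] mem)
qed

text \<open>\<open>ce_d_lift\<close> computes both differentials, with \<theta> = \<gamma> \<circ>
  \<Phi> on D and \<theta> = 0 on D'. The functions differentiated along a1 and a2 coincide on M, so
  anchor compatibility removes these terms; linear algebra in one fibre of A' and one of C'
  remains.\<close>

lemma ce_d_identity: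
  assumes m: "m \<in> points M" and s: "s \<in> \<Gamma> B"
    and a1: "a1 \<in> \<Gamma> (vbun A)" and c1: "c1 \<in> \<Gamma> C" and a2: "a2 \<in> \<Gamma> (vbun A)" and c2: "c2 \<in> \<Gamma> C"
    and \<alpha>: "\<alpha> \<in> dual_sections (vbun A')" and \<gamma>: "\<gamma> \<in> dual_sections C'"
  shows "ce_d D (pullback_form H G (sum_form \<alpha> \<gamma>)) (lift B a1 c1) (lift B a2 c2) (m, s m)
      - ce_d D' (sum_form \<alpha> \<gamma>) (lift B' (av a1) (cph a1 s c1)) (lift B' (av a2) (cph a2 s c2)) (m, hv s m)
      = \<alpha> m (ver_defect a1 a2 m) + \<gamma> m (core_defect a1 c2 m - core_defect a2 c1 m + koszul_defect a1 a2 s m)"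
    and "core_defect a1 c2 m - core_defect a2 c1 m + koszul_defect a1 a2 s m \<in> fibre C' m"
proof -
  let ?\<alpha> = "pullback_form id (total_map F_ver) \<alpha>" and ?\<gamma> = "pullback_form id (total_map F_c) \<gamma>"
    and ?\<theta> = "\<lambda>m x b. \<gamma> m (\<Phi> m x b)"
  have \<alpha>': "?\<alpha> \<in> dual_sections (vbun A)" by (rule pullback_form_dual[OF fac(2) fac'(2) vb_ver \<alpha>])
  have \<gamma>': "?\<gamma> \<in> dual_sections C" by (rule pullback_form_dual[OF fac(4) fac'(4) vb_c \<gamma>])
  have pull: "?\<alpha> q x = \<alpha> q (F_ver q x)" "?\<gamma> q y = \<gamma> q (F_c q y)" for q x y
    by (simp_all add: pullback_form_def total_map_def)
  note lin\<gamma> = dual_sectionsD(1)[OF \<gamma> pts(4)]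
  have \<theta>: "(\<lambda>m. ?\<theta> m (a m)) \<in> dual_sections B" if a: "a \<in> \<Gamma> (vbun A)" for a
  proof -
    have "lin_on (fibre B q) (?\<theta> q (a q))" if q: "q \<in> points M" for q
      using lin_onD[OF lin\<gamma>[OF q]] lin_onD[OF hom_one_formsD(1)[OF \<Phi> q sectionsD(1)[OF fac(2) a q]]]
        hom_one_formsD(2)[OF \<Phi> q sectionsD(1)[OF fac(2) a q]]
      by (simp add: lin_on_def)
    moreover have "(\<lambda>q. ?\<theta> q (a q) (t q)) \<in> smooth_funs M" if t: "t \<in> \<Gamma> B" for t
      by (rule smooth_funs_cong[OF base_charted[OF fac(2)] dual_sectionsD(2)[OF \<gamma> secs(4)[OF a t], unfolded fac'(6)]])
        (simp add: vals)
    ultimately show ?thesis by (simp add: dual_sections_def fac(5))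
  qed
  have \<zeta>: "pullback_form H G (sum_form \<alpha> \<gamma>) (n, b) (x, y) = ?\<alpha> n x + ?\<gamma> n y + ?\<theta> n x b"
    if "n \<in> points M" "b \<in> fibre B n" "x \<in> fibre (vbun A) n" "y \<in> fibre C n" for n b x y
    using lin_onD(1)[OF lin\<gamma>[OF that(1)] bundle_mapD(2)[OF Fc pts(2)[OF that(1)] that(4)]
        hom_one_formsD(2)[OF \<Phi> that(1,3,2)]]
    unfolding pull by (simp add: pullback_form_def G_eq[OF that] H_eq sum_form_def)
  have zero: "(\<lambda>m b. 0) \<in> dual_sections B'" by (rule dual_sections_0)
  have LHS: "ce_d D (pullback_form H G (sum_form \<alpha> \<gamma>)) (lift B a1 c1) (lift B a2 c2) (m, s m) =
      (anchor A m (a1 m) (\<lambda>q. ?\<alpha> q (a2 q) + ?\<gamma> q (c2 q) + ?\<theta> q (a2 q) (s q))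
        - ?\<theta> m (a2 m) (conn1 V a1 s m) + ?\<theta> m (a2 m) (bdry V m (c1 m)))
    - (anchor A m (a2 m) (\<lambda>q. ?\<alpha> q (a1 q) + ?\<gamma> q (c1 q) + ?\<theta> q (a1 q) (s q))
        - ?\<theta> m (a1 m) (conn1 V a2 s m) + ?\<theta> m (a1 m) (bdry V m (c2 m)))
    - (?\<alpha> m (bracket A a1 a2 m) + ?\<theta> m (bracket A a1 a2 m) (s m)
        + ?\<gamma> m (curv V m (a1 m) (a2 m) (s m) + conn0 V a1 c2 m - conn0 V a2 c1 m))"
    by (rule ce_d_lift[OF vba ru m s a1 c1 a2 c2 \<alpha>' \<gamma>' \<theta> \<zeta>])
  have RHS: "ce_d D' (sum_form \<alpha> \<gamma>) (lift B' (av a1) (cph a1 s c1)) (lift B' (av a2) (cph a2 s c2)) (m, hv s m) =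
      anchor A' m (av a1 m) (\<lambda>q. \<alpha> q (av a2 q) + \<gamma> q (cph a2 s c2 q))
    - anchor A' m (av a2 m) (\<lambda>q. \<alpha> q (av a1 q) + \<gamma> q (cph a1 s c1 q))
    - (\<alpha> m (bracket A' (av a1) (av a2) m)
        + \<gamma> m (curv W m (av a1 m) (av a2 m) (hv s m) + conn0 W (av a1) (cph a2 s c2) m - conn0 W (av a2) (cph a1 s c1) m))"
    using ce_d_lift[OF vba' ru' pts(5)[OF m] secs(2)[OF s] secs(1)[OF a1] secs(5)[OF a1 s c1] secs(1)[OF a2]
        secs(5)[OF a2 s c2] \<alpha> \<gamma> zero, of "sum_form \<alpha> \<gamma>"]
    by (simp add: sum_form_def)
  have anch: "anchor A' m (av a m) (\<lambda>q. \<alpha> q (av a' q) + \<gamma> q (cph a' s c' q)) =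
      anchor A m (a m) (\<lambda>q. ?\<alpha> q (a' q) + ?\<gamma> q (c' q) + ?\<theta> q (a' q) (s q))"
    if a: "a \<in> \<Gamma> (vbun A)" and a': "a' \<in> \<Gamma> (vbun A)" and c': "c' \<in> \<Gamma> C" for a a' c'
  proof (rule anchor_A_eq[OF m a])
    show "(\<lambda>q. \<alpha> q (av a' q) + \<gamma> q (cph a' s c' q)) \<in> smooth_funs M"
      using smooth_funs_add[OF dual_sectionsD(2)[OF \<alpha> secs(1)[OF a'], unfolded base']
          dual_sectionsD(2)[OF \<gamma> secs(5)[OF a' s c'], unfolded fac'(6)]] .
    fix q assume q: "q \<in> points M"
    show "\<alpha> q (av a' q) + \<gamma> q (cph a' s c' q) = ?\<alpha> q (a' q) + ?\<gamma> q (c' q) + ?\<theta> q (a' q) (s q)"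
      using lin_onD(1)[OF lin\<gamma>[OF q] bundle_mapD(2)[OF Fc pts(2)[OF q] sectionsD(1)[OF fac(4) c' pts(2)[OF q]]]
          hom_one_formsD(2)[OF \<Phi> q sectionsD(1)[OF fac(2) a' q] sectionsD(1)[OF fac(3) s pts(1)[OF q]]]]
      unfolding pull by (simp add: vals[OF q])
  qed
  note subC = vector_bundleD(3)[OF fac(4) pts(2)[OF m]] and subC' = vector_bundleD(3)[OF fac'(4) pts(4)[OF m]]
    and subA' = vector_bundleD(3)[OF fac'(2) pts(5)[OF m]]
  note a1m = sectionsD(1)[OF fac(2) a1 m] and a2m = sectionsD(1)[OF fac(2) a2 m]
    and sm = sectionsD(1)[OF fac(3) s pts(1)[OF m]]
  note fc = bundle_mapD[OF Fc pts(2)[OF m]] and fv = bundle_mapD[OF Fv m] and fh = bundle_mapD[OF Fh pts(1)[OF m]]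
  note bd = bundle_mapD[OF rf(6) pts(2)[OF m]]
  have br: "bracket A a1 a2 m \<in> fibre (vbun A) m"
    by (rule sectionsD(1)[OF fac(2) lie_algebroidD(5)[OF fac(1) a1 a2] m])
  have n0: "conn0 V a c m \<in> fibre C m" if "a \<in> \<Gamma> (vbun A)" "c \<in> \<Gamma> C" for a c
    by (rule sectionsD(1)[OF fac(4) connectionD(1)[OF rf(4) that] pts(2)[OF m]])
  have k: "curv V m (a1 m) (a2 m) (s m) \<in> fibre C m"
    by (rule hom_two_forms_mem[OF rf(7) m a1m a2m sm])
  have k': "curv W m (F_ver m (a1 m)) (F_ver m (a2 m)) (F_hor m (s m)) \<in> fibre C' m"
    by (rule hom_two_forms_mem[OF rf'(7) pts(5)[OF m] fv(2)[OF a1m] fv(2)[OF a2m] fh(2)[OF sm]])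
  have n0': "conn0 W (av a) t m \<in> fibre C' m" if "a \<in> \<Gamma> (vbun A)" "t \<in> \<Gamma> C'" for a t
    by (rule sectionsD(1)[OF fac'(4) connectionD(1)[OF rf'(4) secs(1)[OF that(1)] that(2)] pts(4)[OF m]])
  \<comment> \<open>The summand \<open>cv c'\<close> of \<open>cph\<close> belongs to
    \<open>core_defect\<close>, the summand \<open>ph a' s\<close> to the Koszul differential of
    \<Phi>.\<close>
  have split: "conn0 W (av a) (cph a' s c') m = conn0 W (av a) (cv c') m + conn0 W (av a) (ph a' s) m"
    if "a \<in> \<Gamma> (vbun A)" "a' \<in> \<Gamma> (vbun A)" "c' \<in> \<Gamma> C" for a a' c'
    using fun_cong[OF connectionD(2)[OF rf'(4) secs(1)[OF that(1)] secs(3)[OF that(3)] secs(4)[OF that(2) s]], of m] .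
  have \<Phi>1: "\<Phi> m (a m) (conn1 V b s m) \<in> fibre C' m" if "a \<in> \<Gamma> (vbun A)" "b \<in> \<Gamma> (vbun A)" for a b
    by (rule hom_one_formsD(2)[OF \<Phi> m sectionsD(1)[OF fac(2) that(1) m]
          sectionsD(1)[OF fac(3) connectionD(1)[OF rf(5) that(2) s] pts(1)[OF m]]])
  have \<Phi>2: "\<Phi> m (a m) (bdry V m (c m)) \<in> fibre C' m" if "a \<in> \<Gamma> (vbun A)" "c \<in> \<Gamma> C" for a c
    by (rule hom_one_formsD(2)[OF \<Phi> m sectionsD(1)[OF fac(2) that(1) m] bd(2)[OF sectionsD(1)[OF fac(4) that(2) pts(2)[OF m]]]])
  have \<Phi>3: "\<Phi> m (bracket A a1 a2 m) (s m) \<in> fibre C' m"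
    by (rule hom_one_formsD(2)[OF \<Phi> m br sm])
  have Fc_eq: "F_c m (curv V m (a1 m) (a2 m) (s m) + conn0 V a1 c2 m - conn0 V a2 c1 m) =
      F_c m (curv V m (a1 m) (a2 m) (s m)) + F_c m (conn0 V a1 c2 m) - F_c m (conn0 V a2 c1 m)"
    by (simp add: lin_on_diff[OF fc(1) subC] lin_onD(1)[OF fc(1)] subspace_add[OF subC] k n0 a1 a2 c1 c2)
  have eq: "core_defect a1 c2 m - core_defect a2 c1 m + koszul_defect a1 a2 s m =
     (conn0 W (av a1) (cv c2) m - F_c m (conn0 V a1 c2 m) - \<Phi> m (a1 m) (bdry V m (c2 m)))
     - (conn0 W (av a2) (cv c1) m - F_c m (conn0 V a2 c1 m) - \<Phi> m (a2 m) (bdry V m (c1 m)))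
     + ((conn0 W (av a1) (ph a2 s) m - \<Phi> m (a2 m) (conn1 V a1 s m))
        - (conn0 W (av a2) (ph a1 s) m - \<Phi> m (a1 m) (conn1 V a2 s m)) - \<Phi> m (bracket A a1 a2 m) (s m)
        - (F_c m (curv V m (a1 m) (a2 m) (s m)) - curv W m (F_ver m (a1 m)) (F_ver m (a2 m)) (F_hor m (s m))))"
    by (simp add: core_defect_def koszul_defect_def koszul_d1_def hom_conn_def W'_simps apply_map_def Let_def)
  note mem = n0'[OF a1 secs(3)[OF c2]] n0'[OF a2 secs(3)[OF c1]] n0'[OF a1 secs(4)[OF a2 s]] n0'[OF a2 secs(4)[OF a1 s]]
    fc(2)[OF n0[OF a1 c2]] fc(2)[OF n0[OF a2 c1]] fc(2)[OF k] k' \<Phi>1[OF a1 a2] \<Phi>1[OF a2 a1] \<Phi>2[OF a1 c2] \<Phi>2[OF a2 c1] \<Phi>3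
  show "core_defect a1 c2 m - core_defect a2 c1 m + koszul_defect a1 a2 s m \<in> fibre C' m"
    by (simp add: eq mem subspace_diff[OF subC'] subspace_add[OF subC'])
  have ver: "\<alpha> m (ver_defect a1 a2 m) = \<alpha> m (bracket A' (av a1) (av a2) m) - \<alpha> m (F_ver m (bracket A a1 a2 m))"
    using lin_on_diff[OF dual_sectionsD(1)[OF \<alpha> pts(5)[OF m]] subA'
        sectionsD(1)[OF fac'(2) lie_algebroidD(5)[OF fac'(1) secs(1)[OF a1] secs(1)[OF a2]] pts(5)[OF m]] fv(2)[OF br]]
    by (simp add: ver_defect_def)
  show "ce_d D (pullback_form H G (sum_form \<alpha> \<gamma>)) (lift B a1 c1) (lift B a2 c2) (m, s m)
      - ce_d D' (sum_form \<alpha> \<gamma>) (lift B' (av a1) (cph a1 s c1)) (lift B' (av a2) (cph a2 s c2)) (m, hv s m)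
      = \<alpha> m (ver_defect a1 a2 m) + \<gamma> m (core_defect a1 c2 m - core_defect a2 c1 m + koszul_defect a1 a2 s m)"
    unfolding LHS RHS anch[OF a1 a2 c2] anch[OF a2 a1 c1]
    unfolding ver eq split[OF a1 a2 c2] split[OF a2 a1 c1] vals[OF m] pull Fc_eq
    by (simp add: mem subspace_diff[OF subC'] subspace_add[OF subC'] lin_on_diff[OF lin\<gamma>[OF m] subC'] lin_onD(1)[OF lin\<gamma>[OF m]])
qed

end

section \<open>The Lie algebroid conditions in terms of the defects\<close>

text \<open>The anchor clause is part of both sides, so both are false if it fails. If it holds, the
  dual bracket condition applies with all forms on A', and \<open>ce_d_cong\<close> trades arbitrary
  X', Y' for \<open>av X\<close>, \<open>av Y\<close>.\<close>

private lemma la_ver_iff: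
  "la_morphism A A' id (total_map F_ver) \<longleftrightarrow> anchor_compatible A A' id (total_map F_ver) \<and>
     (\<forall>a\<in>\<Gamma> (vbun A). \<forall>b\<in>\<Gamma> (vbun A). \<forall>m\<in>points M. ver_defect a b m = 0)"
proof (cases "anchor_compatible A A' id (total_map F_ver)")
  case False
  then show ?thesis by (auto simp: la_morphism_def anchor_compatible_def Let_def)
next
  case ac: True
  note id = ver_identity[OF ac]
  have "\<forall>p\<in>points (base (vbun A')). \<forall>e\<in>fibre (vbun A') p. (\<forall>\<xi>\<in>dual_sections (vbun A'). \<xi> p e = 0) \<longrightarrow> e = 0"
    using dual_sections_separate[OF fac'(2)] by blast
  note iff = bracket_condition_iff[OF fac(1) fac'(1) vb_ver ac subset_refl this]
  show ?thesis
    unfolding iff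
  proof (intro iffI conjI ac ballI impI; (elim conjE)?)
    fix a b m
    assume Q: "\<forall>\<xi>\<in>dual_sections (vbun A'). \<forall>X\<in>\<Gamma> (vbun A). \<forall>Y\<in>\<Gamma> (vbun A). \<forall>m\<in>points M. \<forall>X'\<in>\<Gamma> (vbun A'). \<forall>Y'\<in>\<Gamma> (vbun A').
      X' (id m) = snd (total_map F_ver (m, X m)) \<longrightarrow> Y' (id m) = snd (total_map F_ver (m, Y m)) \<longrightarrow>
      ce_d A (pullback_form id (total_map F_ver) \<xi>) X Y m = ce_d A' \<xi> X' Y' (id m)"
      and a: "a \<in> \<Gamma> (vbun A)" and b: "b \<in> \<Gamma> (vbun A)" and m: "m \<in> points M"
    show "ver_defect a b m = 0"
    proof (rule dual_sections_separate[OF fac'(2) pts(5)[OF m] id(2)[OF m a b dual_sections_0]])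
      fix \<alpha> assume \<alpha>: "\<alpha> \<in> dual_sections (vbun A')"
      show "\<alpha> m (ver_defect a b m) = 0"
        using id(1)[OF m a b \<alpha>] Q[rule_format, OF \<alpha> a b m secs(1)[OF a] secs(1)[OF b]]
        by (simp add: total_map_def vals[OF m])
    qed
  next
    fix \<xi> X Y m X' Y'
    assume 0: "\<forall>a\<in>\<Gamma> (vbun A). \<forall>b\<in>\<Gamma> (vbun A). \<forall>m\<in>points M. ver_defect a b m = 0"
      and \<xi>: "\<xi> \<in> dual_sections (vbun A')" and X: "X \<in> \<Gamma> (vbun A)" and Y: "Y \<in> \<Gamma> (vbun A)" and m: "m \<in> points M"
      and X': "X' \<in> \<Gamma> (vbun A')" "X' (id m) = snd (total_map F_ver (m, X m))"
      and Y': "Y' \<in> \<Gamma> (vbun A')" "Y' (id m) = snd (total_map F_ver (m, Y m))"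
    have "\<xi> m (ver_defect X Y m) = 0"
      using 0 X Y m lin_on_0[OF dual_sectionsD(1)[OF \<xi> pts(5)[OF m]] vector_bundleD(3)[OF fac'(2) pts(5)[OF m]]] by simp
    moreover have "ce_d A' \<xi> X' Y' m = ce_d A' \<xi> (av X) (av Y) m"
      by (rule ce_d_cong[OF fac'(1) \<xi> pts(5)[OF m] X'(1) secs(1)[OF X] _ Y'(1) secs(1)[OF Y]])
        (use X'(2) Y'(2) in \<open>simp_all add: total_map_def vals[OF m]\<close>)
    ultimately show "ce_d A (pullback_form id (total_map F_ver) \<xi>) X Y m = ce_d A' \<xi> X' Y' (id m)"
      using id(1)[OF m X Y \<xi>] by simp
  qed
qed

private lemma anchor_compatible_D_iff:
  "anchor_compatible D D' H G \<longleftrightarrow> anchor_compatible A A' id (total_map F_ver) \<and>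
     (\<forall>a\<in>\<Gamma> (vbun A). \<forall>s\<in>\<Gamma> B. \<forall>c\<in>\<Gamma> C. \<forall>m\<in>points M. anch_defect a s c m = 0)"
proof (intro iffI conjI; (elim conjE)?)
  assume acD: "anchor_compatible D D' H G"
  have acD': "anchor D (m, b) (x, y) (\<lambda>q. g (H q)) = anchor D' (m, F_hor m b) (F_ver m x, F_c m y + \<Phi> m x b) g"
    if "m \<in> points M" "b \<in> fibre B m" "x \<in> fibre (vbun A) m" "y \<in> fibre C m" "g \<in> smooth_funs (total B')" for m b x y g
    using anchor_compatibleD[OF acD, of "(m, b)" "(x, y)" g] that
    by (simp add: fac(8) fac'(8) dvb_over_B_simps points_total fac(5) G_eq H_eq)
  show ac: "anchor_compatible A A' id (total_map F_ver)"
    unfolding anchor_compatible_def tv_eq_def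
  proof (intro ballI)
    fix m x f assume m: "m \<in> points M" and x: "x \<in> fibre (vbun A) m" and "f \<in> smooth_funs (base (vbun A'))"
    then have f: "f \<in> smooth_funs M" by (simp add: base')
    have f': "(\<lambda>q. f (fst q)) \<in> smooth_funs (total B')"
      by (rule smooth_funs_pullback[OF total_charted[OF fac'(3)] base_charted[OF fac(2)] _ f])
        (use smooth_map_fst[OF fac'(3)] in \<open>simp add: fac'(5)\<close>)
    \<comment> \<open>Functions pulled back from M see neither the fibre point nor the core
      component, so zero vectors serve for both.\<close>
    have b: "0 \<in> fibre B m" and y: "0 \<in> fibre C m"
      using subspace_0[OF vector_bundleD(3)[OF fac(3) pts(1)[OF m]]] subspace_0[OF vector_bundleD(3)[OF fac(4) pts(2)[OF m]]] .
    have mem: "F_hor m 0 \<in> fibre B' m" "F_ver m x \<in> fibre (vbun A') m" "F_c m 0 + \<Phi> m x 0 \<in> fibre C' m"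
      using bundle_mapD(2)[OF Fh pts(1)[OF m] b] bundle_mapD(2)[OF Fv m x]
        subspace_add[OF vector_bundleD(3)[OF fac'(4) pts(4)[OF m]] bundle_mapD(2)[OF Fc pts(2)[OF m] y] hom_one_formsD(2)[OF \<Phi> m x b]] .
    have "(\<lambda>q. f (fst (H q))) = (\<lambda>q. f (fst q))" by (simp add: fun_eq_iff total_map_def split_beta)
    then have "anchor D' (m, F_hor m 0) (F_ver m x, F_c m 0 + \<Phi> m x 0) (\<lambda>q. f (fst q)) = anchor A m x f"
      using acD'[OF m b x y f'] anchor_D_base[OF vba ru m b x y f] by simp
    then show "anchor A' (id m) (snd (total_map F_ver (m, x))) f = pushforward id (anchor A m x) f"
      using anchor_D_base[OF vba' ru' pts(5)[OF m] mem, of f] f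
      by (simp add: base' total_map_def pushforward_def)
  qed
  show "\<forall>a\<in>\<Gamma> (vbun A). \<forall>s\<in>\<Gamma> B. \<forall>c\<in>\<Gamma> C. \<forall>m\<in>points M. anch_defect a s c m = 0"
  proof (intro ballI)
    fix a s c m assume a: "a \<in> \<Gamma> (vbun A)" and s: "s \<in> \<Gamma> B" and c: "c \<in> \<Gamma> C" and m: "m \<in> points M"
    note id = anch_identity[OF ac m a s c]
    show "anch_defect a s c m = 0"
    proof (rule dual_sections_separate[OF fac'(3) pts(3)[OF m] id(2)[OF dual_sections_0]])
      fix \<psi> assume \<psi>: "\<psi> \<in> dual_sections B'"
      show "\<psi> m (anch_defect a s c m) = 0"
        using id(1)[OF \<psi>] acD'[OF m sectionsD(1)[OF fac(3) s pts(1)[OF m]] sectionsD(1)[OF fac(2) a m]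
            sectionsD(1)[OF fac(4) c pts(2)[OF m]] lin_fun_smooth[OF fac'(3) \<psi>]]
        by (simp add: vals[OF m])
    qed
  qed
next
  assume ac: "anchor_compatible A A' id (total_map F_ver)"
    and 0: "\<forall>a\<in>\<Gamma> (vbun A). \<forall>s\<in>\<Gamma> B. \<forall>c\<in>\<Gamma> C. \<forall>m\<in>points M. anch_defect a s c m = 0"
  show "anchor_compatible D D' H G"
    unfolding anchor_compatible_def tv_eq_def
  proof (intro ballI)
    fix p e g assume p: "p \<in> points (base (vbun D))" and e: "e \<in> fibre (vbun D) p"
      and "g \<in> smooth_funs (base (vbun D'))"
    then have g: "g \<in> smooth_funs (total B')" by (simp add: fac'(8) dvb_over_B_simps)
    obtain m b where mb: "p = (m, b)" and m: "m \<in> points M" and b: "b \<in> fibre B m"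
      using p by (auto simp: fac(8) dvb_over_B_simps points_total fac(5))
    obtain x y where xy: "e = (x, y)" and x: "x \<in> fibre (vbun A) m" and y: "y \<in> fibre C m"
      using e by (auto simp: fac(8) dvb_over_B_simps mb)
    \<comment> \<open>The defect is built from connections, so the given vectors are first extended
      to sections.\<close>
    obtain a where a: "a \<in> \<Gamma> (vbun A)" "a m = x" using section_through[OF fac(2) m x] .
    obtain s where s: "s \<in> \<Gamma> B" "s m = b" using section_through[OF fac(3) pts(1)[OF m] b] .
    obtain c where c: "c \<in> \<Gamma> C" "c m = y" using section_through[OF fac(4) pts(2)[OF m] y] .
    have mem: "F_hor m b \<in> fibre B' m" "F_ver m x \<in> fibre (vbun A') m" "F_c m y + \<Phi> m x b \<in> fibre C' m"
      using bundle_mapD(2)[OF Fh pts(1)[OF m] b] bundle_mapD(2)[OF Fv m x]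
        subspace_add[OF vector_bundleD(3)[OF fac'(4) pts(4)[OF m]] bundle_mapD(2)[OF Fc pts(2)[OF m] y] hom_one_formsD(2)[OF \<Phi> m x b]] .
    let ?v = "anchor D' (m, F_hor m b) (F_ver m x, F_c m y + \<Phi> m x b)" and ?w = "pushforward H (anchor D (m, b) (x, y))"
    have v: "tangent_vector (total B') (m, F_hor m b) ?v"
      by (rule anchor_D_tangent[OF vba' ru' pts(5)[OF m] mem])
    have w: "tangent_vector (total B') (m, F_hor m b) ?w"
      using tangent_vector_pushforward[OF total_charted[OF fac(3)] total_charted[OF fac'(3)] smooth_H
          anchor_D_tangent[OF vba ru m b x y]] by (simp add: H_eq)
    \<comment> \<open>Both are tangent vectors of the total space of \<open>B'\<close> at the same
      point, so the vanishing criterion applies to their difference.\<close>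
    have "?v g - ?w g = 0"
    proof (rule tangent_vector_total_eq_0I[OF fac'(3) fac'(10) tangent_vector_diff[OF v w] _ _ g])
      fix f assume "f \<in> smooth_funs (base B')"
      then have f: "f \<in> smooth_funs M" by (simp add: fac'(5))
      have "(\<lambda>q. f (fst q)) \<circ> H = (\<lambda>q. f (fst q))" by (simp add: fun_eq_iff total_map_def split_beta)
      then have "?w (\<lambda>q. f (fst q)) = anchor A m x f"
        using anchor_D_base[OF vba ru m b x y f] by (simp add: pushforward_def)
      moreover have "?v (\<lambda>q. f (fst q)) = anchor A' m (F_ver m x) f"
        using anchor_D_base[OF vba' ru' pts(5)[OF m] mem, of f] f by (simp add: base')
      moreover have "anchor A' m (F_ver m x) f = anchor A m x f"
        using anchor_compatibleD[OF ac m x, of f] f by (simp add: base' total_map_def)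
      ultimately show "?v (\<lambda>q. f (fst q)) - ?w (\<lambda>q. f (fst q)) = 0" by simp
    next
      fix \<psi> assume \<psi>: "\<psi> \<in> dual_sections B'"
      have "\<psi> m (anch_defect a s c m) = 0"
        using 0 a(1) s(1) c(1) m lin_on_0[OF dual_sectionsD(1)[OF \<psi> pts(3)[OF m]] vector_bundleD(3)[OF fac'(3) pts(3)[OF m]]] by simp
      then show "?v (\<ell> \<psi>) - ?w (\<ell> \<psi>) = 0"
        using anch_identity(1)[OF ac m a(1) s(1) c(1) \<psi>] by (simp add: vals[OF m] a(2) s(2) c(2) pushforward_def o_def)
    qed
    then show "anchor D' (H p) (snd (G (p, e))) g = pushforward H (anchor D p e) g"
      by (simp add: mb xy G_eq[OF m b x y] H_eq)
  qed
qed

text \<open>The dual bracket condition asks for sections X', Y' of D' with the right value at the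
  image point. By \<open>GL\<close> the lifts with components \<open>av\<close> and
  \<open>cph\<close> provide them.\<close>

private lemma la_D_iff:
  "la_morphism D D' H G \<longleftrightarrow> anchor_compatible D D' H G \<and>
     (\<forall>a\<in>\<Gamma> (vbun A). \<forall>b\<in>\<Gamma> (vbun A). \<forall>s\<in>\<Gamma> B. \<forall>c\<in>\<Gamma> C. \<forall>d\<in>\<Gamma> C. \<forall>m\<in>points M.
        ver_defect a b m = 0 \<and> core_defect a d m - core_defect b c m + koszul_defect a b s m = 0)"
    (is "_ \<longleftrightarrow> _ \<and> ?R")
proof (cases "anchor_compatible D D' H G")
  case False
  then show ?thesis by (auto simp: la_morphism_def anchor_compatible_def Let_def)
next
  case acD: True
  then have ac: "anchor_compatible A A' id (total_map F_ver)" using anchor_compatible_D_iff by blast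
  note id = ce_d_identity[OF ac]
  note L = lift_in_sections[OF vba ru] and L' = lift_in_sections[OF vba' ru']
  let ?\<Xi> = "{sum_form \<alpha> \<gamma> | \<alpha> \<gamma>. \<alpha> \<in> dual_sections (vbun A') \<and> \<gamma> \<in> dual_sections C'} :: ('m \<times> 'b' \<Rightarrow> 'a' \<times> 'c' \<Rightarrow> real) set"
  note dvb' = fac'(2,3,4) fac'(5)[folded base'] fac'(6)[folded base'] fac'(9)
  have \<Xi>: "?\<Xi> \<subseteq> dual_sections (vbun D')"
    using sum_form_dual[OF dvb'] by (auto simp: fac'(8))
  have sep: "\<forall>p\<in>points (base (vbun D')). \<forall>e\<in>fibre (vbun D') p. (\<forall>\<xi>\<in>?\<Xi>. \<xi> p e = 0) \<longrightarrow> e = 0"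
  proof (intro ballI impI)
    fix p e assume "p \<in> points (base (vbun D'))" "e \<in> fibre (vbun D') p" and 0: "\<forall>\<xi>\<in>?\<Xi>. \<xi> p e = 0"
    then have p: "p \<in> points (total B')" and e: "e \<in> fibre (dvb_over_B (vbun A') B' C') p"
      by (simp_all add: fac'(8) dvb_over_B_simps)
    show "e = 0" by (rule sum_form_separate[OF dvb' p e]) (use 0 in blast)
  qed
  note iff = bracket_condition_iff[OF fac(7) fac'(7) vb_D acD \<Xi> sep]
  have ptD: "(m, s m) \<in> points (total B)" "(m, s m) \<in> points (base (vbun D))" if "m \<in> points M" "s \<in> \<Gamma> B" for m s
    using that sectionsD(1)[OF fac(3) that(2) pts(1)[OF that(1)]]
    by (simp_all add: fac(8) dvb_over_B_simps points_total fac(5))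
  have ptD': "(m, hv s m) \<in> points (total B')" "(m, hv s m) \<in> points (base (vbun D'))" if "m \<in> points M" "s \<in> \<Gamma> B" for m s
    using that sectionsD(1)[OF fac'(3) secs(2)[OF that(2)] pts(3)[OF that(1)]]
    by (simp_all add: fac'(8) dvb_over_B_simps points_total fac'(5))
  have GL: "snd (G ((m, s m), lift B a c (m, s m))) = lift B' (av a) (cph a s c) (m, hv s m)"
    if m: "m \<in> points M" and a: "a \<in> \<Gamma> (vbun A)" and s: "s \<in> \<Gamma> B" and c: "c \<in> \<Gamma> C" for m a s c
    using G_eq[OF m sectionsD(1)[OF fac(3) s pts(1)[OF m]] sectionsD(1)[OF fac(2) a m] sectionsD(1)[OF fac(4) c pts(2)[OF m]]]
    unfolding lift_apply[OF ptD(1)[OF m s]] lift_apply[OF ptD'(1)[OF m s]] by (simp add: vals[OF m])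
  have Hs: "H (m, s m) = (m, hv s m)" if "m \<in> points M" for m s
    using that by (simp add: H_eq vals)
  show ?thesis
  proof (intro iffI conjI acD; (elim conjE)?)
    assume "la_morphism D D' H G"
    note Q = this[unfolded iff, rule_format]
    show ?R
    proof (intro ballI)
      fix a b s c d m
      assume a: "a \<in> \<Gamma> (vbun A)" and b: "b \<in> \<Gamma> (vbun A)" and s: "s \<in> \<Gamma> B" and c: "c \<in> \<Gamma> C" and d: "d \<in> \<Gamma> C"
        and m: "m \<in> points M"
      note id = id[OF m s a c b d]
      have sum0: "\<alpha> m (ver_defect a b m) + \<gamma> m (core_defect a d m - core_defect b c m + koszul_defect a b s m) = 0"
        if \<alpha>: "\<alpha> \<in> dual_sections (vbun A')" and \<gamma>: "\<gamma> \<in> dual_sections C'" for \<alpha> \<gamma>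
      proof -
        have \<xi>: "sum_form \<alpha> \<gamma> \<in> ?\<Xi>" using \<alpha> \<gamma> by blast
        have "ce_d D (pullback_form H G (sum_form \<alpha> \<gamma>)) (lift B a c) (lift B b d) (m, s m) =
            ce_d D' (sum_form \<alpha> \<gamma>) (lift B' (av a) (cph a s c)) (lift B' (av b) (cph b s d)) (H (m, s m))"
          by (rule Q[OF \<xi> L[OF a c] L[OF b d] ptD(2)[OF m s] L'[OF secs(1)[OF a] secs(5)[OF a s c]]
                L'[OF secs(1)[OF b] secs(5)[OF b s d]]])
            (simp_all only: GL[OF m a s c] GL[OF m b s d] Hs[OF m])
        then show ?thesis using id(1)[OF \<alpha> \<gamma>] by (simp only: Hs[OF m])
      qed
      have "ver_defect a b m = 0"
        by (rule dual_sections_separate[OF fac'(2) pts(5)[OF m] ver_identity(2)[OF ac m a b dual_sections_0]])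
          (use sum0[OF _ dual_sections_0] in simp)
      moreover have "core_defect a d m - core_defect b c m + koszul_defect a b s m = 0"
        by (rule dual_sections_separate[OF fac'(4) pts(4)[OF m] id(2)[OF dual_sections_0 dual_sections_0]])
          (use sum0[OF dual_sections_0] in simp)
      ultimately show "ver_defect a b m = 0 \<and> core_defect a d m - core_defect b c m + koszul_defect a b s m = 0" ..
    qed
  next
    assume R: ?R
    show "la_morphism D D' H G"
      unfolding iff
    proof (intro ballI impI)
      fix \<xi> X Y p X' Y'
      assume \<xi>: "\<xi> \<in> ?\<Xi>" and X: "X \<in> \<Gamma> (vbun D)" and Y: "Y \<in> \<Gamma> (vbun D)" and p: "p \<in> points (base (vbun D))"
        and X': "X' \<in> \<Gamma> (vbun D')" "X' (H p) = snd (G (p, X p))" and Y': "Y' \<in> \<Gamma> (vbun D')" "Y' (H p) = snd (G (p, Y p))"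
      obtain \<alpha> \<gamma> where \<alpha>: "\<alpha> \<in> dual_sections (vbun A')" and \<gamma>: "\<gamma> \<in> dual_sections C'" and \<xi>_eq: "\<xi> = sum_form \<alpha> \<gamma>"
        using \<xi> by blast
      \<comment> \<open>A section through the fibre component of p makes the identities along
        sections available at every point of the total space.\<close>
      obtain m s where m: "m \<in> points M" and s: "s \<in> \<Gamma> B" and p_eq: "p = (m, s m)"
        using p section_through[OF fac(3)] by (auto simp: fac(8) dvb_over_B_simps points_total fac(5)) metis
      note ptD = ptD[OF m s] and ptD' = ptD'[OF m s] and Hp = Hs[OF m, of s]
      \<comment> \<open>Only the values of X and Y at p matter, so both are replaced by lifts with
        these values.\<close>
      have ext: "\<exists>a\<in>\<Gamma> (vbun A). \<exists>c\<in>\<Gamma> C. Z (m, s m) = lift B a c (m, s m)" if Z: "Z \<in> \<Gamma> (vbun D)" for Z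
      proof -
        have "Z (m, s m) \<in> fibre (vbun A) m \<times> fibre C m"
          using sectionsD(1)[OF lie_algebroidD(1)[OF fac(7)] Z ptD(2)] by (simp add: fac(8) dvb_over_B_simps)
        then have z: "fst (Z (m, s m)) \<in> fibre (vbun A) m" "snd (Z (m, s m)) \<in> fibre C m" by auto
        obtain a where "a \<in> \<Gamma> (vbun A)" "a m = fst (Z (m, s m))" using section_through[OF fac(2) m z(1)] .
        moreover obtain c where "c \<in> \<Gamma> C" "c m = snd (Z (m, s m))" using section_through[OF fac(4) pts(2)[OF m] z(2)] .
        ultimately show ?thesis by (intro bexI[of _ a] bexI[of _ c]) (simp_all add: lift_apply[OF ptD(1)])
      qed
      obtain a c where a: "a \<in> \<Gamma> (vbun A)" and c: "c \<in> \<Gamma> C" and Xl: "X (m, s m) = lift B a c (m, s m)"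
        using ext[OF X] by blast
      obtain b d where b: "b \<in> \<Gamma> (vbun A)" and d: "d \<in> \<Gamma> C" and Yl: "Y (m, s m) = lift B b d (m, s m)"
        using ext[OF Y] by blast
      have \<xi>D': "\<xi> \<in> dual_sections (vbun D')" using \<xi> \<Xi> by blast
      note \<xi>D = pullback_form_dual[OF lie_algebroidD(1)[OF fac(7)] lie_algebroidD(1)[OF fac'(7)] vb_D \<xi>D']
      have "ce_d D (pullback_form H G \<xi>) X Y (m, s m) = ce_d D (pullback_form H G \<xi>) (lift B a c) (lift B b d) (m, s m)"
        by (rule ce_d_cong[OF fac(7) \<xi>D ptD(2) X L[OF a c] Xl Y L[OF b d] Yl])
      also have "\<dots> = ce_d D' \<xi> (lift B' (av a) (cph a s c)) (lift B' (av b) (cph b s d)) (m, hv s m)"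
        using id(1)[OF m s a c b d \<alpha> \<gamma>] R a b s c d m
          lin_on_0[OF dual_sectionsD(1)[OF \<alpha> pts(5)[OF m]] vector_bundleD(3)[OF fac'(2) pts(5)[OF m]]]
          lin_on_0[OF dual_sectionsD(1)[OF \<gamma> pts(4)[OF m]] vector_bundleD(3)[OF fac'(4) pts(4)[OF m]]]
        by (simp add: \<xi>_eq)
      also have "\<dots> = ce_d D' \<xi> X' Y' (m, hv s m)"
      proof (rule ce_d_cong[OF fac'(7) \<xi>D' ptD'(2) L'[OF secs(1)[OF a] secs(5)[OF a s c]] X'(1) _
            L'[OF secs(1)[OF b] secs(5)[OF b s d]] Y'(1)])
        show "lift B' (av a) (cph a s c) (m, hv s m) = X' (m, hv s m)"
          using X'(2) GL[OF m a s c] by (simp only: p_eq Hp Xl)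
        show "lift B' (av b) (cph b s d) (m, hv s m) = Y' (m, hv s m)"
          using Y'(2) GL[OF m b s d] by (simp only: p_eq Hp Yl)
      qed
      finally show "ce_d D (pullback_form H G \<xi>) X Y p = ce_d D' \<xi> X' Y' (H p)"
        by (simp only: p_eq Hp)
    qed
  qed
qed

section \<open>Separating the combined equations\<close>

text \<open>For a zero core section the core equation is trivial, and the boundary terms drop out of
  \<open>anch_defect\<close>, which leaves the equation for the degree 1 connections.\<close>

private lemma defects_zero:
  assumes a: "a \<in> \<Gamma> (vbun A)" and m: "m \<in> points M"
  shows "core_defect a (\<lambda>m. 0) m = 0"
    and "anch_defect a s (\<lambda>m. 0) m = - (hom_conn M (conn1 V) (conn1 W') a F_hor s m - bdry W m (\<Phi> m (a m) (s m)))"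
proof -
  note sub = vector_bundleD(3)[OF fac(4) pts(2)[OF m]] and sub' = vector_bundleD(3)[OF fac'(4) pts(4)[OF m]]
    and subB = vector_bundleD(3)[OF fac(3) pts(1)[OF m]]
  have "F_c q 0 = 0" if "q \<in> points M" for q
    by (rule lin_on_0[OF bundle_mapD(1)[OF Fc pts(2)[OF that]] vector_bundleD(3)[OF fac(4) pts(2)[OF that]]])
  then have "cv (\<lambda>m. 0) = (\<lambda>m. 0)" "F_c m 0 = 0"
    using m by (auto simp: apply_map_def off_zero_def)
  moreover have "bdry V m 0 = 0" "bdry W m 0 = 0" "F_hor m 0 = 0" "\<Phi> m (a m) 0 = 0"
    using lin_on_0[OF bundle_mapD(1)[OF rf(6) pts(2)[OF m]] sub] lin_on_0[OF bundle_mapD(1)[OF rf'(6) pts(4)[OF m]] sub']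
      lin_on_0[OF bundle_mapD(1)[OF Fh pts(1)[OF m]] subB]
      lin_on_0[OF hom_one_formsD(1)[OF \<Phi> m sectionsD(1)[OF fac(2) a m]] subB] .
  ultimately show "core_defect a (\<lambda>m. 0) m = 0"
    and "anch_defect a s (\<lambda>m. 0) m = - (hom_conn M (conn1 V) (conn1 W') a F_hor s m - bdry W m (\<Phi> m (a m) (s m)))"
    using connection_zero[OF rf(4) a fac(4), of m] connection_zero[OF rf'(4) secs(1)[OF a] fac'(4), of m]
    by (simp_all add: core_defect_def anch_defect_def hom_conn_def W'_simps)
qed

private lemma ruth_morphism_iff:
  "ruth_morphism_over A V W F_ver F_c F_hor \<Phi> \<longleftrightarrow>
     (\<forall>m\<in>points M. \<forall>e\<in>fibre C m. F_hor m (bdry V m e) = bdry W m (F_c m e)) \<and>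
     (\<forall>a\<in>\<Gamma> (vbun A). \<forall>c\<in>\<Gamma> C. \<forall>m\<in>points M. core_defect a c m = 0) \<and>
     (\<forall>a\<in>\<Gamma> (vbun A). \<forall>s\<in>\<Gamma> B. \<forall>m\<in>points M.
        hom_conn M (conn1 V) (conn1 W') a F_hor s m = bdry W m (\<Phi> m (a m) (s m))) \<and>
     (\<forall>a\<in>\<Gamma> (vbun A). \<forall>b\<in>\<Gamma> (vbun A). \<forall>s\<in>\<Gamma> B. \<forall>m\<in>points M. koszul_defect a b s m = 0)"
  using Fh Fc \<Phi>
  by (simp add: ruth_morphism_over_def ruth_morphism_def Let_def rf(2,3) W'_simps(3-5) core_defect_def koszul_defect_def)

lemma vb_algebroid_morphism_iff_ruth_morphism:
  "vb_algebroid_morphism A B C D A' B' C' D' F \<longleftrightarrow>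
     la_morphism A A' id (total_map F_ver) \<and> ruth_morphism_over A V W F_ver F_c F_hor \<Phi>"
proof -
  let ?bd = "\<forall>m\<in>points M. \<forall>e\<in>fibre C m. F_hor m (bdry V m e) = bdry W m (F_c m e)"
    and ?hor = "\<forall>a\<in>\<Gamma> (vbun A). \<forall>s\<in>\<Gamma> B. \<forall>m\<in>points M.
        hom_conn M (conn1 V) (conn1 W') a F_hor s m = bdry W m (\<Phi> m (a m) (s m))"
  note z = sections_0[OF fac(4)] and zA = sections_0[OF fac(2)] and zB = sections_0[OF fac(3)]
  have anch: "(\<forall>a\<in>\<Gamma> (vbun A). \<forall>s\<in>\<Gamma> B. \<forall>c\<in>\<Gamma> C. \<forall>m\<in>points M. anch_defect a s c m = 0) \<longleftrightarrow> ?bd \<and> ?hor"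
  proof (intro iffI conjI; (elim conjE)?)
    assume 0: "\<forall>a\<in>\<Gamma> (vbun A). \<forall>s\<in>\<Gamma> B. \<forall>c\<in>\<Gamma> C. \<forall>m\<in>points M. anch_defect a s c m = 0"
    then show hor: ?hor using defects_zero(2) z by (metis eq_iff_diff_eq_0 neg_equal_0_iff_equal)
    show ?bd
    proof (intro ballI)
      fix m e assume m: "m \<in> points M" and "e \<in> fibre C m"
      then obtain c where c: "c \<in> \<Gamma> C" "c m = e" using section_through[OF fac(4) pts(2)[OF m]] by blast
      \<comment> \<open>At zero a and s the connection part cancels by \<open>hor\<close>, leaving
        the boundary equation at e.\<close>
      have "anch_defect (\<lambda>m. 0) (\<lambda>m. 0) c m = 0" using 0 zA zB c(1) m by blast
      moreover have "hom_conn M (conn1 V) (conn1 W') (\<lambda>m. 0) F_hor (\<lambda>m. 0) m = bdry W m (\<Phi> m 0 0)"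
        using hor zA zB m by blast
      ultimately show "F_hor m (bdry V m e) = bdry W m (F_c m e)" using c(2) by (simp add: anch_defect_def)
    qed
  next
    assume bd: ?bd and hor: ?hor
    show "\<forall>a\<in>\<Gamma> (vbun A). \<forall>s\<in>\<Gamma> B. \<forall>c\<in>\<Gamma> C. \<forall>m\<in>points M. anch_defect a s c m = 0"
    proof (intro ballI)
      fix a s c m assume "a \<in> \<Gamma> (vbun A)" "s \<in> \<Gamma> B" "c \<in> \<Gamma> C" and m: "m \<in> points M"
      then show "anch_defect a s c m = 0"
        using bd hor sectionsD(1)[OF fac(4) _ pts(2)[OF m], of c] by (simp add: anch_defect_def)
    qed
  qed
  have br: "(\<forall>a\<in>\<Gamma> (vbun A). \<forall>b\<in>\<Gamma> (vbun A). \<forall>s\<in>\<Gamma> B. \<forall>c\<in>\<Gamma> C. \<forall>d\<in>\<Gamma> C. \<forall>m\<in>points M.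
        ver_defect a b m = 0 \<and> core_defect a d m - core_defect b c m + koszul_defect a b s m = 0) \<longleftrightarrow>
      (\<forall>a\<in>\<Gamma> (vbun A). \<forall>b\<in>\<Gamma> (vbun A). \<forall>m\<in>points M. ver_defect a b m = 0) \<and>
      (\<forall>a\<in>\<Gamma> (vbun A). \<forall>c\<in>\<Gamma> C. \<forall>m\<in>points M. core_defect a c m = 0) \<and>
      (\<forall>a\<in>\<Gamma> (vbun A). \<forall>b\<in>\<Gamma> (vbun A). \<forall>s\<in>\<Gamma> B. \<forall>m\<in>points M. koszul_defect a b s m = 0)"
    (is "?L \<longleftrightarrow> ?ver \<and> ?core \<and> ?kos")
  proof (intro iffI conjI)
    assume L: ?L
    show ?ver using L zB z by blast
    show kos: ?kos
    proof (intro ballI)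
      fix a b s m assume a: "a \<in> \<Gamma> (vbun A)" and b: "b \<in> \<Gamma> (vbun A)" and s: "s \<in> \<Gamma> B" and m: "m \<in> points M"
      have "core_defect a (\<lambda>m. 0) m - core_defect b (\<lambda>m. 0) m + koszul_defect a b s m = 0"
        using L a b s z m by blast
      then show "koszul_defect a b s m = 0" by (simp add: defects_zero(1)[OF a m] defects_zero(1)[OF b m])
    qed
    show ?core
    proof (intro ballI)
      fix a c m assume a: "a \<in> \<Gamma> (vbun A)" and c: "c \<in> \<Gamma> C" and m: "m \<in> points M"
      \<comment> \<open>With b equal to a, and with s and the other core section zero, every term
        except \<open>core_defect a c m\<close> is already known to vanish.\<close>
      have "core_defect a c m - core_defect a (\<lambda>m. 0) m + koszul_defect a a (\<lambda>m. 0) m = 0"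
        using L a c z zB m by blast
      moreover have "koszul_defect a a (\<lambda>m. 0) m = 0" using kos a zB m by blast
      ultimately show "core_defect a c m = 0" by (simp add: defects_zero(1)[OF a m])
    qed
  next
    assume "?ver \<and> ?core \<and> ?kos"
    then show ?L by simp
  qed
  show ?thesis
    unfolding vb_algebroid_morphism_iff la_D_iff anchor_compatible_D_iff la_ver_iff ruth_morphism_iff anch br
    by (simp only: conj_ac)
qed

end

theorem theorem4p11:
  fixes M :: "('m, 'e::euclidean_space) manifold"
    and A :: "('m, 'e, 'a::real_vector, 'fa::euclidean_space) lie_algd"
    and A' :: "('m, 'e, 'a'::real_vector, 'fa'::euclidean_space) lie_algd"
    and B :: "('m, 'e, 'b::real_vector, 'fb::euclidean_space) vbundle"
    and C :: "('m, 'e, 'c::real_vector, 'fc::euclidean_space) vbundle"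
    and B' :: "('m, 'e, 'b'::real_vector, 'fb'::euclidean_space) vbundle"
    and C' :: "('m, 'e, 'c'::real_vector, 'fc'::euclidean_space) vbundle"
    and D :: "('m \<times> 'b, 'e \<times> 'fb, 'a \<times> 'c, 'fa \<times> 'fc) lie_algd"
    and D' :: "('m \<times> 'b', 'e \<times> 'fb', 'a' \<times> 'c', 'fa' \<times> 'fc') lie_algd"
    and V :: "('m, 'e, 'a, 'c, 'fc, 'b, 'fb) ruth"
    and W :: "('m, 'e, 'a', 'c', 'fc', 'b', 'fb') ruth"
    and F :: "'m \<times> 'a \<times> 'b \<times> 'c \<Rightarrow> 'm \<times> 'a' \<times> 'b' \<times> 'c'"
    and F_ver :: "'m \<Rightarrow> 'a \<Rightarrow> 'a'"
    and F_hor :: "'m \<Rightarrow> 'b \<Rightarrow> 'b'"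
    and F_c :: "'m \<Rightarrow> 'c \<Rightarrow> 'c'"
    and \<Phi> :: "'m \<Rightarrow> 'a \<Rightarrow> 'b \<Rightarrow> 'c'"
  assumes "smooth_manifold M"
    and "lie_algebroid A" "base (vbun A) = M"
    and "lie_algebroid A'" "base (vbun A') = M"
    and "vector_bundle B" "base B = M"
    and "vector_bundle C" "base C = M"
    and "vector_bundle B'" "base B' = M"
    and "vector_bundle C'" "base C' = M"
    and "vb_algebroid A B C D"
    and "vb_algebroid A' B' C' D'"
    and "associated_ruth A B C D V"
    and "associated_ruth A' B' C' D' W"
    and "dvb_morphism (vbun A) B C (vbun A') B' C' id F"
    and "bundle_map (vbun A) (vbun A') F_ver"
    and "bundle_map B B' F_hor"
    and "bundle_map C C' F_c"
    and "\<Phi> \<in> hom_one_forms (vbun A) B C'"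
    and "\<And>m a b c. m \<in> points M \<Longrightarrow> a \<in> fibre (vbun A) m \<Longrightarrow> b \<in> fibre B m \<Longrightarrow> c \<in> fibre C m \<Longrightarrow>
           F (m, a, b, c) = (m, F_ver m a, F_hor m b, F_c m c + \<Phi> m a b)"
  shows "vb_algebroid_morphism A B C D A' B' C' D' F \<longleftrightarrow>
           la_morphism A A' id (total_map F_ver) \<and> ruth_morphism_over A V W F_ver F_c F_hor \<Phi>"
  by (rule vb_algebroid_morphism_iff_ruth_morphism) (use assms in simp_all)

end
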